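(* Let $R$ be a regular Noetherian commutative ring of prime characteristic $p > 0$, with perfect closure $R^\infty$. Let $L$ be any $R$-module. Then \[ \mathrm{sK}_{R^\infty}(L \otimes_R R^\infty) = \bigcup_{\mathfrak{q} \in \mathrm{Ass}_R(L)} \mathrm{sK}_{R^\infty}(R^\infty/\mathfrak{q} R^\infty). \]
   Context: All rings are commutative with unity. For a ring $A$ and an $A$-module $N$, the set $\mathrm{sK}_A(N)$ of strong Krull primes of $N$ is the set of all $\mathfrak{p} \in \mathrm{Spec}\, A$ such that for every finitely generated ideal $I$ of $A$ with $I \subseteq \mathfrak{p}$ there is an element $z \in N$ with $I \subseteq \mathrm{ann}_A(z) \subseteq \mathfrak{p}$. $\mathrm{Ass}_R(L)$ denotes the set of associated primes of $L$, i.e. primes of the form $\mathrm{ann}_R(z)$ with $z \in L$. For a reduced ring $R$ of prime characteristic $p > 0$, the perfect closure $R^\infty \supseteq R$ is the ring obtained from $R$ by adjoining unique $p^n$th roots of all elements of $R$ for all $n \in \mathbb{N}$ (equivalently, the direct limit of $R \to R \to R \to \cdots$ where each map is the Frobenius endomorphism). A Noetherian ring is regular if its localization at every prime ideal is a regular local ring (such a ring is reduced). *)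

theory Defs
  imports
    "HOL-Algebra.Algebra"
    "HOL-Algebra.Free_Abelian_Groups"
    "HOL-Library.Extended_Nat"
begin

definition annihilator :: "('a, 'r) ring_scheme \<Rightarrow> ('a, 'b, 'm) module_scheme \<Rightarrow> 'b \<Rightarrow> 'a set"
  where "annihilator R M z = {a \<in> carrier R. a \<odot>\<^bsub>M\<^esub> z = \<zero>\<^bsub>M\<^esub>}"

definition associated_primes :: "('a, 'r) ring_scheme \<Rightarrow> ('a, 'b, 'm) module_scheme \<Rightarrow> 'a set set"
  where "associated_primes R M = {P. primeideal P R \<and> (\<exists>z \<in> carrier M. P = annihilator R M z)}"

definition fg_ideal :: "'a set \<Rightarrow> ('a, 'r) ring_scheme \<Rightarrow> bool"
  where "fg_ideal I R \<longleftrightarrow> (\<exists>G \<subseteq> carrier R. finite G \<and> I = Idl\<^bsub>R\<^esub> G)"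

definition strong_krull_primes :: "('a, 'r) ring_scheme \<Rightarrow> ('a, 'b, 'm) module_scheme \<Rightarrow> 'a set set"
  where "strong_krull_primes R M =
    {P. primeideal P R \<and>
        (\<forall>I. fg_ideal I R \<and> I \<subseteq> P \<longrightarrow>
          (\<exists>z \<in> carrier M. I \<subseteq> annihilator R M z \<and> annihilator R M z \<subseteq> P))}"

text \<open>The Krull dimension is the supremum of the lengths \<open>n\<close> of strict chains
  \<open>P 0 \<subset> \<dots> \<subset> P n\<close> of prime ideals. (The zero ring gets \<open>0\<close>; it is never local.)\<close>

definition krull_dim :: "('a, 'r) ring_scheme \<Rightarrow> enat"
  where "krull_dim R =
    (SUP n \<in> {n. \<exists>P. (\<forall>i\<le>n. primeideal (P i) R) \<and> (\<forall>i<n. P i \<subset> P (Suc i))}. enat n)"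

definition min_generators :: "('a, 'r) ring_scheme \<Rightarrow> 'a set \<Rightarrow> nat"
  where "min_generators R I =
    (LEAST n. \<exists>G \<subseteq> carrier R. finite G \<and> card G = n \<and> I = Idl\<^bsub>R\<^esub> G)"

definition regular_local_ring :: "('a, 'r) ring_scheme \<Rightarrow> bool"
  where "regular_local_ring R \<longleftrightarrow> cring R \<and> noetherian_ring R \<and>
    (\<exists>M. (\<forall>I. maximalideal I R \<longleftrightarrow> I = M) \<and> enat (min_generators R M) = krull_dim R)"

text \<open>The localization at a prime \<open>P\<close> consists of classes of pairs \<open>(a, s)\<close>, standing for \<open>a / s\<close>
  with \<open>s \<notin> P\<close>. As for \<open>FactRing\<close>, operations on classes are unions over all
  representatives.\<close>

definition loc_rel :: "('a, 'r) ring_scheme \<Rightarrow> 'a set \<Rightarrow> (('a \<times> 'a) \<times> ('a \<times> 'a)) set"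
  where "loc_rel R P =
    {((a, s), (b, t)) | a s b t. a \<in> carrier R \<and> b \<in> carrier R \<and>
       s \<in> carrier R - P \<and> t \<in> carrier R - P \<and>
       (\<exists>u \<in> carrier R - P. u \<otimes>\<^bsub>R\<^esub> (a \<otimes>\<^bsub>R\<^esub> t) = u \<otimes>\<^bsub>R\<^esub> (b \<otimes>\<^bsub>R\<^esub> s))}"

definition localization :: "('a, 'r) ring_scheme \<Rightarrow> 'a set \<Rightarrow> ('a \<times> 'a) set ring"
  where "localization R P =
    \<lparr>carrier = (carrier R \<times> (carrier R - P)) // loc_rel R P,
     monoid.mult = (\<lambda>A B. \<Union>(a, s)\<in>A. \<Union>(b, t)\<in>B. loc_rel R P `` {(a \<otimes>\<^bsub>R\<^esub> b, s \<otimes>\<^bsub>R\<^esub> t)}),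
     monoid.one = loc_rel R P `` {(\<one>\<^bsub>R\<^esub>, \<one>\<^bsub>R\<^esub>)},
     ring.zero = loc_rel R P `` {(\<zero>\<^bsub>R\<^esub>, \<one>\<^bsub>R\<^esub>)},
     ring.add = (\<lambda>A B. \<Union>(a, s)\<in>A. \<Union>(b, t)\<in>B.
              loc_rel R P `` {(a \<otimes>\<^bsub>R\<^esub> t \<oplus>\<^bsub>R\<^esub> b \<otimes>\<^bsub>R\<^esub> s, s \<otimes>\<^bsub>R\<^esub> t)})\<rparr>"

definition regular_noetherian_ring :: "('a, 'r) ring_scheme \<Rightarrow> bool"
  where "regular_noetherian_ring R \<longleftrightarrow> cring R \<and> noetherian_ring R \<and>
    (\<forall>P. primeideal P R \<longrightarrow> regular_local_ring (localization R P))"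

definition has_characteristic :: "('a, 'r) ring_scheme \<Rightarrow> nat \<Rightarrow> bool"
  where "has_characteristic R p \<longleftrightarrow> (\<forall>n::nat. [n] \<cdot>\<^bsub>R\<^esub> \<one>\<^bsub>R\<^esub> = \<zero>\<^bsub>R\<^esub> \<longleftrightarrow> p dvd n)"

text \<open>The perfect closure is the direct limit of \<open>R \<rightarrow> R \<rightarrow> R \<rightarrow> \<dots>\<close> along the Frobenius
  map. The pair \<open>(m, a)\<close> is the element \<open>a\<close> of the \<open>m\<close>-th copy of \<open>R\<close>, i.e. it stands for the
  \<open>p^m\<close>-th root of \<open>a\<close>; two pairs are identified iff they agree in some later copy of \<open>R\<close>.\<close>

definition perf_rel :: "('a, 'r) ring_scheme \<Rightarrow> nat \<Rightarrow> ((nat \<times> 'a) \<times> (nat \<times> 'a)) set"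
  where "perf_rel R p =
    {((m, a), (n, b)) | m a n b. a \<in> carrier R \<and> b \<in> carrier R \<and>
       (\<exists>k. m \<le> k \<and> n \<le> k \<and> a [^]\<^bsub>R\<^esub> (p ^ (k - m)) = b [^]\<^bsub>R\<^esub> (p ^ (k - n)))}"

text \<open>For the operations, \<open>(m, a)\<close> and \<open>(n, b)\<close> are first moved to the copy with index \<open>m + n\<close>.\<close>

definition perfect_closure :: "('a, 'r) ring_scheme \<Rightarrow> nat \<Rightarrow> (nat \<times> 'a) set ring"
  where "perfect_closure R p =
    \<lparr>carrier = (UNIV \<times> carrier R) // perf_rel R p,
     monoid.mult = (\<lambda>A B. \<Union>(m, a)\<in>A. \<Union>(n, b)\<in>B. perf_rel R p ``
              {(m + n, a [^]\<^bsub>R\<^esub> (p ^ n) \<otimes>\<^bsub>R\<^esub> b [^]\<^bsub>R\<^esub> (p ^ m))}),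
     monoid.one = perf_rel R p `` {(0, \<one>\<^bsub>R\<^esub>)},
     ring.zero = perf_rel R p `` {(0, \<zero>\<^bsub>R\<^esub>)},
     ring.add = (\<lambda>A B. \<Union>(m, a)\<in>A. \<Union>(n, b)\<in>B. perf_rel R p ``
              {(m + n, a [^]\<^bsub>R\<^esub> (p ^ n) \<oplus>\<^bsub>R\<^esub> b [^]\<^bsub>R\<^esub> (p ^ m))})\<rparr>"

definition perfect_embed :: "('a, 'r) ring_scheme \<Rightarrow> nat \<Rightarrow> 'a \<Rightarrow> (nat \<times> 'a) set"
  where "perfect_embed R p a = perf_rel R p `` {(0, a)}"

text \<open>For a ring homomorphism \<open>f\<close> from \<open>R\<close> to \<open>S\<close> and an \<open>R\<close>-module \<open>L\<close>, the \<open>S\<close>-module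
  \<open>L \<otimes> S\<close> over \<open>R\<close> is the free abelian group on the symbols \<open>(x, s)\<close> modulo the
  usual relations, with \<open>S\<close> acting on the second component.\<close>

definition tensor_relators ::
    "('a, 'r) ring_scheme \<Rightarrow> ('c, 's) ring_scheme \<Rightarrow> ('a \<Rightarrow> 'c) \<Rightarrow> ('a, 'b, 'm) module_scheme
      \<Rightarrow> ('b \<times> 'c \<Rightarrow>\<^sub>0 int) set"
  where "tensor_relators R S f L =
    {frag_of (x \<oplus>\<^bsub>L\<^esub> y, s) - frag_of (x, s) - frag_of (y, s) | x y s.
       x \<in> carrier L \<and> y \<in> carrier L \<and> s \<in> carrier S} \<union>
    {frag_of (x, s \<oplus>\<^bsub>S\<^esub> t) - frag_of (x, s) - frag_of (x, t) | x s t.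
       x \<in> carrier L \<and> s \<in> carrier S \<and> t \<in> carrier S} \<union>
    {frag_of (r \<odot>\<^bsub>L\<^esub> x, s) - frag_of (x, f r \<otimes>\<^bsub>S\<^esub> s) | r x s.
       r \<in> carrier R \<and> x \<in> carrier L \<and> s \<in> carrier S}"

text \<open>The fields \<open>mult\<close> and \<open>one\<close> of a module record play no role in the locale
  \<open>module\<close>.\<close>

definition base_change ::
    "('a, 'r) ring_scheme \<Rightarrow> ('c, 's) ring_scheme \<Rightarrow> ('a \<Rightarrow> 'c) \<Rightarrow> ('a, 'b, 'm) module_scheme
      \<Rightarrow> ('c, ('b \<times> 'c \<Rightarrow>\<^sub>0 int) set) module"
  where "base_change R S f L =
    (let F = free_Abelian_group (carrier L \<times> carrier S);
         H = generate F (tensor_relators R S f L)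
     in \<lparr>carrier = carrier (F Mod H), monoid.mult = undefined, monoid.one = undefined,
         ring.zero = \<one>\<^bsub>F Mod H\<^esub>, ring.add = monoid.mult (F Mod H),
         smult = (\<lambda>s A. \<Union>c\<in>A. H #>\<^bsub>F\<^esub> frag_extend (\<lambda>(x, t). frag_of (x, s \<otimes>\<^bsub>S\<^esub> t)) c)\<rparr>)"

definition quotient_module :: "('a, 'r) ring_scheme \<Rightarrow> 'a set \<Rightarrow> ('a, 'a set) module"
  where "quotient_module R I =
    ring.extend (R Quot I) \<lparr>smult = (\<lambda>a A. (I +>\<^bsub>R\<^esub> a) \<otimes>\<^bsub>R Quot I\<^esub> A)\<rparr>"

end

(* The perfect closure is flat over a regular ring, because the Frobenius map is (Kunz), and for any
   flat ring homomorphism R -> S with R noetherian the strong Krull primes of the base change of L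
   are determined by the associated primes of L.

   For flatness of Frobenius we show that the relations between p-th powers a_i^p are spanned by the
   p-th powers of the relations between the a_i. By noetherian induction on the ideal generated by
   the a_i this reduces to a prime ideal P, and there it is enough to treat P locally at P. Krull's
   principal ideal theorem shows that the generators of P in the regular local ring at P form a
   regular sequence in every order; so do their p-th powers, and the relations between the members of
   such a sequence are the obvious ones.

   For the base change, let P be a strong Krull prime of the tensor product of L and S, and q its
   contraction to R. As q is finitely generated, flatness lets one assume that the element z that
   witnesses the condition for a given finitely generated ideal is a sum of tensors x_i (x) s_i with
   q x_i = 0. After multiplying z by an element of R outside q, the x_i become linearly independent
   modulo q. Then ann(x_i) = q, and ann(z) is the intersection of the ideals (qS : s_i), one of
   which lies in P. *)

theory Submission
  imports Defs
begin

section \<open>Saturation at a prime ideal\<close>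

text \<open>\<open>S = R^\<infinity>\<close> is usually not Noetherian, so finiteness arguments take
  place in \<open>R\<close>. Localization at \<open>P\<close> is replaced by saturation: a local
  statement is one about elements of \<open>R\<close> up to a multiplier outside \<open>P\<close>,
  and finite generation merges the multipliers into a single \<open>u\<close>. Flatness is kept as
  "every relation over \<open>S\<close> is an \<open>S\<close>-combination of relations over
  \<open>R\<close>"; this form passes through composites and direct limits and decides when a sum of
  tensors vanishes. The obstacle for Frobenius is that at a prime \<open>I\<close> relations lift
  only up to some \<open>u\<close> outside \<open>I\<close>. But then \<open>I + (u)\<close> is
  strictly larger, and the induction hypothesis for it absorbs \<open>u\<close>. Regular sequences
  are needed in every order because powers are introduced entry by entry: one has to cancel the
  changed entry modulo others, and others modulo the changed entry. In the last part
  \<open>q\<close> depends on \<open>P\<close> alone, not on the ideal being tested, so one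
  associated prime serves for all test ideals.\<close>

definition (in ring) colon :: "'a set \<Rightarrow> 'a \<Rightarrow> 'a set"
  where "colon I x = {r \<in> carrier R. r \<otimes> x \<in> I}"

text \<open>Localizing at the prime \<open>P\<close> and contracting back; this replaces working in the localization.\<close>

definition (in ring) saturation :: "'a set \<Rightarrow> 'a set \<Rightarrow> 'a set"
  where "saturation P I = {r \<in> carrier R. \<exists>u \<in> carrier R - P. u \<otimes> r \<in> I}"

context cring
begin

lemma idealD:
  assumes "ideal I R"
  shows "I \<subseteq> carrier R" "\<zero> \<in> I"
    "x \<in> I \<Longrightarrow> y \<in> I \<Longrightarrow> x \<oplus> y \<in> I"
    "x \<in> I \<Longrightarrow> y \<in> I \<Longrightarrow> x \<ominus> y \<in> I"
    "x \<in> I \<Longrightarrow> \<ominus> x \<in> I"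
    "a \<in> carrier R \<Longrightarrow> x \<in> I \<Longrightarrow> a \<otimes> x \<in> I"
    "a \<in> carrier R \<Longrightarrow> x \<in> I \<Longrightarrow> x \<otimes> a \<in> I"
    "x \<in> I \<Longrightarrow> x \<in> carrier R"
proof -
  interpret ideal I R by fact
  show "I \<subseteq> carrier R" "\<zero> \<in> I" "x \<in> I \<Longrightarrow> y \<in> I \<Longrightarrow> x \<oplus> y \<in> I" "x \<in> I \<Longrightarrow> \<ominus> x \<in> I"
    "a \<in> carrier R \<Longrightarrow> x \<in> I \<Longrightarrow> a \<otimes> x \<in> I" "a \<in> carrier R \<Longrightarrow> x \<in> I \<Longrightarrow> x \<otimes> a \<in> I"
    "x \<in> I \<Longrightarrow> x \<in> carrier R"
    using a_subset I_l_closed I_r_closed by auto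
  show "x \<in> I \<Longrightarrow> y \<in> I \<Longrightarrow> x \<ominus> y \<in> I"
    by (simp add: a_minus_def)
qed

lemma cring_idealI:
  assumes "I \<subseteq> carrier R" "\<zero> \<in> I"
    and "\<And>x y. x \<in> I \<Longrightarrow> y \<in> I \<Longrightarrow> x \<oplus> y \<in> I"
    and "\<And>a x. a \<in> carrier R \<Longrightarrow> x \<in> I \<Longrightarrow> a \<otimes> x \<in> I"
  shows "ideal I R"
proof (rule idealI[OF ring_axioms])
  show "subgroup I (add_monoid R)"
  proof (rule add.subgroupI)
    show "\<ominus> a \<in> I" if "a \<in> I" for a
    proof -
      have "\<ominus> a = (\<ominus> \<one>) \<otimes> a" using that assms(1) by (auto simp: l_minus)
      then show ?thesis using assms(4)[of "\<ominus> \<one>" a] that by simp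
    qed
  qed (use assms in auto)
  show "x \<otimes> a \<in> I" if "a \<in> I" "x \<in> carrier R" for a x using assms that by auto
  then show "a \<otimes> x \<in> I" if "a \<in> I" "x \<in> carrier R" for a x
    using that assms(1) m_comm by (metis subsetD)
qed

lemma primeidealD:
  assumes "primeideal P R"
  shows "ideal P R" "\<one> \<notin> P" "P \<subseteq> carrier R"
    "a \<in> carrier R \<Longrightarrow> b \<in> carrier R \<Longrightarrow> a \<otimes> b \<in> P \<Longrightarrow> a \<in> P \<or> b \<in> P"
    "a \<in> carrier R - P \<Longrightarrow> b \<in> carrier R - P \<Longrightarrow> a \<otimes> b \<in> carrier R - P"
proof -
  interpret primeideal P R by fact
  show "ideal P R" ..
  show "\<one> \<notin> P" using one_imp_carrier I_notcarr by blast
  show "P \<subseteq> carrier R" by (rule a_subset)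
  show "a \<in> carrier R \<Longrightarrow> b \<in> carrier R \<Longrightarrow> a \<otimes> b \<in> P \<Longrightarrow> a \<in> P \<or> b \<in> P" by (rule I_prime)
  show "a \<in> carrier R - P \<Longrightarrow> b \<in> carrier R - P \<Longrightarrow> a \<otimes> b \<in> carrier R - P"
    using I_prime by auto
qed

text \<open>Locally at \<open>P\<close>: a unit minus an element of the maximal ideal is a unit. The
  Nakayama arguments rest on this.\<close>

lemma minus_notin_prime:
  assumes "primeideal P R" "u \<in> carrier R - P" "x \<in> P"
  shows "u \<ominus> x \<in> carrier R - P"
proof -
  have x: "x \<in> carrier R" using primeidealD(3)[OF assms(1)] assms(3) by auto
  have "u = (u \<ominus> x) \<oplus> x" using assms x by (simp add: a_minus_def a_assoc l_neg)
  then have "u \<ominus> x \<notin> P"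
    using idealD(3)[OF primeidealD(1)[OF assms(1)], of "u \<ominus> x" x] assms by auto
  then show ?thesis using assms x by auto
qed

lemma colon_ideal:
  assumes "ideal I R" "x \<in> carrier R"
  shows "ideal (colon I x) R"
  using assms idealD[OF assms(1)] by (intro cring_idealI) (auto simp: colon_def l_distr m_assoc)

lemma colon_mono: "I \<subseteq> J \<Longrightarrow> colon I x \<subseteq> colon J x"
  by (auto simp: colon_def)

lemma subset_colon: "ideal I R \<Longrightarrow> x \<in> carrier R \<Longrightarrow> I \<subseteq> colon I x"
  using idealD by (auto simp: colon_def)

lemma mem_adjoin:
  "y \<in> I <+>\<^bsub>R\<^esub> PIdl x \<longleftrightarrow> (\<exists>i\<in>I. \<exists>r\<in>carrier R. y = i \<oplus> r \<otimes> x)"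
  unfolding set_add_def' cgenideal_def by blast

lemma adjoin_ideal: "ideal I R \<Longrightarrow> x \<in> carrier R \<Longrightarrow> ideal (I <+>\<^bsub>R\<^esub> PIdl x) R"
  by (simp add: add_ideals cgenideal_ideal)

lemma subset_adjoin:
  assumes "ideal I R" "x \<in> carrier R"
  shows "I \<subseteq> I <+>\<^bsub>R\<^esub> PIdl x" "x \<in> I <+>\<^bsub>R\<^esub> PIdl x"
proof -
  have "y \<in> I <+>\<^bsub>R\<^esub> PIdl x" if "y \<in> I" for y
    unfolding mem_adjoin
    by (rule bexI[of _ y], rule bexI[of _ \<zero>]) (use assms that idealD(8) in auto)
  then show "I \<subseteq> I <+>\<^bsub>R\<^esub> PIdl x" by blast
  show "x \<in> I <+>\<^bsub>R\<^esub> PIdl x" unfolding mem_adjoin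
    by (rule bexI[of _ \<zero>], rule bexI[of _ \<one>]) (use assms idealD in auto)
qed

lemma adjoin_subset:
  assumes "ideal J R" "I \<subseteq> J" "x \<in> J"
  shows "I <+>\<^bsub>R\<^esub> PIdl x \<subseteq> J"
proof
  fix y assume "y \<in> I <+>\<^bsub>R\<^esub> PIdl x"
  then obtain i r where "i \<in> I" "r \<in> carrier R" "y = i \<oplus> r \<otimes> x" unfolding mem_adjoin by auto
  then show "y \<in> J"
    using idealD(3)[OF assms(1), of i "r \<otimes> x"] idealD(6)[OF assms(1), of r x] assms by auto
qed

lemma adjoin_mono: "I \<subseteq> J \<Longrightarrow> I <+>\<^bsub>R\<^esub> PIdl x \<subseteq> J <+>\<^bsub>R\<^esub> PIdl x"
  unfolding subset_iff mem_adjoin by blast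

lemma Idl_insert:
  assumes "A \<subseteq> carrier R" "x \<in> carrier R"
  shows "Idl (insert x A) = Idl A <+>\<^bsub>R\<^esub> PIdl x"
proof (rule subset_antisym)
  have I: "ideal (Idl A) R" using assms by (simp add: genideal_ideal)
  have "insert x A \<subseteq> Idl A <+>\<^bsub>R\<^esub> PIdl x"
    using subset_adjoin[OF I assms(2)] genideal_self[OF assms(1)] by auto
  then show "Idl (insert x A) \<subseteq> Idl A <+>\<^bsub>R\<^esub> PIdl x"
    using genideal_minimal adjoin_ideal[OF I assms(2)] by blast
  have J: "ideal (Idl (insert x A)) R" using assms by (simp add: genideal_ideal)
  have "insert x A \<subseteq> Idl (insert x A)" using assms by (intro genideal_self) auto
  then show "Idl A <+>\<^bsub>R\<^esub> PIdl x \<subseteq> Idl (insert x A)"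
    by (intro adjoin_subset[OF J] genideal_minimal[OF J]) auto
qed

lemma Idl_empty: "Idl {} = {\<zero>}"
  using genideal_minimal[OF zeroideal] genideal_ideal[of "{}"] idealD(2) by blast

lemma Idl_mono: "A \<subseteq> B \<Longrightarrow> B \<subseteq> carrier R \<Longrightarrow> Idl A \<subseteq> Idl B"
  by (meson genideal_ideal genideal_minimal genideal_self order_trans)

lemma saturation_ideal:
  assumes P: "primeideal P R" and I: "ideal I R"
  shows "ideal (saturation P I) R"
proof (rule cring_idealI)
  note [simp] = idealD[OF I]
  show "saturation P I \<subseteq> carrier R" by (auto simp: saturation_def)
  show "\<zero> \<in> saturation P I"
    using primeidealD(2)[OF P] by (auto simp: saturation_def intro!: bexI[of _ \<one>])
  fix x y assume "x \<in> saturation P I" "y \<in> saturation P I"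
  then obtain u v where u: "u \<in> carrier R - P" "u \<otimes> x \<in> I" and v: "v \<in> carrier R - P" "v \<otimes> y \<in> I"
    and xy: "x \<in> carrier R" "y \<in> carrier R" by (auto simp: saturation_def)
  have "(u \<otimes> v) \<otimes> (x \<oplus> y) = v \<otimes> (u \<otimes> x) \<oplus> u \<otimes> (v \<otimes> y)"
    using u(1) v(1) xy by simp algebra
  also have "\<dots> \<in> I" using u v by auto
  finally show "x \<oplus> y \<in> saturation P I"
    using primeidealD(5)[OF P u(1) v(1)] xy unfolding saturation_def by blast
next
  fix a x assume a: "a \<in> carrier R" and "x \<in> saturation P I"
  then obtain u where u: "u \<in> carrier R - P" "u \<otimes> x \<in> I" and x: "x \<in> carrier R"
    by (auto simp: saturation_def)
  have "u \<otimes> (a \<otimes> x) = a \<otimes> (u \<otimes> x)" using u(1) a x by (simp add: m_lcomm)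
  also have "\<dots> \<in> I" using u a idealD(6)[OF I] by auto
  finally show "a \<otimes> x \<in> saturation P I" using u a x by (auto simp: saturation_def)
qed

lemma saturation_mono: "I \<subseteq> J \<Longrightarrow> saturation P I \<subseteq> saturation P J"
  by (auto simp: saturation_def)

lemma subset_saturation:
  assumes "primeideal P R" "ideal I R"
  shows "I \<subseteq> saturation P I"
  using primeidealD(2)[OF assms(1)] idealD(8)[OF assms(2)]
  by (auto simp: saturation_def intro!: bexI[of _ \<one>])

lemma saturationI: "u \<in> carrier R - P \<Longrightarrow> u \<otimes> x \<in> I \<Longrightarrow> x \<in> carrier R \<Longrightarrow> x \<in> saturation P I"
  by (auto simp: saturation_def)

lemma saturationE:
  assumes "x \<in> saturation P I"
  obtains u where "u \<in> carrier R - P" "u \<otimes> x \<in> I" "x \<in> carrier R"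
  using assms by (auto simp: saturation_def)

lemma saturation_idem:
  assumes P: "primeideal P R"
  shows "saturation P (saturation P I) \<subseteq> saturation P I"
proof
  fix x assume "x \<in> saturation P (saturation P I)"
  then obtain u v where u: "u \<in> carrier R - P" and v: "v \<in> carrier R - P" "v \<otimes> (u \<otimes> x) \<in> I"
    and x: "x \<in> carrier R" by (auto simp: saturation_def)
  have "(v \<otimes> u) \<otimes> x \<in> I" using u v x by (simp add: m_assoc)
  then show "x \<in> saturation P I" using primeidealD(5)[OF P v(1) u] x by (intro saturationI)
qed

lemma saturation_subset:
  assumes "primeideal P R" "I \<subseteq> saturation P J"
  shows "saturation P I \<subseteq> saturation P J"
  using saturation_mono[OF assms(2), of P] saturation_idem[OF assms(1)] by blast

text \<open>A prime inside \<open>P\<close> survives localization at \<open>P\<close> and is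
  recovered by contraction.\<close>

lemma saturation_prime:
  assumes "primeideal Q R" "Q \<subseteq> P"
  shows "saturation P Q \<subseteq> Q"
proof
  fix x assume "x \<in> saturation P Q"
  then obtain u where "u \<in> carrier R - P" "u \<otimes> x \<in> Q" "x \<in> carrier R" by (rule saturationE)
  then show "x \<in> Q" using primeidealD(4)[OF assms(1), of u x] assms(2) by auto
qed

lemma saturation_colon:
  assumes "saturation P I \<subseteq> I" "x \<in> carrier R"
  shows "saturation P (colon I x) \<subseteq> colon I x"
proof
  fix r assume "r \<in> saturation P (colon I x)"
  then obtain u where u: "u \<in> carrier R - P" "(u \<otimes> r) \<otimes> x \<in> I" "r \<in> carrier R"
    by (auto simp: saturation_def colon_def)
  then have "u \<otimes> (r \<otimes> x) \<in> I" using assms(2) by (simp add: m_assoc)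
  then have "r \<otimes> x \<in> saturation P I" using u assms by (intro saturationI[of u]) auto
  then show "r \<in> colon I x" using assms u by (auto simp: colon_def)
qed

text \<open>The hypothesis \<open>step\<close> says that \<open>N\<close> lies in
  \<open>N' + x N\<close> locally at \<open>P\<close>. Instead of using a determinant, the
  generators in \<open>H\<close> are discarded one at a time.\<close>

lemma nakayama_generators:
  assumes P: "primeideal P R" and N: "ideal N R" and N': "ideal N' R" and x: "x \<in> P"
    and step: "\<And>k. k \<in> N \<Longrightarrow> \<exists>u \<in> carrier R - P. \<exists>r \<in> N. u \<otimes> k \<ominus> r \<otimes> x \<in> N'"
    and "finite H" "H \<subseteq> N" "N \<subseteq> saturation P (Idl (N' \<union> H))"
  shows "N \<subseteq> saturation P N'"
  using \<open>finite H\<close> assms(7,8)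
proof (induction H)
  case empty
  have "Idl N' = N'" using N' genideal_minimal[OF N'] genideal_self[OF idealD(1)[OF N']] by blast
  then show ?case using empty by simp
next
  case (insert h H)
  define J where "J = Idl (N' \<union> H)"
  have carr: "N' \<union> H \<subseteq> carrier R" "h \<in> carrier R" "x \<in> carrier R"
    using insert idealD(1)[OF N] idealD(1)[OF N'] primeidealD(3)[OF P] x by auto
  have J: "ideal J R" unfolding J_def by (rule genideal_ideal[OF carr(1)])
  note [simp] = idealD(8)[OF J] idealD(8)[OF N] idealD(8)[OF N']
  have sub: "N \<subseteq> saturation P (J <+>\<^bsub>R\<^esub> PIdl h)"
    using insert.prems(2) Idl_insert[OF carr(1,2)] by (simp add: J_def)
  obtain u r where u: "u \<in> carrier R - P" and r: "r \<in> N" "u \<otimes> h \<ominus> r \<otimes> x \<in> N'"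
    using step[of h] insert.prems by auto
  obtain v where v: "v \<in> carrier R - P" "v \<otimes> r \<in> J <+>\<^bsub>R\<^esub> PIdl h" using sub r(1) by (auto elim: saturationE)
  then obtain j c where j: "j \<in> J" and c: "c \<in> carrier R" and vr: "v \<otimes> r = j \<oplus> c \<otimes> h"
    unfolding mem_adjoin by auto
  define n where "n = u \<otimes> h \<ominus> r \<otimes> x"
  have nJ: "n \<in> J" using r(2) genideal_self[OF carr(1)] by (auto simp: n_def J_def)
  have uv: "v \<otimes> u \<ominus> c \<otimes> x \<in> carrier R - P"
    by (rule minus_notin_prime[OF P primeidealD(5)[OF P v(1) u]])
      (use c x idealD(6)[OF primeidealD(1)[OF P]] in auto)
  have "(v \<otimes> u \<ominus> c \<otimes> x) \<otimes> h = v \<otimes> (u \<otimes> h \<ominus> r \<otimes> x) \<oplus> (v \<otimes> r) \<otimes> x \<ominus> (c \<otimes> h) \<otimes> x"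
  proof -
    have "u \<in> carrier R" "v \<in> carrier R" "r \<in> carrier R" using u v r by auto
    with carr c show ?thesis by algebra
  qed
  also have "\<dots> = v \<otimes> n \<oplus> j \<otimes> x"
  proof -
    have "v \<in> carrier R" "j \<in> carrier R" "n \<in> carrier R" using v j nJ by auto
    with carr c show ?thesis unfolding vr n_def[symmetric] by algebra
  qed
  also have "\<dots> \<in> J" using nJ j v carr idealD[OF J] by auto
  finally have h: "h \<in> saturation P J" by (rule saturationI[OF uv _ carr(2)])
  have "J <+>\<^bsub>R\<^esub> PIdl h \<subseteq> saturation P J"
    by (rule adjoin_subset[OF saturation_ideal[OF P J] subset_saturation[OF P J] h])
  then have "N \<subseteq> saturation P J" using sub saturation_subset[OF P] by blast
  then show ?case using insert by (simp add: J_def)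
qed

end

section \<open>Krull's principal ideal theorem\<close>

locale noetherian_cring = cring + noetherian_ring

context noetherian_cring
begin

text \<open>A strictly ascending sequence of ideals would be a chain. By
  \<open>ideal_chain_is_trivial\<close> its union is one of its members, which the next member
  exceeds.\<close>

lemma noetherian_induct [consumes 1, case_names step]:
  assumes "ideal I R"
    and "\<And>I. ideal I R \<Longrightarrow> (\<And>J. ideal J R \<Longrightarrow> I \<subset> J \<Longrightarrow> Q J) \<Longrightarrow> Q I"
  shows "Q I"
proof -
  define r where "r = {(J, I). ideal I R \<and> ideal J R \<and> I \<subset> J}"
  have "wf r"
    unfolding wf_iff_no_infinite_down_chain
  proof
    assume "\<exists>f. \<forall>i. (f (Suc i), f i) \<in> r"
    then obtain f where "\<forall>i. (f (Suc i), f i) \<in> r" ..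
    then have f: "f i \<subset> f (Suc i)" "ideal (f i) R" for i by (simp_all add: r_def)
    then have mono: "mono f" by (intro mono_iff_le_Suc[THEN iffD2]) auto
    have "f i \<subseteq> f j \<or> f j \<subseteq> f i" for i j
      using mono by (metis monoD nat_le_linear)
    then have "subset.chain {I. ideal I R} (range f)"
      using f(2) by (auto simp: pred_on.chain_def)
    then have "\<Union>(range f) \<in> range f" by (intro ideal_chain_is_trivial) auto
    then obtain n where "\<Union>(range f) = f n" by auto
    then show False using f(1)[of n] by blast
  qed
  then show ?thesis using \<open>ideal I R\<close>
  proof (induction I rule: wf_induct_rule)
    case (less I)
    show ?case by (rule assms(2)) (use less in \<open>auto simp: r_def\<close>)
  qed
qed

lemma nakayama:
  assumes P: "primeideal P R" and N: "ideal N R" and N': "ideal N' R" and x: "x \<in> P"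
    and step: "\<And>k. k \<in> N \<Longrightarrow> \<exists>u \<in> carrier R - P. \<exists>r \<in> N. u \<otimes> k \<ominus> r \<otimes> x \<in> N'"
  shows "N \<subseteq> saturation P N'"
proof -
  obtain H where H: "H \<subseteq> carrier R" "finite H" "N = Idl H" using finetely_gen[OF N] by blast
  have HN: "H \<subseteq> N" using H genideal_self by auto
  have c: "N' \<union> H \<subseteq> carrier R" using H(1) idealD(1)[OF N'] by auto
  have "N \<subseteq> Idl (N' \<union> H)" unfolding H(3) by (rule Idl_mono) (use c in auto)
  also have "\<dots> \<subseteq> saturation P (Idl (N' \<union> H))"
    by (rule subset_saturation[OF P genideal_ideal[OF c]])
  finally show ?thesis using nakayama_generators[OF P N N' x step H(2) HN] by blast
qed

text \<open>By \<open>only\<close>, the localization of \<open>R/I\<close> at \<open>P\<close> is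
  artinian; this is its descending chain condition, for saturated ideals. Noetherian induction on a
  common lower bound \<open>J\<close> takes the place of a composition series.\<close>

lemma descending_chain_stable:
  assumes P: "primeideal P R" and J: "ideal J R" "I \<subseteq> J"
    and only: "\<And>Q. primeideal Q R \<Longrightarrow> I \<subseteq> Q \<Longrightarrow> Q \<subseteq> P \<Longrightarrow> Q = P"
    and K: "\<And>n. ideal (K n) R" "\<And>n. saturation P (K n) \<subseteq> K n" "\<And>n. J \<subseteq> K n"
      "\<And>n. K (Suc n) \<subseteq> K n"
  shows "\<exists>N. \<forall>n\<ge>N. K n = K N"
  using J K
proof (induction J arbitrary: K rule: noetherian_induct)
  case (step J K)
  have K_le: "K n \<subseteq> K m" if "m \<le> n" for m n :: nat
    using lift_Suc_antimono_le[of K m n] step.prems(5) that by blast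
  have one: "K n = carrier R" if "\<one> \<in> K n" for n
    using ideal.one_imp_carrier[OF step.prems(2)] that by auto
  consider "\<not> saturation P J \<subseteq> J" | "J = carrier R"
    | "saturation P J \<subseteq> J" "primeideal J R"
    | a b where "saturation P J \<subseteq> J" "a \<in> carrier R" "b \<in> carrier R" "a \<otimes> b \<in> J" "a \<notin> J" "b \<notin> J"
    using step.hyps primeidealI[OF step.hyps cring_axioms] by blast
  then show ?case
  proof cases
    case 1
    have "J \<subset> saturation P J" using 1 subset_saturation[OF P step.hyps] by auto
    moreover have "saturation P J \<subseteq> K n" for n
      using saturation_mono[OF step.prems(4), of P n] step.prems(3)[of n] by auto
    ultimately show ?thesis
      using step.prems by (intro step.IH[OF saturation_ideal[OF P step.hyps]]) auto
  next
    case 2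
    then have "K n = carrier R" for n using step.prems(4)[of n] idealD(1)[OF step.prems(2)[of n]] by auto
    then show ?thesis by auto
  next
    case 3
    \<comment> \<open>A saturated ideal that meets the complement of \<open>P\<close> contains
      \<open>\<one>\<close>.\<close>
    have "J \<subseteq> P"
    proof
      fix u assume u: "u \<in> J"
      show "u \<in> P"
      proof (rule ccontr)
        assume "u \<notin> P"
        then have "\<one> \<in> saturation P J" using u idealD(8)[OF step.hyps] by (intro saturationI[of u]) auto
        then show False using 3 primeidealD(2)[OF 3(2)] by auto
      qed
    qed
    \<comment> \<open>Minimality of \<open>P\<close> over \<open>I\<close> enters here. Above
      \<open>P\<close> the only saturated ideals are \<open>P\<close> and the whole ring, so the
      chain can drop at most once.\<close>
    then have "J = P" using only 3 step.prems(1) by auto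
    have two: "K n = P \<or> K n = carrier R" for n
    proof (cases "K n \<subseteq> P")
      case True then show ?thesis using step.prems(4)[of n] \<open>J = P\<close> by auto
    next
      case False
      then obtain u where "u \<in> K n" "u \<notin> P" by auto
      then have "\<one> \<in> saturation P (K n)" using idealD(8)[OF step.prems(2)]
        by (intro saturationI[of u]) auto
      then show ?thesis using one step.prems(3)[of n] by auto
    qed
    show ?thesis
    proof (cases "\<exists>N. K N = P")
      case True
      then obtain N where "K N = P" ..
      then have "K n = K N" if "n \<ge> N" for n
        using K_le[OF that] step.prems(4)[of n] \<open>J = P\<close> by auto
      then show ?thesis by auto
    next
      case False
      then show ?thesis using two by auto
    qed
  next
    case 4
    \<comment> \<open>As \<open>J\<close> is not prime, both \<open>(J : a)\<close> and
      \<open>J + (a)\<close> are strictly larger, and the induction hypothesis stabilizes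
      \<open>(K n : a)\<close> and the saturation of \<open>K n + (a)\<close>. For nested saturated
      ideals these two determine \<open>K n\<close>.\<close>
    note a = 4(2)
    have c: "J \<subset> colon J a"
      using subset_colon[OF step.hyps a] 4 m_comm[OF 4(2,3)] by (auto simp: colon_def)
    have d: "J \<subset> J <+>\<^bsub>R\<^esub> PIdl a" using subset_adjoin[OF step.hyps a] 4 by auto
    have Ka: "ideal (K n <+>\<^bsub>R\<^esub> PIdl a) R" for n by (rule adjoin_ideal[OF step.prems(2) a])
    have "\<exists>N. \<forall>n\<ge>N. colon (K n) a = colon (K N) a"
    proof (rule step.IH[OF colon_ideal[OF step.hyps a] c])
      show "I \<subseteq> colon J a" using step.prems(1) c by blast
      fix n
      show "ideal (colon (K n) a) R" by (rule colon_ideal[OF step.prems(2) a])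
      show "saturation P (colon (K n) a) \<subseteq> colon (K n) a"
        by (rule saturation_colon[OF step.prems(3) a])
      show "colon J a \<subseteq> colon (K n) a" by (rule colon_mono[OF step.prems(4)])
      show "colon (K (Suc n)) a \<subseteq> colon (K n) a" by (rule colon_mono[OF step.prems(5)])
    qed
    moreover have "\<exists>N. \<forall>n\<ge>N. saturation P (K n <+>\<^bsub>R\<^esub> PIdl a) = saturation P (K N <+>\<^bsub>R\<^esub> PIdl a)"
    proof (rule step.IH[OF adjoin_ideal[OF step.hyps a] d])
      show "I \<subseteq> J <+>\<^bsub>R\<^esub> PIdl a" using step.prems(1) subset_adjoin(1)[OF step.hyps a] by blast
      fix n
      show "ideal (saturation P (K n <+>\<^bsub>R\<^esub> PIdl a)) R" by (rule saturation_ideal[OF P Ka])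
      show "saturation P (saturation P (K n <+>\<^bsub>R\<^esub> PIdl a)) \<subseteq> saturation P (K n <+>\<^bsub>R\<^esub> PIdl a)"
        by (rule saturation_idem[OF P])
      show "J <+>\<^bsub>R\<^esub> PIdl a \<subseteq> saturation P (K n <+>\<^bsub>R\<^esub> PIdl a)"
        using adjoin_mono[OF step.prems(4)] subset_saturation[OF P Ka] by blast
      show "saturation P (K (Suc n) <+>\<^bsub>R\<^esub> PIdl a) \<subseteq> saturation P (K n <+>\<^bsub>R\<^esub> PIdl a)"
        by (intro saturation_mono adjoin_mono step.prems(5))
    qed
    ultimately obtain N1 N2 where N1: "\<And>n. n \<ge> N1 \<Longrightarrow> colon (K n) a = colon (K N1) a"
      and N2: "\<And>n. n \<ge> N2 \<Longrightarrow> saturation P (K n <+>\<^bsub>R\<^esub> PIdl a) = saturation P (K N2 <+>\<^bsub>R\<^esub> PIdl a)"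
      by auto
    define N where "N = max N1 N2"
    have "K N \<subseteq> K n" if n: "n \<ge> N" for n
    proof
      fix k assume k: "k \<in> K N"
      have kc: "k \<in> carrier R" using k idealD(8)[OF step.prems(2)] by auto
      have "k \<in> saturation P (K N <+>\<^bsub>R\<^esub> PIdl a)"
        using k subset_adjoin(1)[OF step.prems(2) a] subset_saturation[OF P Ka] by blast
      also have "\<dots> = saturation P (K n <+>\<^bsub>R\<^esub> PIdl a)" using N2[of N] N2[of n] n by (simp add: N_def)
      finally obtain u k' r where u: "u \<in> carrier R - P" and k': "k' \<in> K n" and r: "r \<in> carrier R"
        and eq: "u \<otimes> k = k' \<oplus> r \<otimes> a" by (auto simp: mem_adjoin elim!: saturationE)
      have k'c: "k' \<in> carrier R" using k' idealD(8)[OF step.prems(2)] by auto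
      \<comment> \<open>The coefficient \<open>r\<close> lies in
        \<open>(K N : a) = (K n : a)\<close>, so the correction \<open>r a\<close> is already in
        \<open>K n\<close>.\<close>
      have "r \<otimes> a = u \<otimes> k \<ominus> k'"
        unfolding eq using k'c r a by algebra
      also have "\<dots> \<in> K N" using k k' u K_le[OF n] idealD[OF step.prems(2)[of N]] by auto
      finally have "r \<in> colon (K N) a" using r by (simp add: colon_def)
      also have "\<dots> = colon (K n) a" using N1[of N] N1[of n] n by (simp add: N_def)
      finally have "r \<otimes> a \<in> K n" by (simp add: colon_def)
      then have "u \<otimes> k \<in> K n" unfolding eq using k' idealD(3)[OF step.prems(2)] by auto
      then have "k \<in> saturation P (K n)" using u kc by (intro saturationI)
      then show "k \<in> K n" using step.prems(3) by auto
    qed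
    then show ?thesis using K_le by (intro exI[of _ N]) blast
  qed
qed

text \<open>The principal ideal theorem in the form needed for chains. If it failed,
  \<open>P\<close> would be minimal over \<open>P0 + (x)\<close> although \<open>Q\<close> lies
  strictly between \<open>P0\<close> and \<open>P\<close>. Krull's argument then runs modulo
  \<open>P0\<close>, with the ideals \<open>N n\<close> in the place of symbolic powers of
  \<open>Q\<close>.\<close>

lemma prime_between:
  assumes P0: "primeideal P0 R" and Q: "primeideal Q R" and P: "primeideal P R"
    and "P0 \<subset> Q" "Q \<subset> P" and x: "x \<in> P"
  shows "\<exists>Q'. primeideal Q' R \<and> P0 \<subset> Q' \<and> Q' \<subset> P \<and> x \<in> Q'"
proof (cases "x \<in> Q")
  case True
  then show ?thesis using assms by blast
next
  case xQ: False
  show ?thesis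
  proof (rule ccontr)
    assume contra: "\<not> ?thesis"
    have xc: "x \<in> carrier R" using x primeidealD(3)[OF P] by auto
    note I0 = primeidealD(1)[OF P0]
    define I where "I = P0 <+>\<^bsub>R\<^esub> PIdl x"
    have only: "Q' = P" if "primeideal Q' R" "I \<subseteq> Q'" "Q' \<subseteq> P" for Q'
    proof -
      have "P0 \<subseteq> Q'" "x \<in> Q'" using that(2) subset_adjoin[OF I0 xc] by (auto simp: I_def)
      moreover have "x \<notin> P0" using xQ assms(4) by auto
      ultimately have "P0 \<subset> Q'" by auto
      then show ?thesis using contra that \<open>x \<in> Q'\<close> by blast
    qed
    obtain y where y: "y \<in> Q" "y \<notin> P0" using assms(4) by auto
    have yc: "y \<in> carrier R" using y primeidealD(3)[OF Q] by auto
    \<comment> \<open>Modulo \<open>P0\<close> this is the \<open>n\<close>-th power of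
      \<open>(y)\<close>, extended to the localization at \<open>Q\<close> and contracted. The
      powers of a single \<open>y\<close> suffice, since the contradiction will be that some
      \<open>y^n\<close> lies in \<open>P0\<close>.\<close>
    define N where "N n = saturation Q (P0 <+>\<^bsub>R\<^esub> PIdl (y [^] n))" for n :: nat
    have pc: "y [^] n \<in> carrier R" for n :: nat using yc by simp
    have idN: "ideal (N n) R" for n unfolding N_def
      by (rule saturation_ideal[OF Q adjoin_ideal[OF I0 pc]])
    have desc: "N (Suc n) \<subseteq> N n" for n
      unfolding N_def
    proof (intro saturation_mono adjoin_subset[OF adjoin_ideal[OF I0 pc]])
      show "P0 \<subseteq> P0 <+>\<^bsub>R\<^esub> PIdl (y [^] n)" using subset_adjoin[OF I0 pc] by auto
      show "y [^] Suc n \<in> P0 <+>\<^bsub>R\<^esub> PIdl (y [^] n)"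
        using subset_adjoin(2)[OF I0 pc[of n]] yc idealD(7)[OF adjoin_ideal[OF I0 pc]] by simp
    qed
    define K where "K n = saturation P (N n <+>\<^bsub>R\<^esub> PIdl x)" for n
    have idNx: "ideal (N n <+>\<^bsub>R\<^esub> PIdl x) R" for n by (rule adjoin_ideal[OF idN xc])
    have P0N: "P0 \<subseteq> N n" for n
      unfolding N_def
      using subset_adjoin(1)[OF I0 pc] subset_saturation[OF Q adjoin_ideal[OF I0 pc]] by blast
    have "\<exists>N. \<forall>n\<ge>N. K n = K N"
    proof (rule descending_chain_stable[OF P _ _ only])
      show "ideal I R" unfolding I_def by (rule adjoin_ideal[OF I0 xc])
      fix n
      show "ideal (K n) R" unfolding K_def by (rule saturation_ideal[OF P idNx])
      show "saturation P (K n) \<subseteq> K n" unfolding K_def by (rule saturation_idem[OF P])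
      show "I \<subseteq> K n" unfolding K_def I_def
        using adjoin_mono[OF P0N] subset_saturation[OF P idNx] by blast
      show "K (Suc n) \<subseteq> K n" unfolding K_def by (intro saturation_mono adjoin_mono desc)
    qed auto
    then obtain n where "K (Suc n) = K n" by (metis le_Suc_eq order_refl)
    \<comment> \<open>As \<open>K (Suc n) = K n\<close>, an element of \<open>N n\<close> is locally
      in \<open>N (Suc n) + (x)\<close>. Its \<open>x\<close>-coefficient is again in
      \<open>N n\<close>, because \<open>x\<close> is outside \<open>Q\<close> and
      \<open>N n\<close> is saturated at \<open>Q\<close>. So Nakayama applies.\<close>
    have "N n \<subseteq> saturation P (N (Suc n))"
    proof (rule nakayama[OF P idN idN x])
      fix k assume k: "k \<in> N n"
      have "k \<in> K (Suc n)" unfolding \<open>K (Suc n) = K n\<close> unfolding K_def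
        using k subset_adjoin(1)[OF idN xc] subset_saturation[OF P idNx] by blast
      then obtain u k' r where u: "u \<in> carrier R - P" and k': "k' \<in> N (Suc n)"
        and r: "r \<in> carrier R" and eq: "u \<otimes> k = k' \<oplus> r \<otimes> x"
        by (auto simp: mem_adjoin K_def elim!: saturationE)
      note c = idealD(8)[OF idN k] idealD(8)[OF idN k']
      have "x \<otimes> r = u \<otimes> k \<ominus> k'" unfolding eq using c r xc by algebra
      also have "\<dots> \<in> N n" using k subsetD[OF desc k'] u idealD[OF idN[of n]] by auto
      finally have "r \<in> saturation Q (N n)" using xQ xc r by (intro saturationI[of x]) auto
      then have "r \<in> N n" unfolding N_def using saturation_idem[OF Q] by blast
      moreover have "u \<otimes> k \<ominus> r \<otimes> x = k'" unfolding eq using c r xc by algebra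
      ultimately show "\<exists>u\<in>carrier R - P. \<exists>r\<in>N n. u \<otimes> k \<ominus> r \<otimes> x \<in> N (Suc n)"
        using u k' by auto
    qed
    also have "\<dots> \<subseteq> saturation Q (N (Suc n))"
      using assms(5) by (auto simp: saturation_def)
    also have "\<dots> \<subseteq> N (Suc n)" unfolding N_def by (rule saturation_idem[OF Q])
    finally have "y [^] n \<in> N (Suc n)"
      using subset_adjoin(2)[OF I0 pc] subset_saturation[OF Q adjoin_ideal[OF I0 pc]]
      unfolding N_def by blast
    then obtain u i r where u: "u \<in> carrier R - Q" and i: "i \<in> P0" and r: "r \<in> carrier R"
      and eq: "u \<otimes> y [^] n = i \<oplus> r \<otimes> y [^] Suc n"
      by (auto simp: mem_adjoin N_def elim!: saturationE)
    have ic: "i \<in> carrier R" using i idealD(8)[OF I0] by auto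
    \<comment> \<open>Since \<open>y\<close> is in \<open>Q\<close>, the factor
      \<open>u - r y\<close> is outside \<open>Q\<close> and hence outside \<open>P0\<close>. As its
      product with \<open>y^n\<close> is \<open>i\<close> in \<open>P0\<close>, the power
      \<open>y^n\<close> lies in \<open>P0\<close>.\<close>
    have w: "u \<ominus> r \<otimes> y \<in> carrier R - Q"
      by (rule minus_notin_prime[OF Q u]) (use r y idealD(6)[OF primeidealD(1)[OF Q]] in auto)
    have uc: "u \<in> carrier R" using u by auto
    have "(u \<ominus> r \<otimes> y) \<otimes> y [^] n = u \<otimes> y [^] n \<ominus> r \<otimes> y [^] Suc n"
      using uc r yc pc[of n] unfolding nat_pow_Suc by algebra
    also have "\<dots> = i"
      unfolding eq using ic r pc[of "Suc n"] by algebra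
    finally have "(u \<ominus> r \<otimes> y) \<otimes> y [^] n \<in> P0" using i by simp
    then have "y [^] n \<in> P0" using primeidealD(4)[OF P0, of "u \<ominus> r \<otimes> y" "y [^] n"] w assms(4) pc by auto
    then show False
    proof (induction n)
      case 0 then show ?case using primeidealD(2)[OF P0] by simp
    next
      case (Suc n) then show ?case using primeidealD(4)[OF P0, of "y [^] n" y] pc yc y by auto
    qed
  qed
qed

section \<open>Chains of primes and local generators of a prime\<close>

definition prime_chain :: "nat \<Rightarrow> (nat \<Rightarrow> 'a set) \<Rightarrow> bool"
  where "prime_chain n C \<longleftrightarrow> (\<forall>i\<le>n. primeideal (C i) R) \<and> (\<forall>i<n. C i \<subset> C (Suc i))"

lemma prime_chainD:
  assumes "prime_chain n C"
  shows "i \<le> n \<Longrightarrow> primeideal (C i) R" "i < n \<Longrightarrow> C i \<subset> C (Suc i)" "i \<le> n \<Longrightarrow> C i \<subseteq> C n"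
proof -
  show "i \<le> n \<Longrightarrow> primeideal (C i) R" and lt: "i < n \<Longrightarrow> C i \<subset> C (Suc i)" for i
    using assms by (simp_all add: prime_chain_def)
  show "i \<le> n \<Longrightarrow> C i \<subseteq> C n"
    by (induction rule: inc_induct) (use lt in blast)+
qed

text \<open>Descending induction along the chain: \<open>prime_between\<close> replaces the prime
  just below the top by one that contains \<open>x\<close>, and the chain that ends there is treated
  in the same way. The bottom \<open>C 0\<close> is given up.\<close>

lemma prime_chain_through:
  assumes "prime_chain (Suc n) C" "x \<in> C (Suc n)"
  obtains D where "prime_chain n D" "D n = C (Suc n)" "C 0 \<subset> D 0" "x \<in> D 0"
  using assms
proof (induction n arbitrary: C thesis)
  case 0
  have "prime_chain 0 (\<lambda>_. C (Suc 0))" using 0(2) by (simp add: prime_chain_def)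
  then show ?case using 0(1) prime_chainD(2)[OF 0(2), of 0] 0(3) by simp
next
  case (Suc n)
  note C = prime_chainD[OF Suc.prems(2)]
  obtain Q where Q: "primeideal Q R" "C n \<subset> Q" "Q \<subset> C (Suc (Suc n))" "x \<in> Q"
    using prime_between[OF C(1)[of n] C(1)[of "Suc n"] C(1)[of "Suc (Suc n)"]
        C(2)[of n] C(2)[of "Suc n"] Suc.prems(3)] by fastforce
  define C' where "C' = C(Suc n := Q)"
  have "primeideal (C' i) R" if "i \<le> Suc n" for i using that C(1)[of i] Q by (simp add: C'_def)
  moreover have "C' i \<subset> C' (Suc i)" if "i < Suc n" for i
    using that C(2)[of i] Q(2) by (cases "i = n") (simp_all add: C'_def)
  ultimately have "prime_chain (Suc n) C'" by (simp add: prime_chain_def)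
  moreover have "x \<in> C' (Suc n)" using Q by (simp add: C'_def)
  ultimately obtain D where D: "prime_chain n D" "D n = C' (Suc n)" "C' 0 \<subset> D 0" "x \<in> D 0"
    using Suc.IH by blast
  define D' where "D' = D(Suc n := C (Suc (Suc n)))"
  have "primeideal (D' i) R" if "i \<le> Suc n" for i
    using that prime_chainD(1)[OF D(1), of i] C(1)[of "Suc (Suc n)"]
    by (cases "i = Suc n") (simp_all add: D'_def)
  moreover have "D' i \<subset> D' (Suc i)" if "i < Suc n" for i
    using that prime_chainD(2)[OF D(1), of i] D(2) Q(3)
    by (cases "i = n") (simp_all add: D'_def C'_def)
  ultimately have "prime_chain (Suc n) D'" by (simp add: prime_chain_def)
  moreover have "D' (Suc n) = C (Suc (Suc n))" "D' 0 = D 0" "C' 0 = C 0"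
    by (simp_all add: D'_def C'_def)
  ultimately show ?case using Suc.prems(1)[of D'] D by simp
qed

text \<open>Every element of \<open>B\<close> costs one step at the bottom of the chain.\<close>

lemma prime_chain_through_set:
  assumes "finite B" "card B \<le> n" "B \<subseteq> C n" "prime_chain n C"
  obtains D where "prime_chain (n - card B) D" "D (n - card B) = C n" "C 0 \<subseteq> D 0" "B \<subseteq> D 0"
  using assms
proof (induction B arbitrary: n C thesis)
  case empty
  then show ?case by simp
next
  case (insert x B)
  then obtain m where n: "n = Suc m" and cm: "card B \<le> m" by (cases n) auto
  have x: "x \<in> C n" and B: "B \<subseteq> C n" using insert.prems(3) by auto
  obtain D where D: "prime_chain m D" "D m = C n" "C 0 \<subset> D 0" "x \<in> D 0"
    using prime_chain_through[of m C x] insert.prems(4) x unfolding n by blast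
  obtain E where E: "prime_chain (m - card B) E" "E (m - card B) = D m" "D 0 \<subseteq> E 0" "B \<subseteq> E 0"
    using insert.IH[OF _ cm _ D(1)] B D(2) by metis
  have "n - card (insert x B) = m - card B" using insert.hyps n by simp
  moreover have "C 0 \<subseteq> E 0" "insert x B \<subseteq> E 0" using D E by auto
  ultimately show ?case using insert.prems(1)[of E] E D by simp
qed

text \<open>If \<open>P\<close> is locally generated by \<open>A\<close> and at most \<open>n\<close> further elements and some chain of
  primes from \<open>P0 \<supseteq> A\<close> to \<open>P\<close> has length \<open>n\<close>, then \<open>A\<close> generates \<open>P0\<close> locally at \<open>P\<close>:
  pass the chain through one of the further elements, use induction, and apply Nakayama.\<close>

lemma chain_bottom_generated:
  assumes "finite G" "card G \<le> n" "A \<subseteq> C 0" "G \<subseteq> C n" "prime_chain n C"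
    and "C n \<subseteq> saturation (C n) (Idl (A \<union> G))"
  shows "C 0 \<subseteq> saturation (C n) (Idl A)"
  using assms
proof (induction "card G" arbitrary: G n A C)
  case 0
  then show ?case using prime_chainD(3)[OF 0(6), of 0] by auto
next
  case (Suc d)
  obtain m where n: "n = Suc m" using Suc.hyps(2) Suc.prems(2) by (cases n) auto
  note C = prime_chainD[OF Suc.prems(5)]
  have P: "primeideal (C n) R" and P0: "primeideal (C 0) R" using C(1) by auto
  have le: "C i \<subseteq> C n" if "i \<le> n" for i using that by (rule C(3))
  have lt: "C 0 \<subset> C n" using C(2)[of 0] le[of "Suc 0"] n by auto
  have carr: "A \<subseteq> carrier R" "G \<subseteq> carrier R"
    using Suc.prems primeidealD(3)[OF P] primeidealD(3)[OF P0] by auto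
  \<comment> \<open>If all of \<open>G\<close> lay in \<open>C 0\<close>, then so would
    \<open>C n\<close>, which is locally generated by \<open>A\<close> and \<open>G\<close>. This
    contradicts the strictness of a chain of positive length.\<close>
  obtain x where x: "x \<in> G" "x \<notin> C 0"
  proof (rule ccontr)
    assume "\<not> thesis"
    then have "A \<union> G \<subseteq> C 0" using that Suc.prems(3) by blast
    then have "Idl (A \<union> G) \<subseteq> C 0" by (rule genideal_minimal[OF primeidealD(1)[OF P0]])
    then have "C n \<subseteq> C 0"
      using Suc.prems(6) saturation_mono[of "Idl (A \<union> G)" "C 0" "C n"]
        saturation_prime[OF P0 le[OF le0]] by blast
    then show False using lt by auto
  qed
  have xn: "x \<in> C n" using x Suc.prems by auto
  obtain D where D: "prime_chain m D" "D m = C n" "C 0 \<subset> D 0" "x \<in> D 0"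
    using prime_chain_through[of m C x] Suc.prems(5) xn unfolding n by blast
  have "D 0 \<subseteq> saturation (D m) (Idl (insert x A))"
  proof (rule Suc.hyps(1)[of "G - {x}" m "insert x A" D])
    have "insert x A \<union> (G - {x}) = A \<union> G" using x by auto
    then show "D m \<subseteq> saturation (D m) (Idl (insert x A \<union> (G - {x})))"
      using Suc.prems(6) D(2) by simp
    show "insert x A \<subseteq> D 0" using Suc.prems(3) D by auto
    show "G - {x} \<subseteq> D m" using Suc.prems(4) D by auto
  qed (use Suc.hyps(2) Suc.prems(1,2) D(1) x n in auto)
  then have D0: "D 0 \<subseteq> saturation (C n) (Idl A <+>\<^bsub>R\<^esub> PIdl x)"
    using Idl_insert[OF carr(1)] subsetD[OF carr(2) x(1)] D(2) by simp
  show ?case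
  proof (rule nakayama[OF P primeidealD(1)[OF P0] genideal_ideal[OF carr(1)] xn])
    fix k assume k: "k \<in> C 0"
    then have "k \<in> saturation (C n) (Idl A <+>\<^bsub>R\<^esub> PIdl x)" using D(3) D0 by auto
    then obtain u i r where u: "u \<in> carrier R - C n" and i: "i \<in> Idl A" and r: "r \<in> carrier R"
      and eq: "u \<otimes> k = i \<oplus> r \<otimes> x" by (auto simp: mem_adjoin elim!: saturationE)
    have i0: "i \<in> C 0"
      using i genideal_minimal[OF primeidealD(1)[OF P0] Suc.prems(3)] by auto
    have c: "x \<in> carrier R" "i \<in> carrier R" "k \<in> carrier R"
      using x carr i0 k primeidealD(3)[OF P0] by auto
    \<comment> \<open>\<open>C 0\<close> is prime and misses \<open>x\<close>, so \<open>r\<close>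
      lies in \<open>C 0\<close>. Thus \<open>C 0\<close> is locally contained in
      \<open>(A) + x C 0\<close>, as Nakayama requires.\<close>
    have "r \<otimes> x = u \<otimes> k \<ominus> i" unfolding eq using c r by algebra
    also have "\<dots> \<in> C 0" using k u i0 idealD[OF primeidealD(1)[OF P0]] by auto
    finally have "r \<in> C 0" using primeidealD(4)[OF P0 r c(1)] x by auto
    moreover have "u \<otimes> k \<ominus> r \<otimes> x = i" unfolding eq using c r by algebra
    ultimately show "\<exists>u\<in>carrier R - C n. \<exists>r\<in>C 0. u \<otimes> k \<ominus> r \<otimes> x \<in> Idl A" using u i by auto
  qed
qed

text \<open>After the chain has been pushed through \<open>B\<close>, its new bottom
  \<open>D 0\<close> is locally generated by \<open>B\<close>. So the saturation of the ideal of
  \<open>B\<close> is the prime \<open>D 0\<close>, and only \<open>x \<notin> D 0\<close> has to be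
  shown.\<close>

lemma regular_system_permutable:
  assumes G: "finite G" "card G \<le> n" "G \<subseteq> C n" and C: "prime_chain n C"
    and gen: "C n \<subseteq> saturation (C n) (Idl G)"
    and B: "B \<subseteq> G" "x \<in> G - B"
    and r: "r \<in> carrier R" "x \<otimes> r \<in> saturation (C n) (Idl B)"
  shows "r \<in> saturation (C n) (Idl B)"
proof -
  have finB: "finite B" using B G by (auto intro: finite_subset)
  have cardB: "card B < card G" using B G by (intro psubset_card_mono) auto
  have P: "primeideal (C n) R" using prime_chainD(1)[OF C] by simp
  have Gc: "G \<subseteq> carrier R" using G primeidealD(3)[OF P] by auto
  have "card B \<le> n" "B \<subseteq> C n" using cardB G B by auto
  then obtain D where D: "prime_chain (n - card B) D" "D (n - card B) = C n" "B \<subseteq> D 0"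
    using prime_chain_through_set[OF finB _ _ C] by metis
  have "D 0 \<subseteq> saturation (D (n - card B)) (Idl B)"
  proof (rule chain_bottom_generated[OF _ _ D(3) _ D(1)])
    have "B \<union> (G - B) = G" using B by auto
    then show "D (n - card B) \<subseteq> saturation (D (n - card B)) (Idl (B \<union> (G - B)))"
      using gen D(2) by simp
    show "card (G - B) \<le> n - card B" using G finB B by (simp add: card_Diff_subset)
  qed (use D(2) G in auto)
  then have D0: "D 0 \<subseteq> saturation (C n) (Idl B)" using D(2) by simp
  have P0: "primeideal (D 0) R" using prime_chainD(1)[OF D(1)] by simp
  have D0P: "D 0 \<subseteq> C n" using prime_chainD(3)[OF D(1), of 0] D(2) by simp
  have sat: "saturation (C n) (Idl B) \<subseteq> D 0"
    using saturation_mono[OF genideal_minimal[OF primeidealD(1)[OF P0] D(3)]]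
      saturation_prime[OF P0 D0P] by blast
  \<comment> \<open>Otherwise the chain could be pushed once more, through \<open>x\<close>. Its
    bottom \<open>E 0\<close>, strictly above \<open>D 0\<close>, would be locally generated by
    \<open>insert x B\<close>, a subset of \<open>D 0\<close>.\<close>
  have "x \<notin> D 0"
  proof
    assume x: "x \<in> D 0"
    have "n - card B \<noteq> 0" using cardB G(2) by linarith
    then obtain m where m: "n - card B = Suc m" using not0_implies_Suc by blast
    have D': "prime_chain (Suc m) D" "D (Suc m) = C n" using D(1,2) m by simp_all
    have x': "x \<in> D (Suc m)" using x D0P D'(2) by auto
    obtain E where E: "prime_chain m E" "E m = C n" "D 0 \<subset> E 0" "x \<in> E 0"
      using prime_chain_through[OF D'(1) x'] unfolding D'(2) by blast
    have "E 0 \<subseteq> saturation (E m) (Idl (insert x B))"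
    proof (rule chain_bottom_generated[OF _ _ _ _ E(1)])
      have "insert x B \<union> (G - insert x B) = G" using B by auto
      then show "E m \<subseteq> saturation (E m) (Idl (insert x B \<union> (G - insert x B)))"
        using gen E(2) by simp
      have "card (G - insert x B) = card G - card (insert x B)"
        using finB B by (intro card_Diff_subset) auto
      then show "card (G - insert x B) \<le> m" using G finB B m by simp
      show "insert x B \<subseteq> E 0" using E D(3) by auto
      show "G - insert x B \<subseteq> E m" using E(2) G by auto
    qed (use G in auto)
    also have "\<dots> \<subseteq> saturation (C n) (D 0)"
      unfolding E(2) by (intro saturation_mono genideal_minimal[OF primeidealD(1)[OF P0]])
        (use D x in auto)
    also have "\<dots> \<subseteq> D 0" by (rule saturation_prime[OF P0 D0P])
    finally show False using E(3) by auto
  qed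
  moreover have "x \<in> carrier R" "x \<otimes> r \<in> D 0" using B Gc r(2) sat by auto
  ultimately have "r \<in> D 0" using primeidealD(4)[OF P0] r(1) by blast
  then show ?thesis using D0 by auto
qed

end

text \<open>Evaluates the operations of \<open>localization\<close> and
  \<open>perfect_closure\<close>, which are unions over all representatives, on chosen
  representatives.\<close>

lemma Union_class_pair:
  assumes r: "equiv A r" "equiv B q" and "x \<in> A" "y \<in> B"
    and wd: "\<And>x' y'. (x, x') \<in> r \<Longrightarrow> (y, y') \<in> q \<Longrightarrow> F x' y' = F x y"
  shows "(\<Union>x'\<in>r `` {x}. \<Union>y'\<in>q `` {y}. F x' y') = F x y"
proof -
  have "x \<in> r `` {x}" "y \<in> q `` {y}"
    using equiv_class_self[OF r(1) \<open>x \<in> A\<close>] equiv_class_self[OF r(2) \<open>y \<in> B\<close>] by auto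
  moreover have "F x' y' = F x y" if "x' \<in> r `` {x}" "y' \<in> q `` {y}" for x' y' using wd that by auto
  ultimately show ?thesis by blast
qed

section \<open>Powers of the members of a permutable regular sequence\<close>

context cring
begin

text \<open>Regularity in every order, stated without orders: locally at \<open>P\<close>, each
  member is a non-zero-divisor modulo any set of other members. It is stated for an indexed family
  because single entries will be replaced.\<close>

definition locally_permutable :: "'a set \<Rightarrow> 'i set \<Rightarrow> ('i \<Rightarrow> 'a) \<Rightarrow> bool"
  where "locally_permutable P G y \<longleftrightarrow> y ` G \<subseteq> carrier R \<and>
    (\<forall>B\<subseteq>G. \<forall>j\<in>G - B. \<forall>r\<in>carrier R.
      y j \<otimes> r \<in> saturation P (Idl (y ` B)) \<longrightarrow> r \<in> saturation P (Idl (y ` B)))"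

lemma locally_permutableD:
  assumes "locally_permutable P G y" "B \<subseteq> G" "j \<in> G" "j \<notin> B" "r \<in> carrier R"
    "y j \<otimes> r \<in> saturation P (Idl (y ` B))"
  shows "r \<in> saturation P (Idl (y ` B))"
  using assms unfolding locally_permutable_def by blast

lemma mem_saturation_adjoin:
  assumes P: "primeideal P R" and J: "ideal J R" and x: "x \<in> carrier R"
    and r: "r \<in> carrier R" and u: "u \<in> carrier R - P" and t: "t \<in> carrier R"
    and eq: "u \<otimes> r \<ominus> t \<otimes> x \<in> saturation P J"
  shows "r \<in> saturation P (J <+>\<^bsub>R\<^esub> PIdl x)"
proof -
  obtain v where v: "v \<in> carrier R - P" "v \<otimes> (u \<otimes> r \<ominus> t \<otimes> x) \<in> J"
    using eq by (auto elim: saturationE)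
  have c: "u \<in> carrier R" "v \<in> carrier R" using u v by auto
  have "(v \<otimes> u) \<otimes> r = v \<otimes> (u \<otimes> r \<ominus> t \<otimes> x) \<oplus> (v \<otimes> t) \<otimes> x" using c r t x by algebra
  then have "(v \<otimes> u) \<otimes> r \<in> J <+>\<^bsub>R\<^esub> PIdl x" unfolding mem_adjoin using v(2) c t by blast
  then show ?thesis using primeidealD(5)[OF P v(1) u] r by (intro saturationI)
qed

lemma saturation_adjoinE:
  assumes "ideal J R" "r \<in> saturation P (J <+>\<^bsub>R\<^esub> PIdl x)" "x \<in> carrier R"
  obtains u t where "u \<in> carrier R - P" "t \<in> carrier R" "u \<otimes> r \<ominus> t \<otimes> x \<in> J"
proof -
  obtain u j t where u: "u \<in> carrier R - P" "r \<in> carrier R" and j: "j \<in> J" "t \<in> carrier R"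
    and eq: "u \<otimes> r = j \<oplus> t \<otimes> x"
    using assms(2) by (auto simp: mem_adjoin elim!: saturationE)
  have "u \<otimes> r \<ominus> t \<otimes> x = j"
    unfolding eq using j idealD(8)[OF assms(1)] assms(3) by algebra
  then show thesis using that u j by auto
qed

text \<open>The hard case is \<open>z \<in> B\<close>. With \<open>J\<close> generated by the rest
  of \<open>B\<close>, one cancels \<open>y j\<close> modulo \<open>J + (y z)\<close>, then
  \<open>y z\<close> modulo \<open>J\<close>, then \<open>y j\<close> modulo \<open>J + (w)\<close>.
  The first two cancellations come from \<open>y\<close>, the third from
  \<open>y(z := w)\<close>.\<close>

lemma locally_permutable_mult:
  assumes P: "primeideal P R" and y: "locally_permutable P G y"
    and w: "locally_permutable P G (y(z := w))" and z: "z \<in> G"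
  shows "locally_permutable P G (y(z := y z \<otimes> w))"
proof -
  have yc: "y i \<in> carrier R" if "i \<in> G" for i using y that by (auto simp: locally_permutable_def)
  have wc: "w \<in> carrier R" using w z by (auto simp: locally_permutable_def)
  note yz = yc[OF z]
  have "r \<in> saturation P (Idl (y(z := y z \<otimes> w) ` B))"
    if B: "B \<subseteq> G" and j: "j \<in> G" "j \<notin> B" and r: "r \<in> carrier R"
      and jr: "(y(z := y z \<otimes> w)) j \<otimes> r \<in> saturation P (Idl (y(z := y z \<otimes> w) ` B))" for B j r
  proof (cases "z \<in> B")
    case False
    then have im: "y(z := c) ` B = y ` B" for c by auto
    show ?thesis
    proof (cases "j = z")
      case True
      have "y j \<otimes> (w \<otimes> r) \<in> saturation P (Idl (y ` B))"
        using jr True r wc yz unfolding im by (simp add: m_assoc)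
      then have "w \<otimes> r \<in> saturation P (Idl (y ` B))"
        using locally_permutableD[OF y B j] wc r by auto
      then show ?thesis
        using locally_permutableD[OF w B j, of r] r True unfolding im by auto
    next
      case False
      then show ?thesis
        using locally_permutableD[OF y B j r] jr unfolding im by auto
    qed
  next
    case zB: True
    then have jz: "j \<noteq> z" using j by auto
    define B' where "B' = B - {z}"
    have B': "B' \<subseteq> G" "z \<notin> B'" "B = insert z B'" using B zB by (auto simp: B'_def)
    have sub: "y ` B' \<subseteq> carrier R" using B' yc by auto
    define J where "J = Idl (y ` B')"
    have J: "ideal J R" unfolding J_def by (rule genideal_ideal[OF sub])
    note Jc = idealD(8)[OF J]
    have im: "Idl (y(z := c) ` B) = J <+>\<^bsub>R\<^esub> PIdl c" if "c \<in> carrier R" for c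
    proof -
      have "y(z := c) ` B = insert c (y ` B')" using B' by auto
      then show ?thesis using Idl_insert[OF sub that] by (simp add: J_def)
    qed
    have im': "Idl (y ` B) = J <+>\<^bsub>R\<^esub> PIdl (y z)" using im[OF yz] by simp
    have yj: "y j \<in> carrier R" using yc j by auto
    have jr': "y j \<otimes> r \<in> saturation P (J <+>\<^bsub>R\<^esub> PIdl (y z \<otimes> w))"
      using jr jz im[of "y z \<otimes> w"] yz wc by simp
    obtain u t where u: "u \<in> carrier R - P" and t: "t \<in> carrier R"
      and e1: "u \<otimes> (y j \<otimes> r) \<ominus> t \<otimes> (y z \<otimes> w) \<in> J"
      using saturation_adjoinE[OF J jr'] yz wc by auto
    have uc: "u \<in> carrier R" using u by auto
    have "y j \<otimes> r \<in> saturation P (J <+>\<^bsub>R\<^esub> PIdl (y z))"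
    proof (rule mem_saturation_adjoin[OF P J yz _ u])
      have "u \<otimes> (y j \<otimes> r) \<ominus> (t \<otimes> w) \<otimes> y z = u \<otimes> (y j \<otimes> r) \<ominus> t \<otimes> (y z \<otimes> w)"
        using uc yj r t wc yz by algebra
      then show "u \<otimes> (y j \<otimes> r) \<ominus> (t \<otimes> w) \<otimes> y z \<in> saturation P J"
        using e1 subset_saturation[OF P J] by auto
    qed (use yj r t wc in auto)
    then have "r \<in> saturation P (J <+>\<^bsub>R\<^esub> PIdl (y z))"
      using locally_permutableD[OF y B j r] im' by simp
    then obtain v a where v: "v \<in> carrier R - P" and a: "a \<in> carrier R"
      and e2: "v \<otimes> r \<ominus> a \<otimes> y z \<in> J" by (rule saturation_adjoinE[OF J _ yz])
    have vc: "v \<in> carrier R" using v by auto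
    \<comment> \<open>The two congruences are combined so that \<open>r\<close> drops out. This
      leaves \<open>y z\<close> times \<open>e\<close> in \<open>J\<close>, and \<open>y z\<close>
      cancels.\<close>
    define e where "e = (u \<otimes> y j) \<otimes> a \<ominus> (v \<otimes> t) \<otimes> w"
    have ec: "e \<in> carrier R" using uc yj a vc t wc by (simp add: e_def)
    have "y z \<otimes> e = v \<otimes> (u \<otimes> (y j \<otimes> r) \<ominus> t \<otimes> (y z \<otimes> w)) \<ominus> (u \<otimes> y j) \<otimes> (v \<otimes> r \<ominus> a \<otimes> y z)"
      unfolding e_def using uc yj a vc t wc yz r by algebra
    also have "\<dots> \<in> J" using e1 e2 uc yj vc idealD[OF J] by auto
    finally have "y z \<otimes> e \<in> saturation P (Idl (y ` B'))"
      using subset_saturation[OF P J] by (auto simp: J_def)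
    then have e3: "e \<in> saturation P J"
      using locally_permutableD[OF y B'(1) z B'(2) ec] by (simp add: J_def)
    have "y j \<otimes> a \<in> saturation P (J <+>\<^bsub>R\<^esub> PIdl w)"
    proof (rule mem_saturation_adjoin[OF P J wc _ u])
      have "u \<otimes> (y j \<otimes> a) \<ominus> (v \<otimes> t) \<otimes> w = e"
        unfolding e_def using uc yj a vc t wc by algebra
      then show "u \<otimes> (y j \<otimes> a) \<ominus> (v \<otimes> t) \<otimes> w \<in> saturation P J" using e3 by simp
    qed (use yj a vc t in auto)
    then have "a \<in> saturation P (J <+>\<^bsub>R\<^esub> PIdl w)"
      using locally_permutableD[OF w B j a] im[OF wc] jz by simp
    then obtain u' b where u': "u' \<in> carrier R - P" and b: "b \<in> carrier R"
      and e4: "u' \<otimes> a \<ominus> b \<otimes> w \<in> J" by (rule saturation_adjoinE[OF J _ wc])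
    have u'c: "u' \<in> carrier R" using u' by auto
    have "r \<in> saturation P (J <+>\<^bsub>R\<^esub> PIdl (y z \<otimes> w))"
    proof (rule mem_saturation_adjoin[OF P J _ r primeidealD(5)[OF P u' v] b])
      have "(u' \<otimes> v) \<otimes> r \<ominus> b \<otimes> (y z \<otimes> w)
        = u' \<otimes> (v \<otimes> r \<ominus> a \<otimes> y z) \<oplus> y z \<otimes> (u' \<otimes> a \<ominus> b \<otimes> w)"
        using u'c vc r b yz wc a by algebra
      also have "\<dots> \<in> J" using e2 e4 u'c yz idealD[OF J] by auto
      finally show "(u' \<otimes> v) \<otimes> r \<ominus> b \<otimes> (y z \<otimes> w) \<in> saturation P J"
        using subset_saturation[OF P J] by auto
    qed (use yz wc in auto)
    then show ?thesis using im[of "y z \<otimes> w"] yz wc by simp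
  qed
  then have "\<forall>B\<subseteq>G. \<forall>j\<in>G - B. \<forall>r\<in>carrier R.
      (y(z := y z \<otimes> w)) j \<otimes> r \<in> saturation P (Idl (y(z := y z \<otimes> w) ` B)) \<longrightarrow>
      r \<in> saturation P (Idl (y(z := y z \<otimes> w) ` B))" by blast
  moreover have "y(z := y z \<otimes> w) ` G \<subseteq> carrier R" using yc yz wc by auto
  ultimately show ?thesis unfolding locally_permutable_def by (rule conjI[rotated])
qed

text \<open>The new factor is \<open>w = y z\<close>: resetting the entry from \<open>y z^n\<close>
  to \<open>y z\<close> gives back the original family, so both hypotheses of
  \<open>locally_permutable_mult\<close> are at hand.\<close>

lemma locally_permutable_pow_one:
  assumes P: "primeideal P R" and y: "locally_permutable P G y" and z: "z \<in> G" and n: "0 < (n :: nat)"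
  shows "locally_permutable P G (y(z := y z [^] n))"
  using n
proof (induction n rule: nat_induct_non_zero)
  case 1
  have "y z \<in> carrier R" using y z by (auto simp: locally_permutable_def)
  then show ?case using y by simp
next
  case (Suc n)
  have "(y(z := y z [^] n))(z := y z) = y" by (simp only: fun_upd_upd fun_upd_triv)
  then have "locally_permutable P G ((y(z := y z [^] n))(z := (y(z := y z [^] n)) z \<otimes> y z))"
    using locally_permutable_mult[OF P Suc.IH _ z, of "y z"] y by metis
  then show ?case by (simp only: fun_upd_same fun_upd_upd nat_pow_Suc)
qed

lemma locally_permutable_pow:
  assumes P: "primeideal P R" and y: "locally_permutable P G y" and "finite G" and n: "0 < (n :: nat)"
  shows "locally_permutable P G (\<lambda>i. y i [^] n)"
proof -
  have "locally_permutable P G (\<lambda>i. if i \<in> Z then y i [^] n else y i)" if "finite Z" "Z \<subseteq> G" for Z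
    using that
  proof (induction Z)
    case empty
    then show ?case using y by simp
  next
    case (insert z Z)
    have "locally_permutable P G ((\<lambda>i. if i \<in> Z then y i [^] n else y i)(z := y z [^] n))"
      using locally_permutable_pow_one[OF P insert.IH, of z n] insert n by simp
    moreover have "(\<lambda>i. if i \<in> Z then y i [^] n else y i)(z := y z [^] n)
      = (\<lambda>i. if i \<in> insert z Z then y i [^] n else y i)" by auto
    ultimately show ?case by simp
  qed
  from this[OF \<open>finite G\<close> order_refl] have p: "locally_permutable P G (\<lambda>i. if i \<in> G then y i [^] n else y i)" .
  have "(\<lambda>i. if i \<in> G then y i [^] n else y i) ` B = (\<lambda>i. y i [^] n) ` B" if "B \<subseteq> G" for B
    using that by (intro image_cong) auto
  then show ?thesis using p unfolding locally_permutable_def by (simp cong: conj_cong)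
qed

end

section \<open>Regular local rings as localizations\<close>

text \<open>That the localization is a commutative ring is assumed because
  \<open>regular_local_ring\<close> provides it; what remains is to compute with fractions.\<close>

locale prime_localization = cring +
  fixes P
  assumes P: "primeideal P R" and L_cring: "cring (localization R P)"
begin

abbreviation "Loc \<equiv> localization R P"

definition frac :: "'a \<Rightarrow> 'a \<Rightarrow> ('a \<times> 'a) set"
  where "frac a s = loc_rel R P `` {(a, s)}"

lemma loc_rel_equiv: "equiv (carrier R \<times> (carrier R - P)) (loc_rel R P)"
proof (rule equivI)
  show "loc_rel R P \<subseteq> (carrier R \<times> (carrier R - P)) \<times> carrier R \<times> (carrier R - P)"
    by (auto simp: loc_rel_def)
  show "refl_on (carrier R \<times> (carrier R - P)) (loc_rel R P)"
    unfolding refl_on_def using primeidealD(2)[OF P] by (auto simp: loc_rel_def)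
  show "sym (loc_rel R P)"
    unfolding sym_def loc_rel_def by (auto intro: sym)
  show "trans (loc_rel R P)"
  proof (rule transI)
    fix x y z assume "(x, y) \<in> loc_rel R P" "(y, z) \<in> loc_rel R P"
    then obtain a s b t c w u v where
      d: "x = (a, s)" "y = (b, t)" "z = (c, w)" "a \<in> carrier R" "b \<in> carrier R" "c \<in> carrier R"
      and m: "s \<in> carrier R - P" "t \<in> carrier R - P" "w \<in> carrier R - P"
        "u \<in> carrier R - P" "v \<in> carrier R - P"
      and e: "u \<otimes> (a \<otimes> t) = u \<otimes> (b \<otimes> s)" "v \<otimes> (b \<otimes> w) = v \<otimes> (c \<otimes> t)"
      by (auto simp: loc_rel_def)
    have k: "s \<in> carrier R" "t \<in> carrier R" "w \<in> carrier R" "u \<in> carrier R" "v \<in> carrier R"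
      using m by auto
    have "(u \<otimes> v \<otimes> t) \<otimes> (a \<otimes> w) = v \<otimes> w \<otimes> (u \<otimes> (a \<otimes> t))" using d k by algebra
    also have "\<dots> = u \<otimes> s \<otimes> (v \<otimes> (b \<otimes> w))" unfolding e(1) using d k by algebra
    also have "\<dots> = (u \<otimes> v \<otimes> t) \<otimes> (c \<otimes> s)" unfolding e(2) using d k by algebra
    finally have "(u \<otimes> v \<otimes> t) \<otimes> (a \<otimes> w) = (u \<otimes> v \<otimes> t) \<otimes> (c \<otimes> s)" .
    moreover have "u \<otimes> v \<otimes> t \<in> carrier R - P"
      by (rule primeidealD(5)[OF P primeidealD(5)[OF P m(4,5)] m(2)])
    ultimately show "(x, z) \<in> loc_rel R P"
      unfolding loc_rel_def d(1,3) using d(4,6) m(1,3) by blast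
  qed
qed

lemma frac_eq_iff:
  assumes "a \<in> carrier R" "b \<in> carrier R" "s \<in> carrier R - P" "t \<in> carrier R - P"
  shows "frac a s = frac b t \<longleftrightarrow> (\<exists>u\<in>carrier R - P. u \<otimes> (a \<otimes> t) = u \<otimes> (b \<otimes> s))"
proof -
  have "frac a s = frac b t \<longleftrightarrow> ((a, s), (b, t)) \<in> loc_rel R P"
    unfolding frac_def using assms by (intro eq_equiv_class_iff[OF loc_rel_equiv]) auto
  then show ?thesis using assms by (auto simp: loc_rel_def)
qed

lemma frac_eqI:
  assumes "u \<otimes> (a \<otimes> t) = u \<otimes> (b \<otimes> s)" "u \<in> carrier R - P"
    "a \<in> carrier R" "b \<in> carrier R" "s \<in> carrier R - P" "t \<in> carrier R - P"
  shows "frac a s = frac b t"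
  using frac_eq_iff[OF assms(3-6)] assms(1,2) by blast

lemma frac_closed: "a \<in> carrier R \<Longrightarrow> s \<in> carrier R - P \<Longrightarrow> frac a s \<in> carrier Loc"
  unfolding localization_def frac_def by (auto intro: quotientI)

lemma Loc_cases:
  assumes "x \<in> carrier Loc"
  obtains a s where "a \<in> carrier R" "s \<in> carrier R - P" "x = frac a s"
  using assms unfolding localization_def frac_def by (auto elim!: quotientE)

lemma frac_mult:
  assumes "a \<in> carrier R" "b \<in> carrier R" "s \<in> carrier R - P" "t \<in> carrier R - P"
  shows "frac a s \<otimes>\<^bsub>Loc\<^esub> frac b t = frac (a \<otimes> b) (s \<otimes> t)"
proof -
  let ?F = "\<lambda>(a, s) (b, t). frac (a \<otimes> b) (s \<otimes> t)"
  have "frac a s \<otimes>\<^bsub>Loc\<^esub> frac b t = (\<Union>x\<in>frac a s. \<Union>y\<in>frac b t. ?F x y)"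
    unfolding localization_def by (simp add: frac_def split_def)
  also have "\<dots> = ?F (a, s) (b, t)"
    unfolding frac_def[of a s] frac_def[of b t]
  proof (rule Union_class_pair[OF loc_rel_equiv loc_rel_equiv])
    fix x y assume "((a, s), x) \<in> loc_rel R P" "((b, t), y) \<in> loc_rel R P"
    then obtain a' s' b' t' u v where
      d: "x = (a', s')" "y = (b', t')" "a' \<in> carrier R" "b' \<in> carrier R"
      and m: "s' \<in> carrier R - P" "t' \<in> carrier R - P" "u \<in> carrier R - P" "v \<in> carrier R - P"
      and e: "u \<otimes> (a \<otimes> s') = u \<otimes> (a' \<otimes> s)" "v \<otimes> (b \<otimes> t') = v \<otimes> (b' \<otimes> t)"
      by (auto simp: loc_rel_def)
    have k: "s \<in> carrier R" "t \<in> carrier R" "s' \<in> carrier R" "t' \<in> carrier R" "u \<in> carrier R" "v \<in> carrier R"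
      using m assms by auto
    have "(u \<otimes> v) \<otimes> ((a' \<otimes> b') \<otimes> (s \<otimes> t)) = (u \<otimes> (a' \<otimes> s)) \<otimes> (v \<otimes> (b' \<otimes> t))"
      using d assms(1,2) k by algebra
    also have "\<dots> = (u \<otimes> v) \<otimes> ((a \<otimes> b) \<otimes> (s' \<otimes> t'))"
      unfolding e[symmetric] using d assms(1,2) k by algebra
    finally have e': "(u \<otimes> v) \<otimes> ((a' \<otimes> b') \<otimes> (s \<otimes> t)) = (u \<otimes> v) \<otimes> ((a \<otimes> b) \<otimes> (s' \<otimes> t'))" .
    have "frac (a' \<otimes> b') (s' \<otimes> t') = frac (a \<otimes> b) (s \<otimes> t)"
      by (rule frac_eqI[OF e' primeidealD(5)[OF P m(3,4)] _ _
            primeidealD(5)[OF P m(1,2)] primeidealD(5)[OF P assms(3,4)]]) (use d assms in auto)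
    then show "?F x y = ?F (a, s) (b, t)" using d by simp
  qed (use assms in auto)
  finally show ?thesis by simp
qed

lemma frac_add:
  assumes "a \<in> carrier R" "b \<in> carrier R" "s \<in> carrier R - P" "t \<in> carrier R - P"
  shows "frac a s \<oplus>\<^bsub>Loc\<^esub> frac b t = frac (a \<otimes> t \<oplus> b \<otimes> s) (s \<otimes> t)"
proof -
  let ?F = "\<lambda>(a, s) (b, t). frac (a \<otimes> t \<oplus> b \<otimes> s) (s \<otimes> t)"
  have "frac a s \<oplus>\<^bsub>Loc\<^esub> frac b t = (\<Union>x\<in>frac a s. \<Union>y\<in>frac b t. ?F x y)"
    unfolding localization_def by (simp add: frac_def split_def)
  also have "\<dots> = ?F (a, s) (b, t)"
    unfolding frac_def[of a s] frac_def[of b t]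
  proof (rule Union_class_pair[OF loc_rel_equiv loc_rel_equiv])
    fix x y assume "((a, s), x) \<in> loc_rel R P" "((b, t), y) \<in> loc_rel R P"
    then obtain a' s' b' t' u v where
      d: "x = (a', s')" "y = (b', t')" "a' \<in> carrier R" "b' \<in> carrier R"
      and m: "s' \<in> carrier R - P" "t' \<in> carrier R - P" "u \<in> carrier R - P" "v \<in> carrier R - P"
      and e: "u \<otimes> (a \<otimes> s') = u \<otimes> (a' \<otimes> s)" "v \<otimes> (b \<otimes> t') = v \<otimes> (b' \<otimes> t)"
      by (auto simp: loc_rel_def)
    have k: "s \<in> carrier R" "t \<in> carrier R" "s' \<in> carrier R" "t' \<in> carrier R" "u \<in> carrier R" "v \<in> carrier R"
      using m assms by auto
    have "(u \<otimes> v) \<otimes> ((a' \<otimes> t' \<oplus> b' \<otimes> s') \<otimes> (s \<otimes> t))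
      = (u \<otimes> (a' \<otimes> s)) \<otimes> (v \<otimes> t \<otimes> t') \<oplus> (v \<otimes> (b' \<otimes> t)) \<otimes> (u \<otimes> s \<otimes> s')"
      using d assms(1,2) k by algebra
    also have "\<dots> = (u \<otimes> v) \<otimes> ((a \<otimes> t \<oplus> b \<otimes> s) \<otimes> (s' \<otimes> t'))"
      unfolding e[symmetric] using d assms(1,2) k by algebra
    finally have "(u \<otimes> v) \<otimes> ((a' \<otimes> t' \<oplus> b' \<otimes> s') \<otimes> (s \<otimes> t))
      = (u \<otimes> v) \<otimes> ((a \<otimes> t \<oplus> b \<otimes> s) \<otimes> (s' \<otimes> t'))" .
    then have "frac (a' \<otimes> t' \<oplus> b' \<otimes> s') (s' \<otimes> t') = frac (a \<otimes> t \<oplus> b \<otimes> s) (s \<otimes> t)"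
      by (rule frac_eqI[OF _ primeidealD(5)[OF P m(3,4)] _ _
            primeidealD(5)[OF P m(1,2)] primeidealD(5)[OF P assms(3,4)]]) (use d assms k in auto)
    then show "?F x y = ?F (a, s) (b, t)" using d by simp
  qed (use assms in auto)
  finally show ?thesis by simp
qed

lemma one_mem: "\<one> \<in> carrier R - P" using primeidealD(2)[OF P] by auto

lemma Loc_one: "\<one>\<^bsub>Loc\<^esub> = frac \<one> \<one>" by (simp add: localization_def frac_def)
lemma Loc_zero: "\<zero>\<^bsub>Loc\<^esub> = frac \<zero> \<one>" by (simp add: localization_def frac_def)

text \<open>For a \<open>P\<close>-saturated ideal \<open>J\<close> this is its extension to the localization.\<close>

definition frac_ideal :: "'a set \<Rightarrow> ('a \<times> 'a) set set"
  where "frac_ideal J = {frac a s | a s. a \<in> J \<and> s \<in> carrier R - P}"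

text \<open>Extending an ideal and contracting it gives its saturation, hence the ideal itself when
  it is saturated.\<close>

lemma frac_mem_frac_ideal:
  assumes J: "ideal J R" "saturation P J \<subseteq> J" and "a \<in> carrier R" "s \<in> carrier R - P"
  shows "frac a s \<in> frac_ideal J \<longleftrightarrow> a \<in> J"
proof
  assume "frac a s \<in> frac_ideal J"
  then obtain b t where b: "b \<in> J" "t \<in> carrier R - P" "frac a s = frac b t"
    by (auto simp: frac_ideal_def)
  then obtain u where u: "u \<in> carrier R - P" "u \<otimes> (a \<otimes> t) = u \<otimes> (b \<otimes> s)"
    using frac_eq_iff assms idealD(8)[OF J(1)] by metis
  have "u \<in> carrier R" "t \<in> carrier R" using u b by auto
  then have "(u \<otimes> t) \<otimes> a = u \<otimes> (a \<otimes> t)" using assms(3) by algebra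
  also have "\<dots> \<in> J" unfolding u(2) using u b assms idealD[OF J(1)] by auto
  finally have "a \<in> saturation P J"
    using primeidealD(5)[OF P u(1) b(2)] assms by (intro saturationI)
  then show "a \<in> J" using J by auto
qed (use assms in \<open>auto simp: frac_ideal_def\<close>)

lemma frac_ideal_ideal:
  assumes J: "ideal J R"
  shows "ideal (frac_ideal J) Loc"
proof -
  interpret Loc: cring Loc by (rule L_cring)
  note Jc = idealD(8)[OF J]
  show ?thesis
  proof (rule Loc.cring_idealI)
    show "frac_ideal J \<subseteq> carrier Loc" using Jc frac_closed by (auto simp: frac_ideal_def)
    show "\<zero>\<^bsub>Loc\<^esub> \<in> frac_ideal J"
      unfolding Loc_zero frac_ideal_def using one_mem idealD(2)[OF J] by blast
  next
    fix x y assume "x \<in> frac_ideal J" "y \<in> frac_ideal J"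
    then obtain a s b t where "x = frac a s" "y = frac b t" and ab: "a \<in> J" "b \<in> J"
      and st: "s \<in> carrier R - P" "t \<in> carrier R - P" by (auto simp: frac_ideal_def)
    then have "x \<oplus>\<^bsub>Loc\<^esub> y = frac (a \<otimes> t \<oplus> b \<otimes> s) (s \<otimes> t)" using frac_add Jc by simp
    moreover have "a \<otimes> t \<oplus> b \<otimes> s \<in> J" using ab st idealD[OF J] by auto
    ultimately show "x \<oplus>\<^bsub>Loc\<^esub> y \<in> frac_ideal J"
      using primeidealD(5)[OF P st] unfolding frac_ideal_def by blast
  next
    fix c x assume "c \<in> carrier Loc" "x \<in> frac_ideal J"
    then obtain b t a s where "c = frac b t" "x = frac a s" and b: "b \<in> carrier R" and a: "a \<in> J"
      and st: "t \<in> carrier R - P" "s \<in> carrier R - P" by (auto simp: frac_ideal_def elim!: Loc_cases)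
    then have "c \<otimes>\<^bsub>Loc\<^esub> x = frac (b \<otimes> a) (t \<otimes> s)" using frac_mult Jc by simp
    moreover have "b \<otimes> a \<in> J" using a b idealD[OF J] by auto
    ultimately show "c \<otimes>\<^bsub>Loc\<^esub> x \<in> frac_ideal J"
      using primeidealD(5)[OF P st] unfolding frac_ideal_def by blast
  qed
qed

lemma frac_scale:
  assumes "a \<in> carrier R" "s \<in> carrier R - P"
  shows "frac a s \<otimes>\<^bsub>Loc\<^esub> frac s \<one> = frac a \<one>" "frac a \<one> \<otimes>\<^bsub>Loc\<^esub> frac \<one> s = frac a s"
proof -
  have "frac a s \<otimes>\<^bsub>Loc\<^esub> frac s \<one> = frac (a \<otimes> s) (s \<otimes> \<one>)"
    using assms one_mem by (intro frac_mult) auto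
  also have "\<dots> = frac a \<one>"
    using assms one_mem by (intro frac_eq_iff[THEN iffD2] bexI[of _ \<one>]) (auto simp: m_comm)
  finally show "frac a s \<otimes>\<^bsub>Loc\<^esub> frac s \<one> = frac a \<one>" .
  show "frac a \<one> \<otimes>\<^bsub>Loc\<^esub> frac \<one> s = frac a s"
    using frac_mult[of a \<one> \<one> s] assms one_mem by simp
qed

lemma ideal_unit:
  assumes I: "ideal I Loc" and "frac a s \<in> I" "a \<in> carrier R - P" "s \<in> carrier R - P"
  shows "I = carrier Loc"
proof -
  interpret Loc: cring Loc by (rule L_cring)
  have "frac s a \<otimes>\<^bsub>Loc\<^esub> frac a s = frac (s \<otimes> a) (a \<otimes> s)" using assms by (intro frac_mult) auto
  also have "\<dots> = \<one>\<^bsub>Loc\<^esub>" unfolding Loc_one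
    using assms one_mem primeidealD(5)[OF P assms(3,4)]
    by (intro frac_eq_iff[THEN iffD2] bexI[of _ \<one>]) (auto simp: m_comm)
  finally have "\<one>\<^bsub>Loc\<^esub> \<in> I"
    using Loc.idealD(6)[OF I frac_closed[of s a] assms(2)] assms(3,4) by auto
  then show ?thesis using ideal.one_imp_carrier[OF I] by auto
qed

lemma frac_ideal_maximal: "maximalideal (frac_ideal P) Loc"
proof -
  interpret Loc: cring Loc by (rule L_cring)
  note PP = primeidealD(1)[OF P] saturation_prime[OF P order_refl]
  show ?thesis
  proof (rule maximalidealI[OF frac_ideal_ideal[OF PP(1)]])
    have "\<one>\<^bsub>Loc\<^esub> \<notin> frac_ideal P"
      unfolding Loc_one using frac_mem_frac_ideal[OF PP] one_mem by auto
    then show "carrier Loc \<noteq> frac_ideal P" by auto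
  next
    fix J assume J: "ideal J Loc" "frac_ideal P \<subseteq> J" "J \<subseteq> carrier Loc"
    show "J = frac_ideal P \<or> J = carrier Loc"
    proof (cases "J \<subseteq> frac_ideal P")
      case False
      then obtain x where x: "x \<in> J" "x \<notin> frac_ideal P" by auto
      then have "x \<in> carrier Loc" using J(3) by auto
      then obtain a s where a: "a \<in> carrier R" "s \<in> carrier R - P" "x = frac a s"
        by (rule Loc_cases)
      then have "a \<notin> P" using x(2) by (auto simp: frac_ideal_def)
      then show ?thesis using ideal_unit[OF J(1), of a s] a x by auto
    qed (use J in auto)
  qed
qed

definition contraction :: "('a \<times> 'a) set set \<Rightarrow> 'a set"
  where "contraction Q = {a \<in> carrier R. frac a \<one> \<in> Q}"

lemma contraction_prime:
  assumes Q: "primeideal Q Loc"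
  shows "primeideal (contraction Q) R" "contraction Q \<subseteq> P"
proof -
  interpret Loc: cring Loc by (rule L_cring)
  note QQ = Loc.primeidealD[OF Q]
  have one: "\<one> \<notin> contraction Q" using QQ(2) by (simp add: contraction_def Loc_one)
  show "primeideal (contraction Q) R"
  proof (rule primeidealI[OF _ cring_axioms])
    show "ideal (contraction Q) R"
    proof (rule cring_idealI)
      show "contraction Q \<subseteq> carrier R" by (auto simp: contraction_def)
      show "\<zero> \<in> contraction Q" using Loc.idealD(2)[OF QQ(1)] by (auto simp: contraction_def Loc_zero)
      show "x \<oplus> y \<in> contraction Q" if "x \<in> contraction Q" "y \<in> contraction Q" for x y
        using that Loc.idealD(3)[OF QQ(1), of "frac x \<one>" "frac y \<one>"] frac_add[of x y \<one> \<one>] one_mem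
        by (auto simp: contraction_def)
      show "a \<otimes> x \<in> contraction Q" if "a \<in> carrier R" "x \<in> contraction Q" for a x
        using that Loc.idealD(6)[OF QQ(1), of "frac a \<one>" "frac x \<one>"] frac_mult[of a x \<one> \<one>] one_mem
          frac_closed by (auto simp: contraction_def)
    qed
    show "carrier R \<noteq> contraction Q" using one by auto
    show "a \<in> contraction Q \<or> b \<in> contraction Q"
      if "a \<in> carrier R" "b \<in> carrier R" "a \<otimes> b \<in> contraction Q" for a b
      using that QQ(4)[of "frac a \<one>" "frac b \<one>"] frac_mult[of a b \<one> \<one>] one_mem frac_closed
      by (auto simp: contraction_def)
  qed
  show "contraction Q \<subseteq> P"
  proof
    fix a assume a: "a \<in> contraction Q"
    show "a \<in> P"
    proof (rule ccontr)
      assume "a \<notin> P"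
      then have "Q = carrier Loc"
        using ideal_unit[OF QQ(1), of a \<one>] a one_mem by (auto simp: contraction_def)
      then show False using QQ(2) by auto
    qed
  qed
qed

text \<open>A fraction and its numerator differ by a unit factor, so a fraction in \<open>Q'\<close>
  but not in \<open>Q\<close> has a numerator of the same kind.\<close>

lemma contraction_strict:
  assumes Q: "primeideal Q Loc" and Q': "primeideal Q' Loc" and lt: "Q \<subset> Q'"
  shows "contraction Q \<subset> contraction Q'"
proof -
  interpret Loc: cring Loc by (rule L_cring)
  obtain x where x: "x \<in> Q'" "x \<notin> Q" using lt by auto
  obtain a s where a: "a \<in> carrier R" "s \<in> carrier R - P" "x = frac a s"
    using Loc_cases Loc.primeidealD(3)[OF Q'] x(1) by blast
  have "frac a \<one> \<in> Q'"
    using Loc.idealD(7)[OF Loc.primeidealD(1)[OF Q'], of "frac s \<one>" x] frac_scale(1)[of a s] a x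
      frac_closed one_mem by auto
  moreover have "frac a \<one> \<notin> Q"
    using Loc.idealD(7)[OF Loc.primeidealD(1)[OF Q], of "frac \<one> s" "frac a \<one>"] frac_scale(2)[of a s] a x
      frac_closed one_mem by auto
  ultimately show ?thesis using lt a by (auto simp: contraction_def)
qed

end

context noetherian_cring
begin

text \<open>Regularity of the local ring expressed in \<open>R\<close>: numerators of a smallest
  generating set of the maximal ideal generate \<open>P\<close> locally, and contraction yields a
  chain of primes at least as long as their number.\<close>

lemma regular_prime_system:
  assumes P: "primeideal P R" and reg: "regular_local_ring (localization R P)"
  obtains G n C where "finite G" "card G \<le> n" "G \<subseteq> P" "prime_chain n C" "C n = P"
    "P \<subseteq> saturation P (Idl G)"
proof -
  have "cring (localization R P)" using reg unfolding regular_local_ring_def by (rule conjunct1)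
  then interpret pl: prime_localization R P
    by (intro prime_localization.intro prime_localization_axioms.intro cring_axioms P)
  interpret Loc: cring "localization R P" by (rule pl.L_cring)
  note PP = primeidealD(1)[OF P] saturation_prime[OF P order_refl]
  define M where "M = pl.frac_ideal P"
  obtain M' where M': "\<And>I. maximalideal I pl.Loc \<longleftrightarrow> I = M'"
    "enat (min_generators pl.Loc M') = krull_dim pl.Loc"
    using reg by (auto simp: regular_local_ring_def)
  have "M' = M" using M'(1) pl.frac_ideal_maximal by (auto simp: M_def)
  define d where "d = min_generators pl.Loc M"
  have kd: "krull_dim pl.Loc = enat d" using M' \<open>M' = M\<close> by (simp add: d_def)
  have max: "maximalideal M pl.Loc" using M' \<open>M' = M\<close> by blast
  have "\<exists>n. \<exists>G\<subseteq>carrier pl.Loc. finite G \<and> card G = n \<and> M = Idl\<^bsub>pl.Loc\<^esub> G"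
    using noetherian_ring.finetely_gen[of pl.Loc M] reg maximalideal.axioms(1)[OF max]
    by (auto simp: regular_local_ring_def)
  from LeastI_ex[OF this] obtain G' where G': "G' \<subseteq> carrier pl.Loc" "finite G'" "card G' = d"
    "M = Idl\<^bsub>pl.Loc\<^esub> G'"
    by (auto simp: d_def min_generators_def)
  have "G' \<subseteq> M" using Loc.genideal_self[OF G'(1)] G'(4) by simp
  then have "\<forall>g\<in>G'. \<exists>a s. a \<in> P \<and> s \<in> carrier R - P \<and> g = pl.frac a s"
    unfolding M_def pl.frac_ideal_def by blast
  then obtain num den where nd: "\<And>g. g \<in> G' \<Longrightarrow> num g \<in> P" "\<And>g. g \<in> G' \<Longrightarrow> den g \<in> carrier R - P"
    "\<And>g. g \<in> G' \<Longrightarrow> g = pl.frac (num g) (den g)" by metis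
  define G where "G = num ` G'"
  have GP: "G \<subseteq> P" using nd by (auto simp: G_def)
  have Gc: "G \<subseteq> carrier R" using GP primeidealD(3)[OF P] by auto
  note iG = genideal_ideal[OF Gc]
  define J where "J = saturation P (Idl G)"
  have J: "ideal J R" "saturation P J \<subseteq> J"
    unfolding J_def by (rule saturation_ideal[OF P iG], rule saturation_idem[OF P])
  have "num g \<in> J" if "g \<in> G'" for g
    using that genideal_self[OF Gc] subset_saturation[OF P iG] by (auto simp: G_def J_def)
  then have "G' \<subseteq> pl.frac_ideal J"
    using nd unfolding pl.frac_ideal_def by blast
  then have MJ: "M \<subseteq> pl.frac_ideal J"
    unfolding G'(4) by (rule Loc.genideal_minimal[OF pl.frac_ideal_ideal[OF J(1)]])
  have gen: "P \<subseteq> J"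
  proof
    fix y assume y: "y \<in> P"
    then have "pl.frac y \<one> \<in> M" unfolding M_def pl.frac_ideal_def using pl.one_mem by blast
    then show "y \<in> J"
      using MJ pl.frac_mem_frac_ideal[OF J, of y \<one>] y primeidealD(3)[OF P] pl.one_mem by auto
  qed
  define N where "N = {n. \<exists>Q. (\<forall>i\<le>n. primeideal (Q i) pl.Loc) \<and> (\<forall>i<n. Q i \<subset> Q (Suc i))}"
  have "0 \<in> N"
    unfolding N_def using Loc.maximalideal_prime[OF max] by (auto intro: exI[of _ "\<lambda>_. M"])
  \<comment> \<open>The dimension is a supremum, so a chain has to be extracted from it. If every
    length were below \<open>d\<close>, then \<open>d > 0\<close>, as length 0 occurs, and the
    supremum would be at most \<open>d - 1\<close>.\<close>
  have "\<exists>n\<in>N. d \<le> n"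
  proof (rule ccontr)
    assume "\<not> ?thesis"
    then have lt: "n < d" if "n \<in> N" for n using that by auto
    then obtain d' where d': "d = Suc d'" using \<open>0 \<in> N\<close> by (cases d) auto
    have "krull_dim pl.Loc \<le> enat d'"
      unfolding krull_dim_def N_def[symmetric] using lt d' by (intro SUP_least) fastforce
    then show False using kd d' by simp
  qed
  then obtain n Q where n: "d \<le> n" and Q: "\<And>i. i \<le> n \<Longrightarrow> primeideal (Q i) pl.Loc"
    "\<And>i. i < n \<Longrightarrow> Q i \<subset> Q (Suc i)" by (auto simp: N_def)
  \<comment> \<open>The chain need not end in the maximal ideal. Putting \<open>P\<close> in the
    place of its top keeps it strict because all contractions lie in \<open>P\<close>.\<close>
  define C where "C i = (if i = n then P else pl.contraction (Q i))" for i
  have "primeideal (C i) R" if "i \<le> n" for i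
    using that P pl.contraction_prime(1)[OF Q(1)] by (simp add: C_def)
  moreover have "C i \<subset> C (Suc i)" if "i < n" for i
  proof -
    have "pl.contraction (Q i) \<subset> pl.contraction (Q (Suc i))"
      using that by (intro pl.contraction_strict Q) auto
    moreover have "pl.contraction (Q (Suc i)) \<subseteq> P"
      using that by (intro pl.contraction_prime(2) Q(1)) auto
    ultimately show ?thesis using that by (auto simp: C_def)
  qed
  ultimately have "prime_chain n C" by (simp add: prime_chain_def)
  moreover have "card G \<le> n" using card_image_le[OF G'(2), of num] G'(3) n by (simp add: G_def)
  moreover have "finite G" using G'(2) by (simp add: G_def)
  moreover have "C n = P" by (simp add: C_def)
  ultimately show thesis using that GP gen by (simp add: J_def)
qed

end

section \<open>Flatness by equations\<close>

lemma (in abelian_monoid) finsum_swap: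
  assumes "finite A" "finite B" "\<And>i j. i \<in> A \<Longrightarrow> j \<in> B \<Longrightarrow> f i j \<in> carrier G"
  shows "(\<Oplus>i\<in>A. \<Oplus>j\<in>B. f i j) = (\<Oplus>j\<in>B. \<Oplus>i\<in>A. f i j)"
  using assms(1,3)
proof (induction A)
  case empty
  then show ?case by simp
next
  case (insert x A)
  have "(\<Oplus>i\<in>insert x A. \<Oplus>j\<in>B. f i j) = (\<Oplus>j\<in>B. f x j) \<oplus> (\<Oplus>i\<in>A. \<Oplus>j\<in>B. f i j)"
    using insert.hyps insert.prems by (intro finsum_insert) (auto intro!: finsum_closed)
  also have "(\<Oplus>i\<in>A. \<Oplus>j\<in>B. f i j) = (\<Oplus>j\<in>B. \<Oplus>i\<in>A. f i j)"
    using insert by auto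
  also have "(\<Oplus>j\<in>B. f x j) \<oplus> \<dots> = (\<Oplus>j\<in>B. f x j \<oplus> (\<Oplus>i\<in>A. f i j))"
    using insert.prems by (intro finsum_addf[symmetric]) (auto intro!: finsum_closed)
  also have "\<dots> = (\<Oplus>j\<in>B. \<Oplus>i\<in>insert x A. f i j)"
    using insert.hyps insert.prems
    by (intro finsum_cong' finsum_insert[symmetric]) (auto intro!: finsum_closed)
  finally show ?case .
qed

lemma (in abelian_monoid) finsum_delta:
  assumes "finite A" "i \<in> A" "x \<in> carrier G"
  shows "(\<Oplus>j\<in>A. if j = i then x else \<zero>) = x"
  using finsum_singleton[OF assms(2,1), of "\<lambda>_. x"] assms(3) by (simp add: eq_commute[of _ i])

context cring
begin

lemma minus_add_cancel_right: "x \<in> carrier R \<Longrightarrow> y \<in> carrier R \<Longrightarrow> x = (x \<ominus> y) \<oplus> y"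
  by algebra

lemma finsum_lcomb_swap:
  assumes "finite A" "finite B" "\<And>i. i \<in> A \<Longrightarrow> a i \<in> carrier R" "\<And>b. b \<in> B \<Longrightarrow> e b \<in> carrier R"
    and "\<And>b i. b \<in> B \<Longrightarrow> i \<in> A \<Longrightarrow> H b i \<in> carrier R"
  shows "(\<Oplus>i\<in>A. a i \<otimes> (\<Oplus>b\<in>B. H b i \<otimes> e b)) = (\<Oplus>b\<in>B. (\<Oplus>i\<in>A. a i \<otimes> H b i) \<otimes> e b)"
proof -
  have "(\<Oplus>i\<in>A. a i \<otimes> (\<Oplus>b\<in>B. H b i \<otimes> e b)) = (\<Oplus>i\<in>A. \<Oplus>b\<in>B. a i \<otimes> H b i \<otimes> e b)"
    using assms by (intro finsum_cong' refl)
      (auto simp: finsum_rdistr Pi_def m_assoc intro!: finsum_closed finsum_cong')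
  also have "\<dots> = (\<Oplus>b\<in>B. \<Oplus>i\<in>A. a i \<otimes> H b i \<otimes> e b)"
    using assms by (intro finsum_swap) auto
  also have "\<dots> = (\<Oplus>b\<in>B. (\<Oplus>i\<in>A. a i \<otimes> H b i) \<otimes> e b)"
    using assms by (intro finsum_cong' refl) (auto simp: finsum_ldistr Pi_def intro!: finsum_closed)
  finally show ?thesis .
qed

lemma finsum_mem_ideal:
  assumes "ideal I R" "\<And>i. i \<in> A \<Longrightarrow> f i \<in> I"
  shows "(\<Oplus>i\<in>A. f i) \<in> I"
  using assms(2)
proof (induction A rule: infinite_finite_induct)
  case (insert x A)
  then have "(\<Oplus>i\<in>insert x A. f i) = f x \<oplus> (\<Oplus>i\<in>A. f i)"
    using idealD(8)[OF assms(1)] by (intro finsum_insert) auto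
  then show ?case using insert idealD(3)[OF assms(1)] by auto
qed (use idealD(2)[OF assms(1)] in auto)

lemma Idl_image_iff:
  assumes "finite A" "a \<in> A \<rightarrow> carrier R"
  shows "y \<in> Idl (a ` A) \<longleftrightarrow> (\<exists>g \<in> A \<rightarrow> carrier R. y = (\<Oplus>i\<in>A. a i \<otimes> g i))"
proof
  have im: "a ` A \<subseteq> carrier R" using assms by auto
  show "y \<in> Idl (a ` A)" if "\<exists>g \<in> A \<rightarrow> carrier R. y = (\<Oplus>i\<in>A. a i \<otimes> g i)"
    using that genideal_self[OF im] idealD(7)[OF genideal_ideal[OF im]]
    by (auto intro!: finsum_mem_ideal[OF genideal_ideal[OF im]])
  show "\<exists>g \<in> A \<rightarrow> carrier R. y = (\<Oplus>i\<in>A. a i \<otimes> g i)" if "y \<in> Idl (a ` A)"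
    using assms that
  proof (induction A arbitrary: y)
    case empty
    then show ?case by (simp add: Idl_empty)
  next
    case (insert x A)
    have "y \<in> Idl (a ` A) <+>\<^bsub>R\<^esub> PIdl (a x)"
      using insert.prems Idl_insert[of "a ` A" "a x"] by auto
    then obtain i r where i: "i \<in> Idl (a ` A)" and r: "r \<in> carrier R" and y: "y = i \<oplus> r \<otimes> a x"
      unfolding mem_adjoin by auto
    obtain g where g: "g \<in> A \<rightarrow> carrier R" "i = (\<Oplus>i\<in>A. a i \<otimes> g i)"
      using insert.IH[OF _ i] insert.prems by auto
    have ac: "a x \<in> carrier R" "\<And>i. i \<in> A \<Longrightarrow> a i \<in> carrier R" using insert.prems by auto
    have "(\<Oplus>i\<in>insert x A. a i \<otimes> (g(x := r)) i) = a x \<otimes> r \<oplus> (\<Oplus>i\<in>A. a i \<otimes> (g(x := r)) i)"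
      using insert.hyps ac g r by (subst finsum_insert) (auto simp: Pi_def)
    also have "(\<Oplus>i\<in>A. a i \<otimes> (g(x := r)) i) = (\<Oplus>i\<in>A. a i \<otimes> g i)"
      using insert.hyps ac g by (intro finsum_cong' refl) auto
    also have "a x \<otimes> r \<oplus> \<dots> = y"
      unfolding y g(2)[symmetric] using ac r g i
      by (simp add: a_comm m_comm finsum_closed Pi_def)
    finally show ?case using g r by (intro bexI[of _ "g(x := r)"]) auto
  qed
qed

text \<open>The syzygies of the \<open>a i\<close>; values outside \<open>A\<close> are left free,
  in accordance with \<open>hom_span\<close>.\<close>

definition relations :: "'i set \<Rightarrow> ('i \<Rightarrow> 'a) \<Rightarrow> ('i \<Rightarrow> 'a) set"
  where "relations A a = {c \<in> A \<rightarrow> carrier R. (\<Oplus>i\<in>A. a i \<otimes> c i) = \<zero>}"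

lemma relations_funcset: "relations A a \<subseteq> A \<rightarrow> carrier R"
  unfolding relations_def by blast

end

context ring_hom_cring
begin

text \<open>The \<open>S\<close>-span of the image of \<open>V\<close>; vectors matter only through their values on \<open>A\<close>.\<close>

inductive hom_span :: "'i set \<Rightarrow> ('i \<Rightarrow> _) set \<Rightarrow> ('i \<Rightarrow> _) \<Rightarrow> bool" for A V where
  zero: "(\<And>i. i \<in> A \<Longrightarrow> s i = \<zero>\<^bsub>S\<^esub>) \<Longrightarrow> hom_span A V s"
| add: "hom_span A V s \<Longrightarrow> c \<in> V \<Longrightarrow> t \<in> carrier S \<Longrightarrow>
    (\<And>i. i \<in> A \<Longrightarrow> s' i = s i \<oplus>\<^bsub>S\<^esub> h (c i) \<otimes>\<^bsub>S\<^esub> t) \<Longrightarrow> hom_span A V s'"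

lemma hom_span_closed:
  assumes "hom_span A V s" "V \<subseteq> A \<rightarrow> carrier R" "i \<in> A"
  shows "s i \<in> carrier S"
  using assms
proof (induction rule: hom_span.induct)
  case (add s c t s')
  then have "c i \<in> carrier R" by auto
  then show ?case using add by auto
qed auto

lemma hom_span_cong:
  assumes "hom_span A V s" "\<And>i. i \<in> A \<Longrightarrow> s' i = s i"
  shows "hom_span A V s'"
  using assms(1)
proof cases
  case zero
  then show ?thesis using assms(2) by (intro hom_span.zero) auto
next
  case (add s0 c t)
  show ?thesis by (rule hom_span.add[OF add(1-3)]) (simp add: add(4) assms(2))
qed

lemma hom_span_add:
  assumes V: "V \<subseteq> A \<rightarrow> carrier R" and s: "hom_span A V s" and s': "hom_span A V s'"
  shows "hom_span A V (\<lambda>i. s i \<oplus>\<^bsub>S\<^esub> s' i)"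
  using s'
proof (induction rule: hom_span.induct)
  case (zero s')
  then show ?case using hom_span_closed[OF s V] by (intro hom_span_cong[OF s]) auto
next
  case (add s0 c t s')
  show ?case
  proof (rule hom_span.add[OF add.IH add.hyps(2,3)])
    fix i assume i: "i \<in> A"
    have "c i \<in> carrier R" using add.hyps(2) V i by auto
    then show "s i \<oplus>\<^bsub>S\<^esub> s' i = s i \<oplus>\<^bsub>S\<^esub> s0 i \<oplus>\<^bsub>S\<^esub> h (c i) \<otimes>\<^bsub>S\<^esub> t"
      using add.hyps i hom_span_closed[OF s V i] hom_span_closed[OF add.hyps(1) V i]
      by (simp add: S.a_assoc)
  qed
qed

lemma hom_span_single:
  assumes V: "V \<subseteq> A \<rightarrow> carrier R" and "c \<in> V" "t \<in> carrier S"
  shows "hom_span A V (\<lambda>i. h (c i) \<otimes>\<^bsub>S\<^esub> t)"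
proof (rule hom_span.add[OF hom_span.zero[of A "\<lambda>_. \<zero>\<^bsub>S\<^esub>"] assms(2,3)])
  fix i assume "i \<in> A"
  then have "c i \<in> carrier R" using assms by auto
  then show "h (c i) \<otimes>\<^bsub>S\<^esub> t = \<zero>\<^bsub>S\<^esub> \<oplus>\<^bsub>S\<^esub> h (c i) \<otimes>\<^bsub>S\<^esub> t" using assms by simp
qed auto

lemma hom_span_sum:
  assumes V: "V \<subseteq> A \<rightarrow> carrier R" and "\<And>k. k \<in> K \<Longrightarrow> hom_span A V (s k)"
  shows "hom_span A V (\<lambda>i. \<Oplus>\<^bsub>S\<^esub>k\<in>K. s k i)"
  using assms(2)
proof (induction K rule: infinite_finite_induct)
  case (insert k K)
  have "hom_span A V (\<lambda>i. s k i \<oplus>\<^bsub>S\<^esub> (\<Oplus>\<^bsub>S\<^esub>k\<in>K. s k i))"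
    using insert by (intro hom_span_add[OF V]) auto
  then show ?case
  proof (rule hom_span_cong)
    fix i assume "i \<in> A"
    then have "s l i \<in> carrier S" if "l \<in> insert k K" for l
      using hom_span_closed[OF insert.prems[OF that] V] by auto
    then show "(\<Oplus>\<^bsub>S\<^esub>k\<in>insert k K. s k i) = s k i \<oplus>\<^bsub>S\<^esub> (\<Oplus>\<^bsub>S\<^esub>k\<in>K. s k i)"
      using insert.hyps by (intro S.finsum_insert) auto
  qed
qed (auto intro: hom_span.zero)

text \<open>\<open>H\<close> is the matrix of a linear map from \<open>R^B\<close> to
  \<open>R^A\<close> that carries \<open>W\<close> into \<open>V\<close>. Extended to
  \<open>S\<close>, it carries one span into the other.\<close>

lemma hom_span_push:
  assumes "finite B" and W: "W \<subseteq> B \<rightarrow> carrier R"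
    and H: "\<And>b i. b \<in> B \<Longrightarrow> i \<in> A \<Longrightarrow> H b i \<in> carrier R"
    and V: "\<And>e. e \<in> W \<Longrightarrow> (\<lambda>i. \<Oplus>b\<in>B. H b i \<otimes> e b) \<in> V"
    and "hom_span B W w"
  shows "hom_span A V (\<lambda>i. \<Oplus>\<^bsub>S\<^esub>b\<in>B. h (H b i) \<otimes>\<^bsub>S\<^esub> w b)"
  using assms(5)
proof (induction rule: hom_span.induct)
  case (zero w)
  have "(\<Oplus>\<^bsub>S\<^esub>b\<in>B. h (H b i) \<otimes>\<^bsub>S\<^esub> w b) = (\<Oplus>\<^bsub>S\<^esub>b\<in>B. \<zero>\<^bsub>S\<^esub>)" if "i \<in> A" for i
    using zero H that by (intro S.finsum_cong') auto
  then show ?case by (intro hom_span.zero) auto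
next
  case (add w0 e t w)
  show ?case
  proof (rule hom_span.add[OF add.IH V[OF add.hyps(2)] add.hyps(3)])
    fix i assume i: "i \<in> A"
    have e: "e b \<in> carrier R" if "b \<in> B" for b using W add.hyps(2) that by auto
    have w0: "w0 b \<in> carrier S" if "b \<in> B" for b using hom_span_closed[OF add.hyps(1) W that] .
    have "(\<Oplus>\<^bsub>S\<^esub>b\<in>B. h (H b i) \<otimes>\<^bsub>S\<^esub> w b)
      = (\<Oplus>\<^bsub>S\<^esub>b\<in>B. h (H b i) \<otimes>\<^bsub>S\<^esub> w0 b \<oplus>\<^bsub>S\<^esub> h (H b i \<otimes> e b) \<otimes>\<^bsub>S\<^esub> t)"
      using add.hyps i e w0 H by (intro S.finsum_cong') (auto simp: S.r_distr S.m_assoc)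
    also have "\<dots> = (\<Oplus>\<^bsub>S\<^esub>b\<in>B. h (H b i) \<otimes>\<^bsub>S\<^esub> w0 b) \<oplus>\<^bsub>S\<^esub> (\<Oplus>\<^bsub>S\<^esub>b\<in>B. h (H b i \<otimes> e b) \<otimes>\<^bsub>S\<^esub> t)"
      using add.hyps i e w0 H by (intro S.finsum_addf) auto
    also have "(\<Oplus>\<^bsub>S\<^esub>b\<in>B. h (H b i \<otimes> e b) \<otimes>\<^bsub>S\<^esub> t) = h (\<Oplus>b\<in>B. H b i \<otimes> e b) \<otimes>\<^bsub>S\<^esub> t"
      using add.hyps i e H assms(1) by (subst S.finsum_ldistr[symmetric]) (auto simp: comp_def Pi_def)
    finally show "(\<Oplus>\<^bsub>S\<^esub>b\<in>B. h (H b i) \<otimes>\<^bsub>S\<^esub> w b)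
      = (\<Oplus>\<^bsub>S\<^esub>b\<in>B. h (H b i) \<otimes>\<^bsub>S\<^esub> w0 b) \<oplus>\<^bsub>S\<^esub> h (\<Oplus>b\<in>B. H b i \<otimes> e b) \<otimes>\<^bsub>S\<^esub> t" .
  qed
qed

lemma hom_span_smult:
  assumes V: "V \<subseteq> A \<rightarrow> carrier R" and "hom_span A V s" and u: "u \<in> carrier S"
  shows "hom_span A V (\<lambda>i. u \<otimes>\<^bsub>S\<^esub> s i)"
  using assms(2)
proof (induction rule: hom_span.induct)
  case (zero s)
  then show ?case using u by (intro hom_span.zero) auto
next
  case (add s0 c t s)
  show ?case
  proof (rule hom_span.add[OF add.IH add.hyps(2)])
    show "u \<otimes>\<^bsub>S\<^esub> t \<in> carrier S" using u add by auto
    fix i assume i: "i \<in> A"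
    have "c i \<in> carrier R" using V i add.hyps(2) by auto
    then have "h (c i) \<in> carrier S" by simp
    then show "u \<otimes>\<^bsub>S\<^esub> s i = u \<otimes>\<^bsub>S\<^esub> s0 i \<oplus>\<^bsub>S\<^esub> h (c i) \<otimes>\<^bsub>S\<^esub> (u \<otimes>\<^bsub>S\<^esub> t)"
      using add.hyps(3,4) i u hom_span_closed[OF add.hyps(1) V i] by (simp add: S.r_distr S.m_lcomm)
  qed
qed

text \<open>The multiplier \<open>u\<close> acts as a common denominator: with \<open>u\<close>
  outside a prime, this is the lifting of relations after localization at that prime.\<close>

definition relations_lift_up_to :: "_ \<Rightarrow> 'i set \<Rightarrow> ('i \<Rightarrow> _) \<Rightarrow> bool"
  where "relations_lift_up_to u A a \<longleftrightarrow> (\<forall>s \<in> A \<rightarrow> carrier S.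
    (\<Oplus>\<^bsub>S\<^esub>i\<in>A. h (a i) \<otimes>\<^bsub>S\<^esub> s i) = \<zero>\<^bsub>S\<^esub> \<longrightarrow> hom_span A (R.relations A a) (\<lambda>i. h u \<otimes>\<^bsub>S\<^esub> s i))"

abbreviation relations_lift :: "'i set \<Rightarrow> ('i \<Rightarrow> _) \<Rightarrow> bool"
  where "relations_lift \<equiv> relations_lift_up_to \<one>"

text \<open>The equational criterion for flatness of \<open>S\<close> over \<open>R\<close>.\<close>

definition flat :: bool
  where "flat \<longleftrightarrow> (\<forall>(A :: nat set) a. finite A \<longrightarrow> a \<in> A \<rightarrow> carrier R \<longrightarrow> relations_lift A a)"

lemma relations_liftI:
  assumes "\<And>s. s \<in> A \<rightarrow> carrier S \<Longrightarrow> (\<Oplus>\<^bsub>S\<^esub>i\<in>A. h (a i) \<otimes>\<^bsub>S\<^esub> s i) = \<zero>\<^bsub>S\<^esub> \<Longrightarrow>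
    hom_span A (R.relations A a) s"
  shows "relations_lift A a"
  unfolding relations_lift_up_to_def
proof (intro ballI impI)
  fix s assume s: "s \<in> A \<rightarrow> carrier S" "(\<Oplus>\<^bsub>S\<^esub>i\<in>A. h (a i) \<otimes>\<^bsub>S\<^esub> s i) = \<zero>\<^bsub>S\<^esub>"
  show "hom_span A (R.relations A a) (\<lambda>i. h \<one> \<otimes>\<^bsub>S\<^esub> s i)"
    by (rule hom_span_cong[OF assms[OF s]]) (simp add: funcset_mem[OF s(1)])
qed

lemma relations_liftD:
  assumes "relations_lift A a" "s \<in> A \<rightarrow> carrier S" "(\<Oplus>\<^bsub>S\<^esub>i\<in>A. h (a i) \<otimes>\<^bsub>S\<^esub> s i) = \<zero>\<^bsub>S\<^esub>"
  shows "hom_span A (R.relations A a) s"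
proof (rule hom_span_cong)
  show "hom_span A (R.relations A a) (\<lambda>i. h \<one> \<otimes>\<^bsub>S\<^esub> s i)"
    using assms unfolding relations_lift_up_to_def by blast
  show "s i = h \<one> \<otimes>\<^bsub>S\<^esub> s i" if "i \<in> A" for i
    using funcset_mem[OF assms(2) that] by simp
qed

text \<open>This is the vanishing of \<open>Tor\<^sub>1 (R/I, S)\<close> for \<open>I = (a\<^sub>i | i \<in> A)\<close>, deduced from that for
  \<open>I + (a\<^sub>j)\<close> by way of \<open>0 \<rightarrow> R/(I : a\<^sub>j) \<rightarrow> R/I \<rightarrow> R/(I + (a\<^sub>j)) \<rightarrow> 0\<close>.\<close>

lemma relations_lift_remove:
  assumes A: "finite A" "j \<notin> A" and a: "a \<in> insert j A \<rightarrow> carrier R"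
    and B: "finite B" and e: "e \<in> B \<rightarrow> carrier R"
    and H: "\<And>b i. b \<in> B \<Longrightarrow> i \<in> A \<Longrightarrow> H b i \<in> carrier R"
    and eq: "\<And>b. b \<in> B \<Longrightarrow> (\<Oplus>i\<in>A. a i \<otimes> H b i) = \<ominus> (a j \<otimes> e b)"
    and gen: "\<And>d. d \<in> carrier R \<Longrightarrow> d \<otimes> a j \<in> Idl (a ` A) \<Longrightarrow> d \<in> Idl (e ` B)"
    and lift: "relations_lift (insert j A) a"
    and hyp: "\<And>w. w \<in> B \<rightarrow> carrier S \<Longrightarrow> (\<Oplus>\<^bsub>S\<^esub>b\<in>B. h (e b) \<otimes>\<^bsub>S\<^esub> w b) = \<zero>\<^bsub>S\<^esub> \<Longrightarrow>
      hom_span A (R.relations A a) (\<lambda>i. \<Oplus>\<^bsub>S\<^esub>b\<in>B. h (H b i) \<otimes>\<^bsub>S\<^esub> w b)"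
  shows "relations_lift A a"
proof (rule relations_liftI)
  have aA: "a \<in> A \<rightarrow> carrier R" and aj: "a j \<in> carrier R" using a by auto
  have ai: "a i \<in> carrier R" if "i \<in> A" for i using aA that by auto
  have eb: "e b \<in> carrier R" if "b \<in> B" for b using e that by auto
  note rel = R.relations_funcset
  \<comment> \<open>\<open>H b\<close>, completed by \<open>e b\<close> at \<open>j\<close>, is a
    relation on \<open>insert j A\<close>. As the ideal of the \<open>e b\<close> contains the colon
    ideal, every relation is a combination of these and one supported on \<open>A\<close>;
    \<open>key\<close> carries this decomposition over to the span. Then \<open>hyp\<close> only has
    to place the \<open>H\<close>-image of a relation between the \<open>e b\<close>.\<close>
  have key: "\<exists>f w. w \<in> B \<rightarrow> carrier S \<and> hom_span A (R.relations A a) f \<and>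
      (\<forall>i\<in>A. v i = f i \<oplus>\<^bsub>S\<^esub> (\<Oplus>\<^bsub>S\<^esub>b\<in>B. h (H b i) \<otimes>\<^bsub>S\<^esub> w b)) \<and>
      v j = (\<Oplus>\<^bsub>S\<^esub>b\<in>B. h (e b) \<otimes>\<^bsub>S\<^esub> w b)"
    if "hom_span (insert j A) (R.relations (insert j A) a) v" for v
    using that
  proof (induction rule: hom_span.induct)
    case (zero v)
    have "(\<Oplus>\<^bsub>S\<^esub>b\<in>B. h (H b i) \<otimes>\<^bsub>S\<^esub> \<zero>\<^bsub>S\<^esub>) = \<zero>\<^bsub>S\<^esub>" if "i \<in> A" for i
      using H that by (intro S.add.finprod_one_eqI) auto
    moreover have "(\<Oplus>\<^bsub>S\<^esub>b\<in>B. h (e b) \<otimes>\<^bsub>S\<^esub> \<zero>\<^bsub>S\<^esub>) = \<zero>\<^bsub>S\<^esub>"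
      using eb by (intro S.add.finprod_one_eqI) auto
    ultimately show ?case using zero
      by (intro exI[of _ "\<lambda>_. \<zero>\<^bsub>S\<^esub>"] conjI hom_span.zero) auto
  next
    case (add v0 c t v)
    obtain f w where w: "w \<in> B \<rightarrow> carrier S" and f: "hom_span A (R.relations A a) f"
      and v0: "\<And>i. i \<in> A \<Longrightarrow> v0 i = f i \<oplus>\<^bsub>S\<^esub> (\<Oplus>\<^bsub>S\<^esub>b\<in>B. h (H b i) \<otimes>\<^bsub>S\<^esub> w b)"
      and v0j: "v0 j = (\<Oplus>\<^bsub>S\<^esub>b\<in>B. h (e b) \<otimes>\<^bsub>S\<^esub> w b)" using add.IH by blast
    have wb: "w b \<in> carrier S" if "b \<in> B" for b using w that by auto
    have fc: "f i \<in> carrier S" if "i \<in> A" for i using hom_span_closed[OF f rel that] .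
    have cj: "c j \<in> carrier R" and ci: "\<And>i. i \<in> A \<Longrightarrow> c i \<in> carrier R"
      and c0: "(\<Oplus>i\<in>insert j A. a i \<otimes> c i) = \<zero>"
      using add.hyps(2) by (auto simp: R.relations_def)
    have sc: "(\<Oplus>i\<in>A. a i \<otimes> c i) \<in> carrier R" using ai ci by (intro R.finsum_closed) auto
    have c0': "a j \<otimes> c j \<oplus> (\<Oplus>i\<in>A. a i \<otimes> c i) = \<zero>"
      using c0 R.finsum_insert[OF A, of "\<lambda>i. a i \<otimes> c i"] aj cj ai ci by simp
    have "c j \<otimes> a j = \<ominus> (\<Oplus>i\<in>A. a i \<otimes> c i)"
      using R.sum_zero_eq_neg[OF _ sc c0'] aj cj by (simp add: R.m_comm)
    moreover have "(\<Oplus>i\<in>A. a i \<otimes> c i) \<in> Idl (a ` A)"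
      using R.Idl_image_iff[OF A(1) aA] ci by blast
    moreover have "ideal (Idl (a ` A)) R" using aA by (intro R.genideal_ideal) auto
    ultimately have "c j \<otimes> a j \<in> Idl (a ` A)" using R.idealD(5) by simp
    then have "c j \<in> Idl (e ` B)" by (rule gen[OF cj])
    then obtain g where "g \<in> B \<rightarrow> carrier R" and cjg: "c j = (\<Oplus>b\<in>B. e b \<otimes> g b)"
      using R.Idl_image_iff[OF B e] by blast
    then have g: "g b \<in> carrier R" if "b \<in> B" for b using that by auto
    have Hg: "(\<Oplus>b\<in>B. H b i \<otimes> g b) \<in> carrier R" if "i \<in> A" for i
      using that H g by (intro R.finsum_closed) auto
    \<comment> \<open>Subtracting the combination with coefficients \<open>g\<close> clears the
      entry at \<open>j\<close> and leaves a relation on \<open>A\<close>.\<close>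
    define c' where "c' i = c i \<ominus> (\<Oplus>b\<in>B. H b i \<otimes> g b)" for i
    have c'c: "c' i \<in> carrier R" if "i \<in> A" for i using that ci Hg by (simp add: c'_def)
    have "(\<Oplus>i\<in>A. a i \<otimes> (\<Oplus>b\<in>B. H b i \<otimes> g b)) = (\<Oplus>b\<in>B. (\<Oplus>i\<in>A. a i \<otimes> H b i) \<otimes> g b)"
      using A(1) B ai g H by (rule R.finsum_lcomb_swap)
    also have "\<dots> = (\<Oplus>b\<in>B. \<ominus> (a j) \<otimes> (e b \<otimes> g b))"
      using eq aj eb g by (intro R.finsum_cong') (auto simp: R.m_assoc R.l_minus)
    also have "\<dots> = \<ominus> (a j) \<otimes> c j"
      unfolding cjg using aj eb g B by (intro R.finsum_rdistr[symmetric]) auto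
    finally have Hsum: "(\<Oplus>i\<in>A. a i \<otimes> (\<Oplus>b\<in>B. H b i \<otimes> g b)) = \<ominus> (a j) \<otimes> c j" .
    have "(\<Oplus>i\<in>A. a i \<otimes> c i) = (\<Oplus>i\<in>A. a i \<otimes> c' i \<oplus> a i \<otimes> (\<Oplus>b\<in>B. H b i \<otimes> g b))"
    proof (rule R.finsum_cong')
      fix i assume i: "i \<in> A"
      have "c i = c' i \<oplus> (\<Oplus>b\<in>B. H b i \<otimes> g b)"
        unfolding c'_def using ci[OF i] Hg[OF i] by (rule R.minus_add_cancel_right)
      then show "a i \<otimes> c i = a i \<otimes> c' i \<oplus> a i \<otimes> (\<Oplus>b\<in>B. H b i \<otimes> g b)"
        using ai[OF i] c'c[OF i] Hg[OF i] by (metis R.r_distr)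
    qed (use ai ci c'c Hg in auto)
    also have "\<dots> = (\<Oplus>i\<in>A. a i \<otimes> c' i) \<oplus> (\<Oplus>i\<in>A. a i \<otimes> (\<Oplus>b\<in>B. H b i \<otimes> g b))"
      using ai c'c Hg by (intro R.finsum_addf) auto
    finally have "(\<Oplus>i\<in>A. a i \<otimes> c i) = (\<Oplus>i\<in>A. a i \<otimes> c' i) \<oplus> \<ominus> (a j) \<otimes> c j" unfolding Hsum .
    moreover have sc': "(\<Oplus>i\<in>A. a i \<otimes> c' i) \<in> carrier R"
      using ai c'c by (intro R.finsum_closed) auto
    ultimately have "a j \<otimes> c j \<oplus> ((\<Oplus>i\<in>A. a i \<otimes> c' i) \<oplus> \<ominus> (a j) \<otimes> c j) = \<zero>" using c0' by simp
    moreover have "x \<otimes> y \<oplus> (z \<oplus> \<ominus> x \<otimes> y) = z"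
      if "x \<in> carrier R" "y \<in> carrier R" "z \<in> carrier R" for x y z using that by algebra
    note this[OF aj cj sc']
    ultimately have c'rel: "c' \<in> R.relations A a" using c'c by (auto simp: R.relations_def)
    define f' where "f' i = f i \<oplus>\<^bsub>S\<^esub> h (c' i) \<otimes>\<^bsub>S\<^esub> t" for i
    define w' where "w' b = w b \<oplus>\<^bsub>S\<^esub> h (g b) \<otimes>\<^bsub>S\<^esub> t" for b
    have f': "hom_span A (R.relations A a) f'"
      by (rule hom_span.add[OF f c'rel add.hyps(3)]) (simp add: f'_def)
    have split: "(\<Oplus>\<^bsub>S\<^esub>b\<in>B. h (k b) \<otimes>\<^bsub>S\<^esub> w' b)
        = (\<Oplus>\<^bsub>S\<^esub>b\<in>B. h (k b) \<otimes>\<^bsub>S\<^esub> w b) \<oplus>\<^bsub>S\<^esub> h (\<Oplus>b\<in>B. k b \<otimes> g b) \<otimes>\<^bsub>S\<^esub> t"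
      if k: "\<And>b. b \<in> B \<Longrightarrow> k b \<in> carrier R" for k
    proof -
      have "(\<Oplus>\<^bsub>S\<^esub>b\<in>B. h (k b) \<otimes>\<^bsub>S\<^esub> w' b)
        = (\<Oplus>\<^bsub>S\<^esub>b\<in>B. h (k b) \<otimes>\<^bsub>S\<^esub> w b \<oplus>\<^bsub>S\<^esub> h (k b \<otimes> g b) \<otimes>\<^bsub>S\<^esub> t)"
        using k wb g add.hyps(3) by (intro S.finsum_cong') (auto simp: w'_def S.r_distr S.m_assoc)
      also have "\<dots> = (\<Oplus>\<^bsub>S\<^esub>b\<in>B. h (k b) \<otimes>\<^bsub>S\<^esub> w b) \<oplus>\<^bsub>S\<^esub> (\<Oplus>\<^bsub>S\<^esub>b\<in>B. h (k b \<otimes> g b) \<otimes>\<^bsub>S\<^esub> t)"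
        using k wb g add.hyps(3) by (intro S.finsum_addf) auto
      also have "(\<Oplus>\<^bsub>S\<^esub>b\<in>B. h (k b \<otimes> g b) \<otimes>\<^bsub>S\<^esub> t) = h (\<Oplus>b\<in>B. k b \<otimes> g b) \<otimes>\<^bsub>S\<^esub> t"
        using k g add.hyps(3) B by (subst S.finsum_ldistr[symmetric]) (auto simp: comp_def Pi_def)
      finally show ?thesis .
    qed
    have "v i = f' i \<oplus>\<^bsub>S\<^esub> (\<Oplus>\<^bsub>S\<^esub>b\<in>B. h (H b i) \<otimes>\<^bsub>S\<^esub> w' b)" if i: "i \<in> A" for i
    proof -
      define y where "y = (\<Oplus>\<^bsub>S\<^esub>b\<in>B. h (H b i) \<otimes>\<^bsub>S\<^esub> w b)"
      define z where "z = (\<Oplus>b\<in>B. H b i \<otimes> g b)"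
      have yc: "y \<in> carrier S" unfolding y_def using H i wb by (intro S.finsum_closed) auto
      have zc: "z \<in> carrier R" using Hg i by (simp add: z_def)
      have "c i = c' i \<oplus> z"
        unfolding c'_def z_def[symmetric] using ci[OF i] zc by (rule R.minus_add_cancel_right)
      then have hc: "h (c i) = h (c' i) \<oplus>\<^bsub>S\<^esub> h z" using c'c[OF i] zc by simp
      have k: "h (c' i) \<in> carrier S" "h z \<in> carrier S" using c'c[OF i] zc by auto
      have "v i = f i \<oplus>\<^bsub>S\<^esub> y \<oplus>\<^bsub>S\<^esub> (h (c' i) \<oplus>\<^bsub>S\<^esub> h z) \<otimes>\<^bsub>S\<^esub> t"
        using add.hyps(4)[of i] v0[OF i] i by (simp add: y_def hc)
      also have "\<dots> = f i \<oplus>\<^bsub>S\<^esub> h (c' i) \<otimes>\<^bsub>S\<^esub> t \<oplus>\<^bsub>S\<^esub> (y \<oplus>\<^bsub>S\<^esub> h z \<otimes>\<^bsub>S\<^esub> t)"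
        using fc[OF i] yc k add.hyps(3) by (simp add: S.l_distr S.a_ac)
      also have "y \<oplus>\<^bsub>S\<^esub> h z \<otimes>\<^bsub>S\<^esub> t = (\<Oplus>\<^bsub>S\<^esub>b\<in>B. h (H b i) \<otimes>\<^bsub>S\<^esub> w' b)"
        unfolding y_def z_def using H i by (intro split[symmetric]) auto
      finally show ?thesis by (simp add: f'_def)
    qed
    moreover have "v j = (\<Oplus>\<^bsub>S\<^esub>b\<in>B. h (e b) \<otimes>\<^bsub>S\<^esub> w' b)"
      using add.hyps(4)[of j] v0j cjg split[OF eb] by simp
    moreover have "w' \<in> B \<rightarrow> carrier S" using wb g add.hyps(3) by (auto simp: w'_def)
    ultimately show ?case using f' by blast
  qed
  fix s assume s: "s \<in> A \<rightarrow> carrier S" and s0: "(\<Oplus>\<^bsub>S\<^esub>i\<in>A. h (a i) \<otimes>\<^bsub>S\<^esub> s i) = \<zero>\<^bsub>S\<^esub>"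
  \<comment> \<open>Padded with zero at \<open>j\<close>, the relation becomes one on
    \<open>insert j A\<close>. The zero entry makes the coefficients \<open>w\<close> from
    \<open>key\<close> a relation between the \<open>e b\<close>, to which \<open>hyp\<close>
    applies.\<close>
  define s' where "s' = s(j := \<zero>\<^bsub>S\<^esub>)"
  have s'c: "s' \<in> insert j A \<rightarrow> carrier S" using s by (auto simp: s'_def)
  have "(\<Oplus>\<^bsub>S\<^esub>i\<in>insert j A. h (a i) \<otimes>\<^bsub>S\<^esub> s' i)
    = h (a j) \<otimes>\<^bsub>S\<^esub> s' j \<oplus>\<^bsub>S\<^esub> (\<Oplus>\<^bsub>S\<^esub>i\<in>A. h (a i) \<otimes>\<^bsub>S\<^esub> s' i)"
    using A a s'c by (intro S.finsum_insert) auto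
  also have "(\<Oplus>\<^bsub>S\<^esub>i\<in>A. h (a i) \<otimes>\<^bsub>S\<^esub> s' i) = (\<Oplus>\<^bsub>S\<^esub>i\<in>A. h (a i) \<otimes>\<^bsub>S\<^esub> s i)"
    using A s ai by (intro S.finsum_cong') (auto simp: s'_def)
  finally have "(\<Oplus>\<^bsub>S\<^esub>i\<in>insert j A. h (a i) \<otimes>\<^bsub>S\<^esub> s' i) = \<zero>\<^bsub>S\<^esub>"
    using s0 aj by (simp add: s'_def)
  then have "hom_span (insert j A) (R.relations (insert j A) a) s'"
    by (rule relations_liftD[OF lift s'c])
  from key[OF this] obtain f w where w: "w \<in> B \<rightarrow> carrier S" and f: "hom_span A (R.relations A a) f"
      and si: "\<And>i. i \<in> A \<Longrightarrow> s' i = f i \<oplus>\<^bsub>S\<^esub> (\<Oplus>\<^bsub>S\<^esub>b\<in>B. h (H b i) \<otimes>\<^bsub>S\<^esub> w b)"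
      and sj: "s' j = (\<Oplus>\<^bsub>S\<^esub>b\<in>B. h (e b) \<otimes>\<^bsub>S\<^esub> w b)" by blast
  have "(\<Oplus>\<^bsub>S\<^esub>b\<in>B. h (e b) \<otimes>\<^bsub>S\<^esub> w b) = \<zero>\<^bsub>S\<^esub>" using sj by (simp add: s'_def)
  from hom_span_add[OF rel f hyp[OF w this]]
  show "hom_span A (R.relations A a) s"
  proof (rule hom_span_cong)
    fix i assume i: "i \<in> A"
    then have "s i = s' i" using A by (auto simp: s'_def)
    then show "s i = f i \<oplus>\<^bsub>S\<^esub> (\<Oplus>\<^bsub>S\<^esub>b\<in>B. h (H b i) \<otimes>\<^bsub>S\<^esub> w b)" using si[OF i] by simp
  qed
qed

end

context cring
begin

lemma finsum_mult_delta:
  assumes "finite A" "k \<in> A" "\<And>i. i \<in> A \<Longrightarrow> a i \<in> carrier R" "x \<in> carrier R"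
  shows "(\<Oplus>i\<in>A. a i \<otimes> (if i = k then x else \<zero>)) = a k \<otimes> x"
proof -
  have "(\<Oplus>i\<in>A. a i \<otimes> (if i = k then x else \<zero>)) = (\<Oplus>i\<in>A. if i = k then a k \<otimes> x else \<zero>)"
    using assms by (intro finsum_cong') auto
  also have "\<dots> = a k \<otimes> x" using assms by (intro finsum_delta) auto
  finally show ?thesis .
qed

end

context ring_hom_cring
begin

lemma hom_span_extend:
  assumes A: "finite A" "j \<notin> A" and a: "a \<in> insert j A \<rightarrow> carrier R"
    and "hom_span A (R.relations A a) f"
  shows "hom_span (insert j A) (R.relations (insert j A) a) (f(j := \<zero>\<^bsub>S\<^esub>))"
  using assms(4)
proof (induction rule: hom_span.induct)
  case (zero s)
  then show ?case by (intro hom_span.zero) auto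
next
  case (add s c t s')
  have cc: "c \<in> A \<rightarrow> carrier R" and c0: "(\<Oplus>i\<in>A. a i \<otimes> c i) = \<zero>"
    using add.hyps(2) by (simp_all add: R.relations_def)
  have ai: "a i \<in> carrier R" if "i \<in> A" for i using a that by auto
  have ci: "c i \<in> carrier R" if "i \<in> A" for i using cc that by auto
  have cc': "c(j := \<zero>) \<in> insert j A \<rightarrow> carrier R" using cc by auto
  have "(\<Oplus>i\<in>insert j A. a i \<otimes> (c(j := \<zero>)) i)
    = a j \<otimes> (c(j := \<zero>)) j \<oplus> (\<Oplus>i\<in>A. a i \<otimes> (c(j := \<zero>)) i)"
    using A ai ci a cc' by (intro R.finsum_insert) auto
  also have "(\<Oplus>i\<in>A. a i \<otimes> (c(j := \<zero>)) i) = (\<Oplus>i\<in>A. a i \<otimes> c i)"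
    using A ai ci by (intro R.finsum_cong') auto
  finally have "c(j := \<zero>) \<in> R.relations (insert j A) a"
    using cc' c0 a by (simp add: R.relations_def)
  then show ?case
    by (rule hom_span.add[OF add.IH _ add.hyps(3)]) (use add.hyps(3,4) A in auto)
qed

text \<open>With an element \<open>v\<close> killing the discrepancy between \<open>((h a\<^sub>i) : h a\<^sub>j)\<close> and
  \<open>((a\<^sub>i) : a\<^sub>j)\<close>, relations can be treated one generator at a time.\<close>

lemma relations_lift_up_to_insert:
  assumes A: "finite A" "j \<notin> A" and a: "a \<in> insert j A \<rightarrow> carrier R"
    and K: "finite K" and c: "c \<in> K \<rightarrow> carrier R"
    and H: "\<And>k i. k \<in> K \<Longrightarrow> i \<in> A \<Longrightarrow> H k i \<in> carrier R"
    and eq: "\<And>k. k \<in> K \<Longrightarrow> (\<Oplus>i\<in>A. a i \<otimes> H k i) = \<ominus> (a j \<otimes> c k)"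
    and u: "u \<in> carrier R" and v: "v \<in> carrier R"
    and lift: "relations_lift_up_to u A a"
    and colon: "\<And>s t. s \<in> carrier S \<Longrightarrow> t \<in> A \<rightarrow> carrier S \<Longrightarrow>
      h (a j) \<otimes>\<^bsub>S\<^esub> s = (\<Oplus>\<^bsub>S\<^esub>i\<in>A. h (a i) \<otimes>\<^bsub>S\<^esub> t i) \<Longrightarrow>
      \<exists>t \<in> K \<rightarrow> carrier S. h v \<otimes>\<^bsub>S\<^esub> s = (\<Oplus>\<^bsub>S\<^esub>k\<in>K. h (c k) \<otimes>\<^bsub>S\<^esub> t k)"
  shows "relations_lift_up_to (u \<otimes> v) (insert j A) a"
  unfolding relations_lift_up_to_def
proof (intro ballI impI)
  fix s assume s: "s \<in> insert j A \<rightarrow> carrier S"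
    and s0: "(\<Oplus>\<^bsub>S\<^esub>i\<in>insert j A. h (a i) \<otimes>\<^bsub>S\<^esub> s i) = \<zero>\<^bsub>S\<^esub>"
  have ai: "a i \<in> carrier R" if "i \<in> A" for i using a that by auto
  have aj: "a j \<in> carrier R" using a by auto
  have si: "s i \<in> carrier S" if "i \<in> A" for i using s that by auto
  have sj: "s j \<in> carrier S" using s by auto
  have ck: "c k \<in> carrier R" if "k \<in> K" for k using c that by auto
  define \<sigma> where "\<sigma> = (\<Oplus>\<^bsub>S\<^esub>i\<in>A. h (a i) \<otimes>\<^bsub>S\<^esub> s i)"
  have \<sigma>: "\<sigma> \<in> carrier S" unfolding \<sigma>_def using ai si by (intro S.finsum_closed) auto
  have sum: "h (a j) \<otimes>\<^bsub>S\<^esub> s j \<oplus>\<^bsub>S\<^esub> \<sigma> = \<zero>\<^bsub>S\<^esub>"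
    using s0 S.finsum_insert[OF A, of "\<lambda>i. h (a i) \<otimes>\<^bsub>S\<^esub> s i"] ai aj si sj
    by (simp add: \<sigma>_def)
  then have sum': "h (a j) \<otimes>\<^bsub>S\<^esub> s j = \<ominus>\<^bsub>S\<^esub> \<sigma>"
    using S.sum_zero_eq_neg[OF _ \<sigma>] aj sj by simp
  have m1: "\<ominus>\<^bsub>S\<^esub> x = (\<ominus>\<^bsub>S\<^esub> \<one>\<^bsub>S\<^esub>) \<otimes>\<^bsub>S\<^esub> x" if "x \<in> carrier S" for x
    using that by (simp add: S.l_minus)
  have "\<ominus>\<^bsub>S\<^esub> \<sigma> = (\<Oplus>\<^bsub>S\<^esub>i\<in>A. (\<ominus>\<^bsub>S\<^esub> \<one>\<^bsub>S\<^esub>) \<otimes>\<^bsub>S\<^esub> (h (a i) \<otimes>\<^bsub>S\<^esub> s i))"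
    unfolding m1[OF \<sigma>] unfolding \<sigma>_def using ai si A by (intro S.finsum_rdistr) auto
  also have "\<dots> = (\<Oplus>\<^bsub>S\<^esub>i\<in>A. h (a i) \<otimes>\<^bsub>S\<^esub> (\<ominus>\<^bsub>S\<^esub> (s i)))"
    using ai si by (intro S.finsum_cong') (auto simp: S.l_minus S.r_minus)
  finally obtain t where t: "t \<in> K \<rightarrow> carrier S"
      and vt: "h v \<otimes>\<^bsub>S\<^esub> s j = (\<Oplus>\<^bsub>S\<^esub>k\<in>K. h (c k) \<otimes>\<^bsub>S\<^esub> t k)"
    using colon[OF sj, of "\<lambda>i. \<ominus>\<^bsub>S\<^esub> (s i)"] si sum' by auto
  have tk: "t k \<in> carrier S" if "k \<in> K" for k using t that by auto
  define \<tau> where "\<tau> i = (\<Oplus>\<^bsub>S\<^esub>k\<in>K. h (H k i) \<otimes>\<^bsub>S\<^esub> t k)" for i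
  have \<tau>: "\<tau> i \<in> carrier S" if "i \<in> A" for i
    unfolding \<tau>_def using H that tk by (intro S.finsum_closed) auto
  \<comment> \<open>Multiplied by \<open>v\<close>, the entry at \<open>j\<close> is a combination
    of the \<open>c k\<close>. Subtracting the relations formed by \<open>H k\<close> and
    \<open>c k\<close> with coefficients \<open>t k\<close> clears that entry; what remains on
    \<open>A\<close> is \<open>s'\<close>.\<close>
  define s' where "s' i = h v \<otimes>\<^bsub>S\<^esub> s i \<ominus>\<^bsub>S\<^esub> \<tau> i" for i
  have s': "s' i \<in> carrier S" if "i \<in> A" for i using \<tau> si v that by (simp add: s'_def)
  have "(\<Oplus>\<^bsub>S\<^esub>i\<in>A. h (a i) \<otimes>\<^bsub>S\<^esub> \<tau> i) = (\<Oplus>\<^bsub>S\<^esub>k\<in>K. (\<Oplus>\<^bsub>S\<^esub>i\<in>A. h (a i) \<otimes>\<^bsub>S\<^esub> h (H k i)) \<otimes>\<^bsub>S\<^esub> t k)"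
    unfolding \<tau>_def using A(1) K ai tk H by (intro S.finsum_lcomb_swap) auto
  also have "\<dots> = (\<Oplus>\<^bsub>S\<^esub>k\<in>K. (\<ominus>\<^bsub>S\<^esub> h (a j)) \<otimes>\<^bsub>S\<^esub> (h (c k) \<otimes>\<^bsub>S\<^esub> t k))"
  proof (rule S.finsum_cong')
    fix k assume k: "k \<in> K"
    have "(\<Oplus>\<^bsub>S\<^esub>i\<in>A. h (a i) \<otimes>\<^bsub>S\<^esub> h (H k i)) = h (\<Oplus>i\<in>A. a i \<otimes> H k i)"
      using ai H[OF k] by (subst hom_finsum) (auto simp: comp_def intro!: S.finsum_cong')
    also have "\<dots> = (\<ominus>\<^bsub>S\<^esub> h (a j)) \<otimes>\<^bsub>S\<^esub> h (c k)"
      using eq[OF k] aj ck[OF k] by (simp add: S.l_minus)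
    finally show "(\<Oplus>\<^bsub>S\<^esub>i\<in>A. h (a i) \<otimes>\<^bsub>S\<^esub> h (H k i)) \<otimes>\<^bsub>S\<^esub> t k
      = (\<ominus>\<^bsub>S\<^esub> h (a j)) \<otimes>\<^bsub>S\<^esub> (h (c k) \<otimes>\<^bsub>S\<^esub> t k)"
      using aj ck[OF k] tk[OF k] by (simp add: S.m_assoc)
  qed (use aj ck tk in auto)
  also have "\<dots> = (\<ominus>\<^bsub>S\<^esub> h (a j)) \<otimes>\<^bsub>S\<^esub> (h v \<otimes>\<^bsub>S\<^esub> s j)"
    unfolding vt using aj ck tk K by (intro S.finsum_rdistr[symmetric]) auto
  finally have \<tau>sum: "(\<Oplus>\<^bsub>S\<^esub>i\<in>A. h (a i) \<otimes>\<^bsub>S\<^esub> \<tau> i) = (\<ominus>\<^bsub>S\<^esub> h (a j)) \<otimes>\<^bsub>S\<^esub> (h v \<otimes>\<^bsub>S\<^esub> s j)" .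
  have "h v \<otimes>\<^bsub>S\<^esub> \<sigma> = (\<Oplus>\<^bsub>S\<^esub>i\<in>A. h v \<otimes>\<^bsub>S\<^esub> (h (a i) \<otimes>\<^bsub>S\<^esub> s i))"
    unfolding \<sigma>_def using ai si A v by (intro S.finsum_rdistr) auto
  also have "\<dots> = (\<Oplus>\<^bsub>S\<^esub>i\<in>A. h (a i) \<otimes>\<^bsub>S\<^esub> s' i \<oplus>\<^bsub>S\<^esub> h (a i) \<otimes>\<^bsub>S\<^esub> \<tau> i)"
  proof (rule S.finsum_cong')
    fix i assume i: "i \<in> A"
    have "h v \<otimes>\<^bsub>S\<^esub> s i = s' i \<oplus>\<^bsub>S\<^esub> \<tau> i"
      unfolding s'_def using si[OF i] v \<tau>[OF i] by (intro S.minus_add_cancel_right) auto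
    then have "h (a i) \<otimes>\<^bsub>S\<^esub> (h v \<otimes>\<^bsub>S\<^esub> s i) = h (a i) \<otimes>\<^bsub>S\<^esub> s' i \<oplus>\<^bsub>S\<^esub> h (a i) \<otimes>\<^bsub>S\<^esub> \<tau> i"
      using ai[OF i] s'[OF i] \<tau>[OF i] by (simp add: S.r_distr)
    then show "h v \<otimes>\<^bsub>S\<^esub> (h (a i) \<otimes>\<^bsub>S\<^esub> s i) = h (a i) \<otimes>\<^bsub>S\<^esub> s' i \<oplus>\<^bsub>S\<^esub> h (a i) \<otimes>\<^bsub>S\<^esub> \<tau> i"
      using S.m_lcomm[of "h v" "h (a i)" "s i"] ai[OF i] si[OF i] v by simp
  qed (use ai s' \<tau> in auto)
  also have "\<dots> = (\<Oplus>\<^bsub>S\<^esub>i\<in>A. h (a i) \<otimes>\<^bsub>S\<^esub> s' i) \<oplus>\<^bsub>S\<^esub> (\<Oplus>\<^bsub>S\<^esub>i\<in>A. h (a i) \<otimes>\<^bsub>S\<^esub> \<tau> i)"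
    using ai s' \<tau> by (intro S.finsum_addf) auto
  finally have e1: "h v \<otimes>\<^bsub>S\<^esub> \<sigma>
    = (\<Oplus>\<^bsub>S\<^esub>i\<in>A. h (a i) \<otimes>\<^bsub>S\<^esub> s' i) \<oplus>\<^bsub>S\<^esub> (\<ominus>\<^bsub>S\<^esub> h (a j)) \<otimes>\<^bsub>S\<^esub> (h v \<otimes>\<^bsub>S\<^esub> s j)"
    unfolding \<tau>sum .
  have "y = \<zero>\<^bsub>S\<^esub>"
    if "w \<otimes>\<^bsub>S\<^esub> (\<ominus>\<^bsub>S\<^esub> (x \<otimes>\<^bsub>S\<^esub> z)) = y \<oplus>\<^bsub>S\<^esub> (\<ominus>\<^bsub>S\<^esub> x) \<otimes>\<^bsub>S\<^esub> (w \<otimes>\<^bsub>S\<^esub> z)"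
      "w \<in> carrier S" "x \<in> carrier S" "y \<in> carrier S" "z \<in> carrier S" for w x y z
  proof -
    have "y = (y \<oplus>\<^bsub>S\<^esub> (\<ominus>\<^bsub>S\<^esub> x) \<otimes>\<^bsub>S\<^esub> (w \<otimes>\<^bsub>S\<^esub> z)) \<oplus>\<^bsub>S\<^esub> w \<otimes>\<^bsub>S\<^esub> (x \<otimes>\<^bsub>S\<^esub> z)"
      using that(2-5) by algebra
    also have "\<dots> = \<zero>\<^bsub>S\<^esub>" unfolding that(1)[symmetric] using that(2-5) by algebra
    finally show ?thesis .
  qed
  note this[of "h v" "h (a j)" "s j" "\<Oplus>\<^bsub>S\<^esub>i\<in>A. h (a i) \<otimes>\<^bsub>S\<^esub> s' i"]
  moreover have "\<sigma> = \<ominus>\<^bsub>S\<^esub> (h (a j) \<otimes>\<^bsub>S\<^esub> s j)" using sum' \<sigma> by simp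
  ultimately have "(\<Oplus>\<^bsub>S\<^esub>i\<in>A. h (a i) \<otimes>\<^bsub>S\<^esub> s' i) = \<zero>\<^bsub>S\<^esub>"
    using e1 v aj sj s' ai S.finsum_closed[of "\<lambda>i. h (a i) \<otimes>\<^bsub>S\<^esub> s' i" A] by (simp add: Pi_def)
  then have "hom_span A (R.relations A a) (\<lambda>i. h u \<otimes>\<^bsub>S\<^esub> s' i)"
    using lift s' unfolding relations_lift_up_to_def by blast
  from hom_span_extend[OF A a this]
  have f: "hom_span (insert j A) (R.relations (insert j A) a) ((\<lambda>i. h u \<otimes>\<^bsub>S\<^esub> s' i)(j := \<zero>\<^bsub>S\<^esub>))" .
  define C where "C k = (H k)(j := c k)" for k
  have C: "C k \<in> R.relations (insert j A) a" if k: "k \<in> K" for k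
  proof -
    have Cc: "C k \<in> insert j A \<rightarrow> carrier R" using H[OF k] ck[OF k] by (auto simp: C_def)
    have "(\<Oplus>i\<in>insert j A. a i \<otimes> C k i) = a j \<otimes> C k j \<oplus> (\<Oplus>i\<in>A. a i \<otimes> C k i)"
      using A a Cc by (intro R.finsum_insert) auto
    also have "(\<Oplus>i\<in>A. a i \<otimes> C k i) = (\<Oplus>i\<in>A. a i \<otimes> H k i)"
      using A a H[OF k] by (intro R.finsum_cong') (auto simp: C_def)
    finally show ?thesis using Cc eq[OF k] aj ck[OF k] by (simp add: R.relations_def C_def R.r_neg)
  qed
  have g: "hom_span (insert j A) (R.relations (insert j A) a)
      (\<lambda>i. \<Oplus>\<^bsub>S\<^esub>k\<in>K. h (C k i) \<otimes>\<^bsub>S\<^esub> (h u \<otimes>\<^bsub>S\<^esub> t k))"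
    by (intro hom_span_sum[OF R.relations_funcset] hom_span_single[OF R.relations_funcset C])
      (use u tk in auto)
  have pull: "(\<Oplus>\<^bsub>S\<^esub>k\<in>K. h (m k) \<otimes>\<^bsub>S\<^esub> (h u \<otimes>\<^bsub>S\<^esub> t k)) = h u \<otimes>\<^bsub>S\<^esub> (\<Oplus>\<^bsub>S\<^esub>k\<in>K. h (m k) \<otimes>\<^bsub>S\<^esub> t k)"
    if "\<And>k. k \<in> K \<Longrightarrow> m k \<in> carrier R" for m
  proof -
    have "h u \<otimes>\<^bsub>S\<^esub> (\<Oplus>\<^bsub>S\<^esub>k\<in>K. h (m k) \<otimes>\<^bsub>S\<^esub> t k) = (\<Oplus>\<^bsub>S\<^esub>k\<in>K. h u \<otimes>\<^bsub>S\<^esub> (h (m k) \<otimes>\<^bsub>S\<^esub> t k))"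
      using that u tk K by (intro S.finsum_rdistr) auto
    also have "\<dots> = (\<Oplus>\<^bsub>S\<^esub>k\<in>K. h (m k) \<otimes>\<^bsub>S\<^esub> (h u \<otimes>\<^bsub>S\<^esub> t k))"
      using that u tk by (intro S.finsum_cong') (auto simp: S.m_lcomm)
    finally show ?thesis by simp
  qed
  show "hom_span (insert j A) (R.relations (insert j A) a) (\<lambda>i. h (u \<otimes> v) \<otimes>\<^bsub>S\<^esub> s i)"
  proof (rule hom_span_cong[OF hom_span_add[OF R.relations_funcset f g]])
    fix i assume "i \<in> insert j A"
    then consider "i = j" | "i \<in> A" "i \<noteq> j" using A by auto
    then show "h (u \<otimes> v) \<otimes>\<^bsub>S\<^esub> s i = ((\<lambda>i. h u \<otimes>\<^bsub>S\<^esub> s' i)(j := \<zero>\<^bsub>S\<^esub>)) i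
        \<oplus>\<^bsub>S\<^esub> (\<Oplus>\<^bsub>S\<^esub>k\<in>K. h (C k i) \<otimes>\<^bsub>S\<^esub> (h u \<otimes>\<^bsub>S\<^esub> t k))"
    proof cases
      case 1
      have "(\<Oplus>\<^bsub>S\<^esub>k\<in>K. h (C k i) \<otimes>\<^bsub>S\<^esub> (h u \<otimes>\<^bsub>S\<^esub> t k)) = h u \<otimes>\<^bsub>S\<^esub> (h v \<otimes>\<^bsub>S\<^esub> s j)"
        unfolding vt using pull[OF ck] 1 by (simp add: C_def)
      then show ?thesis using 1 u v sj by (simp add: S.m_assoc)
    next
      case 2
      have "(\<Oplus>\<^bsub>S\<^esub>k\<in>K. h (C k i) \<otimes>\<^bsub>S\<^esub> (h u \<otimes>\<^bsub>S\<^esub> t k)) = h u \<otimes>\<^bsub>S\<^esub> \<tau> i"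
        unfolding \<tau>_def using pull[of "\<lambda>k. H k i"] H 2 by (simp add: C_def)
      moreover have "h v \<otimes>\<^bsub>S\<^esub> s i = s' i \<oplus>\<^bsub>S\<^esub> \<tau> i"
        unfolding s'_def using si 2 v \<tau> by (intro S.minus_add_cancel_right) auto
      ultimately show ?thesis using 2 u v si s' \<tau> by (simp add: S.m_assoc S.r_distr)
    qed
  qed
qed

text \<open>If \<open>\<one>\<close> is the sum of the \<open>a i g i\<close>, then
  \<open>c j = e_j - a j g\<close> is a relation, where \<open>e_j\<close> is the unit vector. A
  relation \<open>s\<close> over \<open>S\<close> is the combination of the \<open>c j\<close> with
  coefficients \<open>s j\<close>, since the parts that involve \<open>g\<close> add up to
  zero.\<close>

lemma relations_lift_unit:
  assumes A: "finite A" and a: "a \<in> A \<rightarrow> carrier R" and one: "\<one> \<in> Idl (a ` A)"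
  shows "relations_lift A a"
proof (rule relations_liftI)
  fix s assume s: "s \<in> A \<rightarrow> carrier S" and s0: "(\<Oplus>\<^bsub>S\<^esub>i\<in>A. h (a i) \<otimes>\<^bsub>S\<^esub> s i) = \<zero>\<^bsub>S\<^esub>"
  obtain g where "g \<in> A \<rightarrow> carrier R" and g1: "\<one> = (\<Oplus>i\<in>A. a i \<otimes> g i)"
    using one R.Idl_image_iff[OF A a] by blast
  then have g: "g i \<in> carrier R" if "i \<in> A" for i using that by auto
  have ai: "a i \<in> carrier R" if "i \<in> A" for i using a that by auto
  have si: "s i \<in> carrier S" if "i \<in> A" for i using s that by auto
  define c where "c j i = (if i = j then \<one> else \<zero>) \<oplus> (\<ominus> (a j)) \<otimes> g i" for j i
  have c: "c j \<in> R.relations A a" if j: "j \<in> A" for j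
  proof -
    have "(\<Oplus>i\<in>A. a i \<otimes> c j i) = (\<Oplus>i\<in>A. a i \<otimes> (if i = j then \<one> else \<zero>) \<oplus> (\<ominus> (a j)) \<otimes> (a i \<otimes> g i))"
      using ai ai[OF j] g by (intro R.finsum_cong') (auto simp: c_def R.r_distr R.m_lcomm R.l_minus R.r_minus)
    also have "\<dots> = (\<Oplus>i\<in>A. a i \<otimes> (if i = j then \<one> else \<zero>)) \<oplus> (\<Oplus>i\<in>A. (\<ominus> (a j)) \<otimes> (a i \<otimes> g i))"
      using ai ai[OF j] g by (intro R.finsum_addf) auto
    also have "(\<Oplus>i\<in>A. (\<ominus> (a j)) \<otimes> (a i \<otimes> g i)) = (\<ominus> (a j)) \<otimes> \<one>"
      unfolding g1 using ai ai[OF j] g A by (intro R.finsum_rdistr[symmetric]) auto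
    also have "(\<Oplus>i\<in>A. a i \<otimes> (if i = j then \<one> else \<zero>)) = a j \<otimes> \<one>"
      using A ai j by (intro R.finsum_mult_delta) auto
    finally show ?thesis using ai[OF j] ai g by (auto simp: R.relations_def R.r_neg c_def)
  qed
  have "hom_span A (R.relations A a) (\<lambda>i. \<Oplus>\<^bsub>S\<^esub>j\<in>A. h (c j i) \<otimes>\<^bsub>S\<^esub> s j)"
    by (intro hom_span_sum[OF R.relations_funcset] hom_span_single[OF R.relations_funcset c] si)
  then show "hom_span A (R.relations A a) s"
  proof (rule hom_span_cong)
    fix i assume i: "i \<in> A"
    have "(\<Oplus>\<^bsub>S\<^esub>j\<in>A. h (c j i) \<otimes>\<^bsub>S\<^esub> s j)
      = (\<Oplus>\<^bsub>S\<^esub>j\<in>A. s j \<otimes>\<^bsub>S\<^esub> (if j = i then \<one>\<^bsub>S\<^esub> else \<zero>\<^bsub>S\<^esub>) \<oplus>\<^bsub>S\<^esub> (\<ominus>\<^bsub>S\<^esub> (h (g i))) \<otimes>\<^bsub>S\<^esub> (h (a j) \<otimes>\<^bsub>S\<^esub> s j))"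
      using ai g[OF i] si
      by (intro S.finsum_cong')
        (auto simp: c_def S.l_distr S.l_minus S.r_minus S.m_assoc S.m_lcomm)
    also have "\<dots> = (\<Oplus>\<^bsub>S\<^esub>j\<in>A. s j \<otimes>\<^bsub>S\<^esub> (if j = i then \<one>\<^bsub>S\<^esub> else \<zero>\<^bsub>S\<^esub>))
        \<oplus>\<^bsub>S\<^esub> (\<Oplus>\<^bsub>S\<^esub>j\<in>A. (\<ominus>\<^bsub>S\<^esub> (h (g i))) \<otimes>\<^bsub>S\<^esub> (h (a j) \<otimes>\<^bsub>S\<^esub> s j))"
      using ai g[OF i] si by (intro S.finsum_addf) auto
    also have "(\<Oplus>\<^bsub>S\<^esub>j\<in>A. (\<ominus>\<^bsub>S\<^esub> (h (g i))) \<otimes>\<^bsub>S\<^esub> (h (a j) \<otimes>\<^bsub>S\<^esub> s j)) = (\<ominus>\<^bsub>S\<^esub> (h (g i))) \<otimes>\<^bsub>S\<^esub> \<zero>\<^bsub>S\<^esub>"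
      unfolding s0[symmetric] using ai g[OF i] si A by (intro S.finsum_rdistr[symmetric]) auto
    also have "(\<Oplus>\<^bsub>S\<^esub>j\<in>A. s j \<otimes>\<^bsub>S\<^esub> (if j = i then \<one>\<^bsub>S\<^esub> else \<zero>\<^bsub>S\<^esub>)) = s i \<otimes>\<^bsub>S\<^esub> \<one>\<^bsub>S\<^esub>"
      using A si i by (intro S.finsum_mult_delta) auto
    finally show "s i = (\<Oplus>\<^bsub>S\<^esub>j\<in>A. h (c j i) \<otimes>\<^bsub>S\<^esub> s j)" using si[OF i] g[OF i] by simp
  qed
qed

end

section \<open>The Frobenius endomorphism\<close>

context cring
begin

lemma add_pow_one_mult: "x \<in> carrier R \<Longrightarrow> [(n :: nat)] \<cdot>\<^bsub>R\<^esub> x = ([n] \<cdot>\<^bsub>R\<^esub> \<one>) \<otimes> x"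
  using add_pow_ldistr[of \<one> x n] by simp

lemma binomial:
  assumes a: "a \<in> carrier R" and b: "b \<in> carrier R"
  shows "(a \<oplus> b) [^] n = (\<Oplus>k\<in>{..n}. [(n choose k)] \<cdot>\<^bsub>R\<^esub> (a [^] k \<otimes> b [^] (n - k)))"
proof (induction n)
  case 0
  then show ?case using assms by simp
next
  case (Suc n)
  define f where "f m k = [(m choose k)] \<cdot>\<^bsub>R\<^esub> (a [^] k \<otimes> b [^] (m - k))" for m k :: nat
  have fc: "f m k \<in> carrier R" for m k using assms by (simp add: f_def)
  \<comment> \<open>The vanishing term past the end lets both halves of Pascal's rule be summed over
    the same range.\<close>
  have zero: "f m (Suc m) = \<zero>" for m by (simp add: f_def binomial_eq_0)
  have step: "f (Suc n) (Suc k) = f n k \<otimes> a \<oplus> f n (Suc k) \<otimes> b" if "k \<le> n" for k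
  proof (cases "k = n")
    case True
    then show ?thesis using zero[of n] fc[of n n] a b by (simp add: f_def)
  next
    case False
    then have "n - k = Suc (n - Suc k)" using that by auto
    then have bn: "b [^] (n - k) = b [^] (n - Suc k) \<otimes> b" by simp
    define y where "y = a [^] Suc k \<otimes> b [^] (n - k)"
    have y: "y \<in> carrier R" using a b by (simp add: y_def)
    have "(a [^] k \<otimes> b [^] (n - k)) \<otimes> a = y" "(a [^] Suc k \<otimes> b [^] (n - Suc k)) \<otimes> b = y"
      using a b by (simp_all add: y_def bn m_ac)
    then have "f n k \<otimes> a = [(n choose k)] \<cdot>\<^bsub>R\<^esub> y" "f n (Suc k) \<otimes> b = [(n choose Suc k)] \<cdot>\<^bsub>R\<^esub> y"
      using a b by (simp_all add: f_def add_pow_ldistr del: nat_pow_Suc)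
    then show ?thesis using y by (simp add: f_def y_def add.nat_pow_mult)
  qed
  have "(a \<oplus> b) [^] Suc n = (\<Oplus>k\<in>{..n}. f n k) \<otimes> (a \<oplus> b)"
    using Suc by (simp add: f_def)
  also have "\<dots> = (\<Oplus>k\<in>{..n}. f n k) \<otimes> a \<oplus> (\<Oplus>k\<in>{..n}. f n k) \<otimes> b"
    using fc a b by (intro r_distr) (auto intro!: finsum_closed)
  also have "(\<Oplus>k\<in>{..n}. f n k) \<otimes> a = (\<Oplus>k\<in>{..n}. f n k \<otimes> a)"
    using fc a by (intro finsum_ldistr) auto
  also have "(\<Oplus>k\<in>{..n}. f n k) = (\<Oplus>k\<in>{..Suc n}. f n k)"
    using fc zero[of n] by (subst finsum_Suc) (auto intro!: finsum_closed)
  also have "\<dots> = (\<Oplus>k\<in>{..n}. f n (Suc k)) \<oplus> f n 0"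
    using fc by (intro finsum_Suc2) auto
  also have "\<dots> \<otimes> b = (\<Oplus>k\<in>{..n}. f n (Suc k)) \<otimes> b \<oplus> f n 0 \<otimes> b"
    using fc b by (intro l_distr) (auto intro!: finsum_closed)
  also have "(\<Oplus>k\<in>{..n}. f n (Suc k)) \<otimes> b = (\<Oplus>k\<in>{..n}. f n (Suc k) \<otimes> b)"
    using fc b by (intro finsum_ldistr) auto
  also have "f n 0 \<otimes> b = f (Suc n) 0" using a b by (simp add: f_def)
  also have "(\<Oplus>k\<in>{..n}. f n k \<otimes> a) \<oplus> ((\<Oplus>k\<in>{..n}. f n (Suc k) \<otimes> b) \<oplus> f (Suc n) 0)
    = (\<Oplus>k\<in>{..n}. f n k \<otimes> a) \<oplus> (\<Oplus>k\<in>{..n}. f n (Suc k) \<otimes> b) \<oplus> f (Suc n) 0"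
    using fc a b by (intro a_assoc[symmetric]) (auto intro!: finsum_closed)
  also have "(\<Oplus>k\<in>{..n}. f n k \<otimes> a) \<oplus> (\<Oplus>k\<in>{..n}. f n (Suc k) \<otimes> b)
    = (\<Oplus>k\<in>{..n}. f n k \<otimes> a \<oplus> f n (Suc k) \<otimes> b)"
    using fc a b by (intro finsum_addf[symmetric]) auto
  also have "\<dots> = (\<Oplus>k\<in>{..n}. f (Suc n) (Suc k))"
    using step fc by (intro finsum_cong') auto
  also have "\<dots> \<oplus> f (Suc n) 0 = (\<Oplus>k\<in>{..Suc n}. f (Suc n) k)"
    using fc by (intro finsum_Suc2[symmetric]) auto
  finally show ?case by (simp add: f_def)
qed

end

locale char_p_cring = cring +
  fixes p :: nat
  assumes prime_p: "Factorial_Ring.prime p" and p_zero: "[p] \<cdot>\<^bsub>R\<^esub> \<one> = \<zero>"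
begin

lemma p_pos: "0 < p" using prime_p prime_gt_0_nat by blast

lemma frobenius_add:
  assumes a: "a \<in> carrier R" and b: "b \<in> carrier R"
  shows "(a \<oplus> b) [^] p = a [^] p \<oplus> b [^] p"
proof -
  define f where "f k = [(p choose k)] \<cdot>\<^bsub>R\<^esub> (a [^] k \<otimes> b [^] (p - k))" for k :: nat
  have fc: "f k \<in> carrier R" for k using assms by (simp add: f_def)
  \<comment> \<open>With \<open>p = q + 2\<close>, the inner binomial coefficients are those at
    \<open>Suc k\<close> for \<open>k \<le> q\<close>, and all of them are divisible by
    \<open>p\<close>.\<close>
  define q where "q = p - 2"
  have q: "p = Suc (Suc q)" using prime_ge_2_nat[OF prime_p] by (simp add: q_def)
  have "f (Suc k) = \<zero>" if "k \<le> q" for k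
  proof -
    have "p dvd (p choose Suc k)"
      using prime_p that q by (intro dvd_choose_prime) auto
    then obtain m where m: "p choose Suc k = m * p" by (metis dvdE mult.commute)
    define y where "y = a [^] Suc k \<otimes> b [^] (p - Suc k)"
    have y: "y \<in> carrier R" using assms by (simp add: y_def)
    have "f (Suc k) = [(m * p)] \<cdot>\<^bsub>R\<^esub> y" by (simp only: f_def m y_def)
    also have "\<dots> = [m] \<cdot>\<^bsub>R\<^esub> ([p] \<cdot>\<^bsub>R\<^esub> y)" using y by (simp add: add.nat_pow_pow mult.commute)
    also have "[p] \<cdot>\<^bsub>R\<^esub> y = \<zero>" using add_pow_one_mult[OF y, of p] p_zero y by simp
    finally show ?thesis by simp
  qed
  then have mid: "(\<Oplus>k\<in>{..q}. f (Suc k)) = \<zero>" by (intro add.finprod_one_eqI) auto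
  have "(a \<oplus> b) [^] p = (\<Oplus>k\<in>{..p}. f k)" using binomial[OF a b] by (simp add: f_def)
  also have "\<dots> = f p \<oplus> (\<Oplus>k\<in>{..Suc q}. f k)" unfolding q using fc by (intro finsum_Suc) auto
  also have "(\<Oplus>k\<in>{..Suc q}. f k) = (\<Oplus>k\<in>{..q}. f (Suc k)) \<oplus> f 0" using fc by (intro finsum_Suc2) auto
  finally show ?thesis using a b mid fc by (simp add: f_def)
qed

lemma frobenius_hom: "ring_hom_cring R R (\<lambda>a. a [^] p)"
  by unfold_locales (auto intro!: ring_hom_memI simp: nat_pow_distrib frobenius_add)

end

text \<open>The composite is a separate map \<open>k\<close> because the maps to which this is
  applied are known to be composites only on the carrier.\<close>

lemma hom_span_map:
  assumes f: "ring_hom_cring R S f" and g: "ring_hom_cring S T g" and k: "ring_hom_cring R T k"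
    and k_eq: "\<And>a. a \<in> carrier R \<Longrightarrow> k a = g (f a)"
    and V: "V \<subseteq> A \<rightarrow> carrier R" and s: "ring_hom_cring.hom_span S f A V s"
  shows "ring_hom_cring.hom_span T k A V (\<lambda>i. g (s i))"
proof -
  interpret f: ring_hom_cring R S f by fact
  interpret g: ring_hom_cring S T g by fact
  interpret k: ring_hom_cring R T k by fact
  show ?thesis
    using s
  proof (induction rule: f.hom_span.induct)
    case (zero s)
    then show ?case by (intro k.hom_span.zero) simp
  next
    case (add s c t s')
    show ?case
    proof (rule k.hom_span.add[OF add.IH add.hyps(2)])
      show "g t \<in> carrier T" using add.hyps(3) by simp
      fix i assume i: "i \<in> A"
      have "c i \<in> carrier R" using add.hyps(2) V i by auto
      then show "g (s' i) = g (s i) \<oplus>\<^bsub>T\<^esub> k (c i) \<otimes>\<^bsub>T\<^esub> g t"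
        using add.hyps(3,4) i f.hom_span_closed[OF add.hyps(1) V i] k_eq by simp
    qed
  qed
qed

text \<open>A relation over \<open>T\<close> is a \<open>T\<close>-combination of relations over
  \<open>S\<close>, each of which is an \<open>S\<close>-combination of relations over
  \<open>R\<close>.\<close>

lemma flat_compose:
  assumes f: "ring_hom_cring R S f" and g: "ring_hom_cring S T g" and k: "ring_hom_cring R T k"
    and k_eq: "\<And>a. a \<in> carrier R \<Longrightarrow> k a = g (f a)"
    and flat_f: "ring_hom_cring.flat R S f" and flat_g: "ring_hom_cring.flat S T g"
  shows "ring_hom_cring.flat R T k"
proof -
  interpret f: ring_hom_cring R S f by fact
  interpret g: ring_hom_cring S T g by fact
  interpret k: ring_hom_cring R T k by fact
  note rel = f.R.relations_funcset
  show ?thesis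
    unfolding k.flat_def
  proof (intro allI impI k.relations_liftI)
    fix A :: "nat set" and a s
    assume A: "finite A" and a: "a \<in> A \<rightarrow> carrier R" and s: "s \<in> A \<rightarrow> carrier T"
      and s0: "(\<Oplus>\<^bsub>T\<^esub>i\<in>A. k (a i) \<otimes>\<^bsub>T\<^esub> s i) = \<zero>\<^bsub>T\<^esub>"
    have ai: "a i \<in> carrier R" if "i \<in> A" for i using a that by auto
    have si: "s i \<in> carrier T" if "i \<in> A" for i using s that by auto
    have fa: "(\<lambda>i. f (a i)) \<in> A \<rightarrow> carrier S" using ai by auto
    have "(\<Oplus>\<^bsub>T\<^esub>i\<in>A. g (f (a i)) \<otimes>\<^bsub>T\<^esub> s i) = (\<Oplus>\<^bsub>T\<^esub>i\<in>A. k (a i) \<otimes>\<^bsub>T\<^esub> s i)"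
      using ai si k_eq by (intro g.S.finsum_cong') auto
    then have "(\<Oplus>\<^bsub>T\<^esub>i\<in>A. g (f (a i)) \<otimes>\<^bsub>T\<^esub> s i) = \<zero>\<^bsub>T\<^esub>" using s0 by simp
    moreover have "g.relations_lift A (\<lambda>i. f (a i))"
      using flat_g A fa unfolding g.flat_def by blast
    ultimately have "g.hom_span A (f.S.relations A (\<lambda>i. f (a i))) s"
      using g.relations_liftD s by blast
    then show "k.hom_span A (f.R.relations A a) s"
    proof (induction rule: g.hom_span.induct)
      case (zero s)
      then show ?case by (rule k.hom_span.zero)
    next
      case (add s c t s')
      have cc: "c \<in> A \<rightarrow> carrier S" and c0: "(\<Oplus>\<^bsub>S\<^esub>i\<in>A. f (a i) \<otimes>\<^bsub>S\<^esub> c i) = \<zero>\<^bsub>S\<^esub>"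
        using add.hyps(2) by (simp_all add: f.S.relations_def)
      have "f.relations_lift A a" using flat_f A a unfolding f.flat_def by blast
      then have "f.hom_span A (f.R.relations A a) c" using f.relations_liftD cc c0 by blast
      from hom_span_map[OF f g k k_eq rel this]
      have "k.hom_span A (f.R.relations A a) (\<lambda>i. g (c i))" by simp
      from k.hom_span_add[OF rel add.IH k.hom_span_smult[OF rel this add.hyps(3)]]
      show ?case
      proof (rule k.hom_span_cong)
        fix i assume i: "i \<in> A"
        have "g (c i) \<in> carrier T" using cc i by auto
        then show "s' i = s i \<oplus>\<^bsub>T\<^esub> t \<otimes>\<^bsub>T\<^esub> g (c i)"
          using add.hyps(3,4) i by (simp add: g.S.m_comm)
      qed
    qed
  qed
qed

context cring
begin

text \<open>In matrix form the hypothesis is \<open>a H = x e\<close>, so \<open>H\<close> maps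
  syzygies of \<open>e\<close> to syzygies of \<open>a\<close>. This is what
  \<open>hom_span_push\<close> asks for.\<close>

lemma relations_push:
  assumes A: "finite A" and B: "finite B" and a: "\<And>i. i \<in> A \<Longrightarrow> a i \<in> carrier R"
    and e: "\<And>b. b \<in> B \<Longrightarrow> e b \<in> carrier R" and x: "x \<in> carrier R"
    and H: "\<And>b i. b \<in> B \<Longrightarrow> i \<in> A \<Longrightarrow> H b i \<in> carrier R"
    and eq: "\<And>b. b \<in> B \<Longrightarrow> (\<Oplus>i\<in>A. a i \<otimes> H b i) = x \<otimes> e b"
    and c: "c \<in> relations B e"
  shows "(\<lambda>i. \<Oplus>b\<in>B. H b i \<otimes> c b) \<in> relations A a"
proof -
  have cb: "c b \<in> carrier R" if "b \<in> B" for b using c that by (auto simp: relations_def)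
  have "(\<Oplus>i\<in>A. a i \<otimes> (\<Oplus>b\<in>B. H b i \<otimes> c b)) = (\<Oplus>b\<in>B. (\<Oplus>i\<in>A. a i \<otimes> H b i) \<otimes> c b)"
    using A B a cb H by (intro finsum_lcomb_swap) auto
  also have "\<dots> = (\<Oplus>b\<in>B. x \<otimes> (e b \<otimes> c b))"
    using eq x e cb by (intro finsum_cong') (auto simp: m_assoc)
  also have "\<dots> = x \<otimes> (\<Oplus>b\<in>B. e b \<otimes> c b)" using x e cb B by (intro finsum_rdistr[symmetric]) auto
  also have "\<dots> = \<zero>" using c x by (simp add: relations_def)
  finally show ?thesis using H cb by (auto simp: relations_def intro!: finsum_closed)
qed

end

section \<open>Relations between p-th powers over a regular ring\<close>

context noetherian_cring
begin

text \<open>Finitely many generators need finitely many multipliers, and the product of these serves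
  all of \<open>D\<close>.\<close>

lemma uniform_saturation:
  assumes P: "primeideal P R" and D: "ideal D R" and I: "ideal I R" and sub: "D \<subseteq> saturation P I"
  obtains v where "v \<in> carrier R - P" "\<And>d. d \<in> D \<Longrightarrow> v \<otimes> d \<in> I"
proof -
  obtain T where T: "T \<subseteq> carrier R" "finite T" "D = Idl T" using finetely_gen[OF D] by blast
  have "\<exists>v\<in>carrier R - P. \<forall>t\<in>T. v \<otimes> t \<in> I" if "finite T" "T \<subseteq> saturation P I" for T
    using that
  proof (induction T)
    case empty
    then show ?case using primeidealD(2)[OF P] by (auto intro: bexI[of _ \<one>])
  next
    case (insert t T)
    obtain v where v: "v \<in> carrier R - P" "\<And>t. t \<in> T \<Longrightarrow> v \<otimes> t \<in> I" using insert by auto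
    obtain u where u: "u \<in> carrier R - P" "u \<otimes> t \<in> I" "t \<in> carrier R"
      using insert.prems by (auto elim: saturationE)
    have T: "x \<in> carrier R" if "x \<in> T" for x using insert.prems that by (auto simp: saturation_def)
    have "(v \<otimes> u) \<otimes> t \<in> I" using idealD(6)[OF I, of v "u \<otimes> t"] u v by (simp add: m_assoc)
    moreover have "(v \<otimes> u) \<otimes> x \<in> I" if "x \<in> T" for x
    proof -
      have "(v \<otimes> u) \<otimes> x = u \<otimes> (v \<otimes> x)" using u v T[OF that] by (simp add: m_ac)
      then show ?thesis using idealD(6)[OF I, of u "v \<otimes> x"] u v that by simp
    qed
    ultimately show ?case using primeidealD(5)[OF P v(1) u(1)] by blast
  qed
  note this[OF T(2)]
  moreover have "T \<subseteq> saturation P I" using sub T genideal_self[OF T(1)] by blast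
  ultimately have "\<exists>v\<in>carrier R - P. \<forall>t\<in>T. v \<otimes> t \<in> I" by simp
  then obtain v where v: "v \<in> carrier R - P" "\<And>t. t \<in> T \<Longrightarrow> v \<otimes> t \<in> I" by blast
  have "t \<in> colon I v" if "t \<in> T" for t
    using v(1) v(2)[OF that] subsetD[OF T(1) that] m_comm[of t v] by (simp add: colon_def)
  then have "Idl T \<subseteq> colon I v"
    using v by (intro genideal_minimal colon_ideal[OF I]) auto
  then have "v \<otimes> d \<in> I" if "d \<in> D" for d
    using that v T(3) by (auto simp: colon_def m_comm)
  then show thesis using that v by blast
qed

lemma finite_ideal_family:
  assumes "ideal I R"
  obtains n :: nat and e where "e \<in> {..<n} \<rightarrow> carrier R" "Idl (e ` {..<n}) = I"
proof -
  obtain T where T: "T \<subseteq> carrier R" "finite T" "I = Idl T" using finetely_gen[OF assms] by blast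
  obtain xs where xs: "set xs = T" using finite_list[OF T(2)] by blast
  have im: "(!) xs ` {..<length xs} = T" using xs by (auto simp: set_conv_nth)
  show thesis
    by (rule that[of "(!) xs" "length xs"]) (use im T in auto)
qed

end

locale regular_char_p = noetherian_cring R + char_p_cring R p for R (structure) and p +
  assumes regular: "primeideal P R \<Longrightarrow> regular_local_ring (localization R P)"

sublocale char_p_cring \<subseteq> F: ring_hom_cring R R "\<lambda>a. a [^] p"
  by (rule frobenius_hom)

context regular_char_p
begin

text \<open>The family lists local generators of \<open>P\<close> that form a regular sequence in
  every order, and then generators of \<open>P\<close> itself. So it generates \<open>P\<close>
  exactly, while its relations are under control up to a multiplier outside
  \<open>P\<close>.\<close>

lemma frobenius_prime_system:
  assumes P: "primeideal P R"
  obtains u n y where "u \<in> carrier R - P" "y \<in> {..<n} \<rightarrow> carrier R" "Idl (y ` {..<n}) = P"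
    "F.relations_lift_up_to u {..<n :: nat} y"
proof -
  obtain G m C where G: "finite G" "card G \<le> m" "G \<subseteq> P" and C: "prime_chain m C" "C m = P"
    and gen: "P \<subseteq> saturation P (Idl G)"
    using regular_prime_system[OF P regular[OF P]] by blast
  have Pc: "P \<subseteq> carrier R" by (rule primeidealD(3)[OF P])
  obtain gs where gs: "set gs = G" "distinct gs" using finite_distinct_list[OF G(1)] by blast
  obtain T where T: "T \<subseteq> carrier R" "finite T" "P = Idl T"
    using finetely_gen[OF primeidealD(1)[OF P]] by blast
  obtain bs where bs: "set bs = T" using finite_list[OF T(2)] by blast
  define xs where "xs = gs @ bs"
  define d where "d = length gs"
  define y where "y = (!) xs"
  have TP: "T \<subseteq> P" using genideal_self[OF T(1)] T(3) by simp
  have yP: "y i \<in> P" if "i < length xs" for i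
  proof -
    have "y i \<in> set xs" using that by (simp add: y_def)
    then show ?thesis using gs bs G TP by (auto simp: xs_def)
  qed
  have yc: "y i \<in> carrier R" if "i < length xs" for i using yP[OF that] Pc by auto
  have dl: "d \<le> length xs" by (simp add: d_def xs_def)
  have yd: "y i = gs ! i" if "i < d" for i using that by (simp add: y_def xs_def d_def nth_append)
  have yG: "y ` {..<d} = G" using yd gs(1) by (auto simp: set_conv_nth d_def image_iff)
  have inj: "inj_on y {..<d}" using gs(2) yd by (auto simp: inj_on_def d_def nth_eq_iff_index_eq)
  have "locally_permutable P {..<d} y"
    unfolding locally_permutable_def
  proof (intro conjI allI impI ballI)
    show "y ` {..<d} \<subseteq> carrier R" using yG G Pc by auto
    fix B j r assume B: "B \<subseteq> {..<d}" and j: "j \<in> {..<d} - B" and r: "r \<in> carrier R"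
      and mem: "y j \<otimes> r \<in> saturation P (Idl (y ` B))"
    have "y ` B \<subseteq> G" using B yG by auto
    moreover have "y j \<in> G - y ` B"
      using B j yG inj_on_image_mem_iff[OF inj, of j B] by auto
    ultimately show "r \<in> saturation P (Idl (y ` B))"
      using regular_system_permutable[OF G(1,2) _ C(1), of "y ` B" "y j" r] G(3) gen r mem
      unfolding C(2) by simp
  qed
  then have perm: "locally_permutable P {..<d} (\<lambda>i. y i [^] p)"
    by (rule locally_permutable_pow[OF P]) (simp_all add: p_pos)
  \<comment> \<open>The family grows by one member at a time, and \<open>u\<close> collects the
    multipliers.\<close>
  have "\<exists>u\<in>carrier R - P. F.relations_lift_up_to u {..<k} y" if "k \<le> length xs" for k
    using that
  proof (induction k)
    case 0
    have "F.relations_lift_up_to \<one> {..<0::nat} y"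
      unfolding F.relations_lift_up_to_def by (auto intro: F.hom_span.zero)
    then show ?case using primeidealD(2)[OF P] by (intro bexI[of _ \<one>]) auto
  next
    case (Suc k)
    then obtain u where u: "u \<in> carrier R - P" "F.relations_lift_up_to u {..<k} y" by auto
    have kc: "y i \<in> carrier R" if "i \<le> k" for i using yc that Suc.prems by auto
    have yk: "y \<in> insert k {..<k} \<rightarrow> carrier R" using kc by auto
    have ykP: "y k \<in> P" using yP Suc.prems by auto
    have ins: "{..<Suc k} = insert k {..<k}" by (rule lessThan_Suc)
    show ?case
    proof (cases "k < d")
      case True
      define I where "I = Idl ((\<lambda>i. y i [^] p) ` {..<k})"
      have fam: "(\<lambda>i. y i [^] p) \<in> {..<k} \<rightarrow> carrier R" using kc by auto
      have I: "ideal I R" unfolding I_def using fam by (intro genideal_ideal) auto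
      have pk: "y k [^] p \<in> carrier R" using kc by simp
      \<comment> \<open>The \<open>p\<close>-th powers again form a regular sequence locally, so the
        colon ideal is locally no larger than \<open>I\<close>.\<close>
      have "colon I (y k [^] p) \<subseteq> saturation P I"
      proof
        fix r assume "r \<in> colon I (y k [^] p)"
        then have r: "r \<in> carrier R" "y k [^] p \<otimes> r \<in> I" using pk by (auto simp: colon_def m_comm)
        then have "y k [^] p \<otimes> r \<in> saturation P I" using subset_saturation[OF P I] by auto
        then show "r \<in> saturation P I"
          unfolding I_def using locally_permutableD[OF perm _ _ _ r(1), of "{..<k}" k] True by auto
      qed
      then obtain v where v: "v \<in> carrier R - P"
        and vI: "\<And>r. r \<in> colon I (y k [^] p) \<Longrightarrow> v \<otimes> r \<in> I"
        using uniform_saturation[OF P colon_ideal[OF I pk] I] by blast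
      \<comment> \<open>The elements \<open>c\<close> of the colon ideal are the earlier members
        \<open>y l\<close>, and the relations that accompany them are the Koszul relations between
        \<open>y k\<close> and \<open>y l\<close>.\<close>
      have "F.relations_lift_up_to (u \<otimes> v) (insert k {..<k}) y"
      proof (rule F.relations_lift_up_to_insert[OF _ _ yk])
        show "(\<Oplus>i\<in>{..<k}. y i \<otimes> (if i = l then \<ominus> (y k) else \<zero>)) = \<ominus> (y k \<otimes> y l)"
          if "l \<in> {..<k}" for l
          using that kc by (subst finsum_mult_delta) (auto simp: r_minus m_comm)
        fix s t assume s: "s \<in> carrier R" and t: "t \<in> {..<k} \<rightarrow> carrier R"
          and eq: "y k [^] p \<otimes> s = (\<Oplus>i\<in>{..<k}. y i [^] p \<otimes> t i)"
        have "y k [^] p \<otimes> s \<in> I" unfolding I_def Idl_image_iff[OF finite_lessThan fam] using t eq by blast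
        then have "v \<otimes> s \<in> I" using vI s pk by (auto simp: colon_def m_comm)
        \<comment> \<open>Frobenius turns \<open>v\<close> into its \<open>p\<close>-th power; one
          of these factors moves \<open>s\<close> into \<open>I\<close>.\<close>
        moreover have "v [^] p \<otimes> s = v [^] (p - 1) \<otimes> (v \<otimes> s)"
        proof -
          have "v [^] p = v [^] Suc (p - 1)" using p_pos by simp
          then show ?thesis using v s by (simp add: m_assoc)
        qed
        ultimately have "v [^] p \<otimes> s \<in> I" using idealD(6)[OF I, of "v [^] (p - 1)" "v \<otimes> s"] v by simp
        then show "\<exists>t\<in>{..<k} \<rightarrow> carrier R. v [^] p \<otimes> s = (\<Oplus>i\<in>{..<k}. y i [^] p \<otimes> t i)"
          unfolding I_def Idl_image_iff[OF finite_lessThan fam] .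
      qed (use u v kc in auto)
      then show ?thesis using primeidealD(5)[OF P u(1) v] unfolding ins by blast
    next
      case False
      \<comment> \<open>Beyond the regular sequence, some \<open>v y k\<close> is a combination of
        earlier members. So \<open>v\<close> lies in the colon ideal, and since it is also allowed
        as multiplier, it alone suffices for \<open>c\<close>.\<close>
      obtain v where v: "v \<in> carrier R - P" "v \<otimes> y k \<in> Idl G"
        using gen ykP by (auto elim: saturationE)
      have fam: "y \<in> {..<k} \<rightarrow> carrier R" using kc by auto
      have "Idl G \<subseteq> Idl (y ` {..<k})"
        unfolding yG[symmetric] using False fam by (intro Idl_mono) auto
      then obtain g where "g \<in> {..<k} \<rightarrow> carrier R" and vg: "v \<otimes> y k = (\<Oplus>i\<in>{..<k}. y i \<otimes> g i)"
        using Idl_image_iff[OF finite_lessThan fam] v(2) by blast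
      then have g: "g i \<in> carrier R" if "i < k" for i using that by auto
      have "F.relations_lift_up_to (u \<otimes> v) (insert k {..<k}) y"
      proof (rule F.relations_lift_up_to_insert[OF _ _ yk, of "{()}" "\<lambda>_. v" "\<lambda>_ i. \<ominus> (g i)"])
        fix l :: unit
        have "(\<Oplus>i\<in>{..<k}. y i \<otimes> \<ominus> (g i)) = (\<Oplus>i\<in>{..<k}. (\<ominus> \<one>) \<otimes> (y i \<otimes> g i))"
          using kc g by (intro finsum_cong') (auto simp: r_minus l_minus)
        also have "\<dots> = (\<ominus> \<one>) \<otimes> (v \<otimes> y k)"
          unfolding vg using kc g by (intro finsum_rdistr[symmetric]) auto
        also have "\<dots> = \<ominus> (y k \<otimes> v)" using v kc by (simp add: l_minus m_comm)
        finally show "(\<Oplus>i\<in>{..<k}. y i \<otimes> \<ominus> (g i)) = \<ominus> (y k \<otimes> v)" .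
      next
        fix s assume "s \<in> carrier R"
        then show "\<exists>t\<in>{()} \<rightarrow> carrier R. v [^] p \<otimes> s = (\<Oplus>k\<in>{()}. v [^] p \<otimes> t k)"
          using v by (intro bexI[of _ "\<lambda>_. s"]) auto
      qed (use u v kc g in auto)
      then show ?thesis using primeidealD(5)[OF P u(1) v(1)] unfolding ins by blast
    qed
  qed
  then obtain u where u: "u \<in> carrier R - P" "F.relations_lift_up_to u {..<length xs} y" by auto
  have "T \<subseteq> y ` {..<length xs}"
  proof
    fix t assume "t \<in> T"
    then have "t \<in> set xs" using bs by (simp add: xs_def)
    then show "t \<in> y ` {..<length xs}" unfolding y_def by (auto simp: in_set_conv_nth)
  qed
  then have "P \<subseteq> Idl (y ` {..<length xs})" unfolding T(3) using yc by (intro Idl_mono) auto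
  moreover have "Idl (y ` {..<length xs}) \<subseteq> P"
    using yP by (intro genideal_minimal primeidealD(1)[OF P]) auto
  ultimately have "Idl (y ` {..<length xs}) = P" by (rule subset_antisym[rotated])
  moreover have "y \<in> {..<length xs} \<rightarrow> carrier R" using yc by auto
  ultimately show thesis using that[OF u(1) _ _ u(2)] by simp
qed

text \<open>Kunz's theorem, in the direction from regularity to flatness of the Frobenius.\<close>

theorem frobenius_flat: "F.flat"
proof -
  \<comment> \<open>The family varies while its ideal is fixed, because the induction hypothesis is
    applied to families built for the larger ideals.\<close>
  have "\<forall>A a. finite (A :: nat set) \<longrightarrow> a \<in> A \<rightarrow> carrier R \<longrightarrow> Idl (a ` A) = I \<longrightarrow> F.relations_lift A a"
    if "ideal I R" for I
    using that
  proof (induction I rule: noetherian_induct)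
    case (step I)
    show ?case
    proof (intro allI impI)
      fix A :: "nat set" and a
      assume A: "finite A" and a: "a \<in> A \<rightarrow> carrier R" and I: "Idl (a ` A) = I"
      have aA: "a ` A \<subseteq> carrier R" using a by auto
      \<comment> \<open>The fresh index \<open>j\<close> holds the element to be adjoined or divided
        by; \<open>cong\<close> finally discards the value that \<open>a\<close> receives
        there.\<close>
      obtain j where j: "j \<notin> A" using ex_new_if_finite[OF infinite_UNIV_nat A] by blast
      have lift: "F.relations_lift (insert j A) (a(j := x))" if "x \<in> carrier R" "x \<notin> I" for x
      proof -
        have "(a(j := x)) ` insert j A = insert x (a ` A)" using j by auto
        then have eq: "Idl ((a(j := x)) ` insert j A) = I <+>\<^bsub>R\<^esub> PIdl x"
          using Idl_insert[OF aA that(1)] I by simp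
        have "I \<subset> I <+>\<^bsub>R\<^esub> PIdl x" using subset_adjoin[OF step.hyps that(1)] that(2) by auto
        moreover have "a(j := x) \<in> insert j A \<rightarrow> carrier R" using a by (auto simp: that(1))
        ultimately show ?thesis
          using step.IH[OF adjoin_ideal[OF step.hyps that(1)]] A eq by blast
      qed
      have upd: "a(j := x) \<in> A \<rightarrow> carrier R" "Idl (a(j := x) ` A) = I" for x
      proof -
        show "a(j := x) \<in> A \<rightarrow> carrier R" using a j by auto
        have "a(j := x) ` A = a ` A" using j by auto
        then show "Idl (a(j := x) ` A) = I" using I by simp
      qed
      have ac: "i \<in> A \<Longrightarrow> (a(j := x)) i \<in> carrier R" for x i
        using funcset_mem[OF upd(1)] .
      have family: "\<exists>H. \<forall>b\<in>B. (\<forall>i\<in>A. H b i \<in> carrier R) \<and> (\<Oplus>i\<in>A. (a(j := x)) i \<otimes> H b i) = f b"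
        if "\<And>b. b \<in> B \<Longrightarrow> f b \<in> I" for B :: "nat set" and f x
      proof -
        have "\<forall>b\<in>B. \<exists>g. g \<in> A \<rightarrow> carrier R \<and> f b = (\<Oplus>i\<in>A. (a(j := x)) i \<otimes> g i)"
          using that Idl_image_iff[OF A upd(1)[of x]] upd(2)[of x] by blast
        then obtain H where "\<forall>b\<in>B. H b \<in> A \<rightarrow> carrier R \<and> f b = (\<Oplus>i\<in>A. (a(j := x)) i \<otimes> H b i)"
          unfolding bchoice_iff by blast
        then show ?thesis by (intro exI[of _ H]) auto
      qed
      have cong: "F.relations_lift A a" if "F.relations_lift A (a(j := x))" for x
      proof (rule F.relations_liftI)
        have rel: "relations A (a(j := x)) = relations A a"
        proof -
          have "(\<Oplus>i\<in>A. (a(j := x)) i \<otimes> c i) = (\<Oplus>i\<in>A. a i \<otimes> c i)" if "c \<in> A \<rightarrow> carrier R" for c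
            using that a j by (intro finsum_cong') auto
          then show ?thesis unfolding relations_def by auto
        qed
        fix s assume s: "s \<in> A \<rightarrow> carrier R" "(\<Oplus>i\<in>A. a i [^] p \<otimes> s i) = \<zero>"
        have "(\<Oplus>i\<in>A. (a(j := x)) i [^] p \<otimes> s i) = (\<Oplus>i\<in>A. a i [^] p \<otimes> s i)"
          using s a j by (intro finsum_cong') auto
        then show "F.hom_span A (relations A a) s"
          using F.relations_liftD[OF that s(1)] s(2) rel by simp
      qed
      consider "I = carrier R" | "primeideal I R"
        | x y where "x \<in> carrier R" "y \<in> carrier R" "x \<otimes> y \<in> I" "x \<notin> I" "y \<notin> I"
        using primeidealI[OF step.hyps cring_axioms] by blast
      then show "F.relations_lift A a"
      proof cases
        case 1
        then show ?thesis using F.relations_lift_unit[OF A a] I by auto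
      next
        case 2
        obtain u n y where u: "u \<in> carrier R - I" and y: "y \<in> {..<n :: nat} \<rightarrow> carrier R"
          and yI: "Idl (y ` {..<n}) = I" and up: "F.relations_lift_up_to u {..<n} y"
          using frobenius_prime_system[OF 2] .
        have yc: "y b \<in> carrier R" if "b \<in> {..<n}" for b using y that by auto
        have "y b \<in> I" if "b \<in> {..<n}" for b
          using that genideal_self[of "y ` {..<n}"] y yI by blast
        from family[of "{..<n}" y "\<ominus> u", OF this]
        obtain H where "\<forall>b\<in>{..<n}. (\<forall>i\<in>A. H b i \<in> carrier R) \<and>
          (\<Oplus>i\<in>A. (a(j := \<ominus> u)) i \<otimes> H b i) = y b" ..
        then have H: "\<And>b i. b \<in> {..<n} \<Longrightarrow> i \<in> A \<Longrightarrow> H b i \<in> carrier R"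
          and Hy: "\<And>b. b \<in> {..<n} \<Longrightarrow> (\<Oplus>i\<in>A. (a(j := \<ominus> u)) i \<otimes> H b i) = y b" by blast+
        have uc: "u \<in> carrier R" "\<ominus> u \<in> carrier R" using u by auto
        have "\<ominus> (\<ominus> u) = u" using uc by simp
        then have nu: "\<ominus> u \<notin> I" using u idealD(5)[OF step.hyps, of "\<ominus> u"] by auto
        \<comment> \<open>\<open>I\<close> is prime and misses \<open>u\<close>, so the colon ideal
          is \<open>I\<close> again, with generators \<open>y\<close>. Relations between these lift
          only up to \<open>u\<close>; but the vectors that express \<open>u y b\<close> through
          \<open>a\<close> carry a factor \<open>u\<close>, and Frobenius turns it into the
          \<open>u^p\<close> that \<open>up\<close> requires.\<close>
        have "F.relations_lift A (a(j := \<ominus> u))"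
        proof (rule F.relations_lift_remove[OF A j _ finite_lessThan y])
          show "a(j := \<ominus> u) \<in> insert j A \<rightarrow> carrier R" using ac uc by auto
          show "u \<otimes> H b i \<in> carrier R" if "b \<in> {..<n}" "i \<in> A" for b i using H[OF that] uc by simp
          show "F.relations_lift (insert j A) (a(j := \<ominus> u))" by (rule lift[OF uc(2) nu])
          show "(\<Oplus>i\<in>A. (a(j := \<ominus> u)) i \<otimes> (u \<otimes> H b i)) = \<ominus> ((a(j := \<ominus> u)) j \<otimes> y b)"
            if b: "b \<in> {..<n}" for b
          proof -
            have "(\<Oplus>i\<in>A. (a(j := \<ominus> u)) i \<otimes> (u \<otimes> H b i)) = (\<Oplus>i\<in>A. u \<otimes> ((a(j := \<ominus> u)) i \<otimes> H b i))"
              using ac H[OF b] uc by (intro finsum_cong') (auto simp: m_lcomm simp del: fun_upd_apply)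
            also have "\<dots> = u \<otimes> y b"
              unfolding Hy[OF b, symmetric] using ac H[OF b] uc A
              by (intro finsum_rdistr[symmetric]) (auto simp del: fun_upd_apply)
            finally show ?thesis using uc yc[OF b] by (simp add: l_minus)
          qed
          show "d \<in> Idl (y ` {..<n})"
            if "d \<in> carrier R" "d \<otimes> (a(j := \<ominus> u)) j \<in> Idl (a(j := \<ominus> u) ` A)" for d
            using that primeidealD(4)[OF 2 that(1) uc(2)] nu unfolding upd(2) yI by simp
          fix w assume w: "w \<in> {..<n} \<rightarrow> carrier R" "(\<Oplus>b\<in>{..<n}. y b [^] p \<otimes> w b) = \<zero>"
          then have "F.hom_span {..<n} (relations {..<n} y) (\<lambda>b. u [^] p \<otimes> w b)"
            using up unfolding F.relations_lift_up_to_def by blast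
          then have "F.hom_span A (relations A (a(j := \<ominus> u)))
              (\<lambda>i. \<Oplus>b\<in>{..<n}. H b i [^] p \<otimes> (u [^] p \<otimes> w b))"
          proof (rule F.hom_span_push[OF finite_lessThan relations_funcset, rotated -1])
            show "(\<lambda>i. \<Oplus>b\<in>{..<n}. H b i \<otimes> c b) \<in> relations A (a(j := \<ominus> u))"
              if "c \<in> relations {..<n} y" for c
              by (rule relations_push[OF A finite_lessThan ac yc one_closed H _ that])
                (use Hy yc in auto)
          qed (rule H)
          then show "F.hom_span A (relations A (a(j := \<ominus> u)))
              (\<lambda>i. \<Oplus>b\<in>{..<n}. (u \<otimes> H b i) [^] p \<otimes> w b)"
          proof (rule F.hom_span_cong)
            show "(\<Oplus>b\<in>{..<n}. (u \<otimes> H b i) [^] p \<otimes> w b)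
              = (\<Oplus>b\<in>{..<n}. H b i [^] p \<otimes> (u [^] p \<otimes> w b))" if i: "i \<in> A" for i
              using H[OF _ i] uc funcset_mem[OF w(1)]
              by (intro finsum_cong') (auto simp: nat_pow_distrib m_ac)
          qed
        qed
        then show ?thesis by (rule cong)
      next
        case 3
        \<comment> \<open>Both \<open>(I : x)\<close> and \<open>I + (x)\<close> are strictly larger
          than \<open>I\<close>, so the induction hypothesis covers both ends of the exact
          sequence.\<close>
        have D: "ideal (colon I x) R" by (rule colon_ideal[OF step.hyps 3(1)])
        have "y \<otimes> x = x \<otimes> y" by (rule m_comm[OF 3(2,1)])
        then have "y \<in> colon I x" using 3(2,3) by (simp add: colon_def)
        then have "I \<subset> colon I x" using subset_colon[OF step.hyps 3(1)] 3(5) by blast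
        obtain n and e where e: "e \<in> {..<n :: nat} \<rightarrow> carrier R" and eI: "Idl (e ` {..<n}) = colon I x"
          using finite_ideal_family[OF D] .
        have lift_e: "F.relations_lift {..<n} e"
          using step.IH[OF D \<open>I \<subset> colon I x\<close>] e eI by blast
        have ec: "e b \<in> carrier R" if "b \<in> {..<n}" for b using e that by auto
        have "e b \<in> colon I x" if "b \<in> {..<n}" for b
          using that genideal_self[of "e ` {..<n}"] e eI by blast
        then have ex: "e b \<otimes> x \<in> I" if "b \<in> {..<n}" for b using that by (simp add: colon_def)
        have "(\<ominus> x) \<otimes> e b \<in> I" if "b \<in> {..<n}" for b
          using idealD(5)[OF step.hyps ex[OF that]] 3(1) ec[OF that] m_comm[of "e b" x]
          by (simp add: l_minus)
        from family[of "{..<n}" "\<lambda>b. (\<ominus> x) \<otimes> e b" x, OF this]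
        obtain H where "\<forall>b\<in>{..<n}. (\<forall>i\<in>A. H b i \<in> carrier R) \<and>
          (\<Oplus>i\<in>A. (a(j := x)) i \<otimes> H b i) = (\<ominus> x) \<otimes> e b" ..
        then have H: "\<And>b i. b \<in> {..<n} \<Longrightarrow> i \<in> A \<Longrightarrow> H b i \<in> carrier R"
          and He: "\<And>b. b \<in> {..<n} \<Longrightarrow> (\<Oplus>i\<in>A. (a(j := x)) i \<otimes> H b i) = (\<ominus> x) \<otimes> e b" by blast+
        have "F.relations_lift A (a(j := x))"
        proof (rule F.relations_lift_remove[OF A j _ finite_lessThan e H])
          show "a(j := x) \<in> insert j A \<rightarrow> carrier R" using ac 3(1) by auto
          show "F.relations_lift (insert j A) (a(j := x))" by (rule lift[OF 3(1,4)])
          show "(\<Oplus>i\<in>A. (a(j := x)) i \<otimes> H b i) = \<ominus> ((a(j := x)) j \<otimes> e b)"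
            if b: "b \<in> {..<n}" for b
            unfolding He[OF b] using 3(1) ec[OF b] by (simp add: l_minus)
          show "d \<in> Idl (e ` {..<n})"
            if "d \<in> carrier R" "d \<otimes> (a(j := x)) j \<in> Idl (a(j := x) ` A)" for d
            using that unfolding upd(2) eI by (simp add: colon_def)
          fix w assume w: "w \<in> {..<n} \<rightarrow> carrier R" "(\<Oplus>b\<in>{..<n}. e b [^] p \<otimes> w b) = \<zero>"
          have "F.hom_span {..<n} (relations {..<n} e) w" by (rule F.relations_liftD[OF lift_e w])
          then show "F.hom_span A (relations A (a(j := x))) (\<lambda>i. \<Oplus>b\<in>{..<n}. H b i [^] p \<otimes> w b)"
          proof (rule F.hom_span_push[OF finite_lessThan relations_funcset, rotated -1])
            show "(\<lambda>i. \<Oplus>b\<in>{..<n}. H b i \<otimes> c b) \<in> relations A (a(j := x))"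
              if "c \<in> relations {..<n} e" for c
              by (rule relations_push[OF A finite_lessThan ac ec a_inv_closed[OF 3(1)] H He that])
          qed (rule H)
        qed
        then show ?thesis by (rule cong)
      qed
    qed
  qed
  moreover have "ideal (Idl (a ` A)) R" if "a \<in> A \<rightarrow> carrier R" for a and A :: "nat set"
    using that by (intro genideal_ideal) auto
  ultimately show ?thesis unfolding F.flat_def by blast
qed

end

section \<open>The perfect closure\<close>

context char_p_cring
begin

definition frob :: "nat \<Rightarrow> 'a \<Rightarrow> 'a" where "frob n a = a [^] (p ^ n)"

lemma frob_0 [simp]: "a \<in> carrier R \<Longrightarrow> frob 0 a = a" by (simp add: frob_def)

lemma frob_closed [simp, intro]: "a \<in> carrier R \<Longrightarrow> frob n a \<in> carrier R" by (simp add: frob_def)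

lemma frob_one [simp]: "frob n \<one> = \<one>" by (simp add: frob_def)

lemma frob_frob: "a \<in> carrier R \<Longrightarrow> frob m (frob n a) = frob (m + n) a"
  by (simp add: frob_def nat_pow_pow power_add mult.commute)

lemma frob_mult: "a \<in> carrier R \<Longrightarrow> b \<in> carrier R \<Longrightarrow> frob n (a \<otimes> b) = frob n a \<otimes> frob n b"
  by (simp add: frob_def nat_pow_distrib)

lemma frob_Suc: "a \<in> carrier R \<Longrightarrow> frob (Suc n) a = frob n a [^] p"
  by (simp add: frob_def nat_pow_pow mult.commute)

lemma frob_add: "a \<in> carrier R \<Longrightarrow> b \<in> carrier R \<Longrightarrow> frob n (a \<oplus> b) = frob n a \<oplus> frob n b"
  by (induction n) (simp_all add: frob_Suc frobenius_add)

lemma frob_hom: "ring_hom_cring R R (frob n)"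
  by (intro ring_hom_cring.intro ring_hom_cring_axioms.intro cring_axioms ring_hom_memI)
    (auto simp: frob_mult frob_add)

lemma frob_flat:
  assumes "F.flat"
  shows "ring_hom_cring.flat R R (frob n)"
proof (induction n)
  case 0
  interpret f: ring_hom_cring R R "frob 0" by (rule frob_hom)
  show ?case
    unfolding f.flat_def
  proof (intro allI impI f.relations_liftI)
    fix A :: "nat set" and a s
    assume a: "a \<in> A \<rightarrow> carrier R" and s: "s \<in> A \<rightarrow> carrier R"
      and s0: "(\<Oplus>i\<in>A. frob 0 (a i) \<otimes> s i) = \<zero>"
    have ai: "a i \<in> carrier R" and si: "s i \<in> carrier R" if "i \<in> A" for i
      using funcset_mem[OF a that] funcset_mem[OF s that] .
    have "(\<Oplus>i\<in>A. frob 0 (a i) \<otimes> s i) = (\<Oplus>i\<in>A. a i \<otimes> s i)"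
      using ai si by (intro finsum_cong') auto
    then have "s \<in> relations A a" using s s0 by (simp add: relations_def)
    from f.hom_span_single[OF relations_funcset this one_closed]
    show "f.hom_span A (relations A a) s" by (rule f.hom_span_cong) (simp add: si)
  qed
next
  case (Suc n)
  show ?case
    by (rule flat_compose[OF frob_hom frobenius_hom frob_hom frob_Suc Suc assms])
qed

abbreviation "Perf \<equiv> perfect_closure R p"

text \<open>\<open>rt n a\<close> is the \<open>p\<^sup>n\<close>-th root of \<open>a\<close>.\<close>

definition rt :: "nat \<Rightarrow> 'a \<Rightarrow> (nat \<times> 'a) set"
  where "rt n a = perf_rel R p `` {(n, a)}"

lemma perf_rel_iff:
  "((m, a), (n, b)) \<in> perf_rel R p \<longleftrightarrow> a \<in> carrier R \<and> b \<in> carrier R \<and>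
    (\<exists>k\<ge>max m n. frob (k - m) a = frob (k - n) b)"
  by (auto simp: perf_rel_def frob_def)

lemma frob_eq_mono:
  assumes "frob (k - m) a = frob (k - n) b" "m \<le> k" "n \<le> k" "k \<le> l" "a \<in> carrier R" "b \<in> carrier R"
  shows "frob (l - m) a = frob (l - n) b"
proof -
  have "frob (l - k) (frob (k - m) a) = frob (l - k) (frob (k - n) b)" using assms(1) by simp
  moreover have "frob (l - k) (frob (k - m) a) = frob (l - m) a"
    using assms frob_frob[of a "l - k" "k - m"] by simp
  moreover have "frob (l - k) (frob (k - n) b) = frob (l - n) b"
    using assms frob_frob[of b "l - k" "k - n"] by simp
  ultimately show ?thesis by simp
qed

lemma perf_rel_equiv: "equiv (UNIV \<times> carrier R) (perf_rel R p)"
proof (rule equivI)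
  show "perf_rel R p \<subseteq> (UNIV \<times> carrier R) \<times> UNIV \<times> carrier R" by (auto simp: perf_rel_def)
  show "refl_on (UNIV \<times> carrier R) (perf_rel R p)"
    unfolding refl_on_def by (auto simp: perf_rel_iff)
  show "sym (perf_rel R p)"
    unfolding sym_def by (auto simp: perf_rel_iff max.commute eq_commute)
  show "trans (perf_rel R p)"
  proof (rule transI)
    fix x y z assume xy: "(x, y) \<in> perf_rel R p" and yz: "(y, z) \<in> perf_rel R p"
    obtain m a n b l c where d: "x = (m, a)" "y = (n, b)" "z = (l, c)" by (cases x, cases y, cases z)
    obtain k k' where k: "frob (k - m) a = frob (k - n) b" "m \<le> k" "n \<le> k"
      and k': "frob (k' - n) b = frob (k' - l) c" "n \<le> k'" "l \<le> k'"
      and abc: "a \<in> carrier R" "b \<in> carrier R" "c \<in> carrier R"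
      using xy yz by (auto simp: d perf_rel_iff)
    have "frob (max k k' - m) a = frob (max k k' - n) b"
      using frob_eq_mono[OF k max.cobounded1 abc(1,2)] .
    also have "\<dots> = frob (max k k' - l) c"
      using frob_eq_mono[OF k' max.cobounded2 abc(2,3)] .
    finally show "(x, z) \<in> perf_rel R p"
      using k k' abc unfolding d perf_rel_iff by (intro conjI exI[of _ "max k k'"]) auto
  qed
qed

lemma rt_eq_iff:
  assumes "a \<in> carrier R" "b \<in> carrier R"
  shows "rt m a = rt n b \<longleftrightarrow> (\<exists>k\<ge>max m n. frob (k - m) a = frob (k - n) b)"
proof -
  have "rt m a = rt n b \<longleftrightarrow> ((m, a), (n, b)) \<in> perf_rel R p"
    unfolding rt_def using assms by (intro eq_equiv_class_iff[OF perf_rel_equiv]) auto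
  then show ?thesis using assms by (auto simp: perf_rel_iff)
qed

lemma rt_shift: "a \<in> carrier R \<Longrightarrow> rt (n + k) (frob k a) = rt n a"
  by (subst rt_eq_iff) (auto intro!: exI[of _ "n + k"])

lemma rt_closed [simp, intro]: "a \<in> carrier R \<Longrightarrow> rt n a \<in> carrier Perf"
  unfolding perfect_closure_def rt_def by (auto intro: quotientI)

lemma Perf_cases:
  assumes "x \<in> carrier Perf"
  obtains n a where "a \<in> carrier R" "x = rt n a"
  using assms unfolding perfect_closure_def rt_def by (auto elim!: quotientE)

text \<open>Any finite configuration lives in one copy of \<open>R\<close>. This reduces the ring
  axioms and flatness to statements about \<open>R\<close>.\<close>

lemma Perf_common_level:
  assumes "finite A" "\<And>i. i \<in> A \<Longrightarrow> s i \<in> carrier Perf"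
  shows "\<exists>n b. \<forall>i\<in>A. b i \<in> carrier R \<and> s i = rt n (b i)"
proof -
  have "\<exists>n a. a \<in> carrier R \<and> s i = rt n a" if "i \<in> A" for i
    by (rule Perf_cases[OF assms(2)[OF that]]) auto
  then obtain m a where ma: "\<And>i. i \<in> A \<Longrightarrow> a i \<in> carrier R" "\<And>i. i \<in> A \<Longrightarrow> s i = rt (m i) (a i)"
    by metis
  define n where "n = sum m A"
  have "s i = rt n (frob (n - m i) (a i))" if "i \<in> A" for i
  proof -
    have "m i \<le> n" unfolding n_def using assms(1) that by (intro member_le_sum) auto
    then show ?thesis using rt_shift[of "a i" "m i" "n - m i"] ma that by simp
  qed
  then show ?thesis using ma by (intro exI[of _ n] exI[of _ "\<lambda>i. frob (n - m i) (a i)"]) auto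
qed

text \<open>Every operation that commutes with Frobenius is well defined on the direct limit, so sum
  and product are treated together.\<close>

lemma rt_op_wd:
  assumes op: "\<And>a b. a \<in> carrier R \<Longrightarrow> b \<in> carrier R \<Longrightarrow> f a b \<in> carrier R"
    and frob: "\<And>n a b. a \<in> carrier R \<Longrightarrow> b \<in> carrier R \<Longrightarrow> frob n (f a b) = f (frob n a) (frob n b)"
    and a: "a \<in> carrier R" and b: "b \<in> carrier R"
  shows "(\<Union>(m, a)\<in>rt m a. \<Union>(n, b)\<in>rt n b. rt (m + n) (f (frob n a) (frob m b)))
    = rt (m + n) (f (frob n a) (frob m b))"
proof -
  let ?F = "\<lambda>(m, a) (n, b). rt (m + n) (f (frob n a) (frob m b))"
  have "(\<Union>x\<in>rt m a. \<Union>y\<in>rt n b. ?F x y) = ?F (m, a) (n, b)"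
    unfolding rt_def[of m a] rt_def[of n b]
  proof (rule Union_class_pair[OF perf_rel_equiv perf_rel_equiv])
    fix x y assume x: "((m, a), x) \<in> perf_rel R p" and y: "((n, b), y) \<in> perf_rel R p"
    obtain m' a' n' b' where d: "x = (m', a')" "y = (n', b')" by (cases x, cases y)
    obtain k l where k: "frob (k - m) a = frob (k - m') a'" "m \<le> k" "m' \<le> k"
      and l: "frob (l - n) b = frob (l - n') b'" "n \<le> l" "n' \<le> l"
      and c: "a' \<in> carrier R" "b' \<in> carrier R"
      using x y by (auto simp: d perf_rel_iff)
    \<comment> \<open>\<open>k\<close> bounds the levels of both representatives of the first
      argument, \<open>l\<close> those of the second. Hence both results can be compared at level
      \<open>k + l\<close>.\<close>
    have e: "frob (k + l - (i + j)) (f (frob j u) (frob i v)) = f (frob (k + l - i) u) (frob (k + l - j) v)"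
      if "i \<le> k" "j \<le> l" "u \<in> carrier R" "v \<in> carrier R" for i j u v
    proof -
      have "k + l - (i + j) + j = k + l - i" "k + l - (i + j) + i = k + l - j" using that by auto
      then show ?thesis using that by (simp add: frob frob_frob)
    qed
    have "frob (k + l - m) a = frob (k + l - m') a'" using frob_eq_mono[OF k _ a c(1), of "k + l"] by simp
    moreover have "frob (k + l - n) b = frob (k + l - n') b'"
      using frob_eq_mono[OF l _ b c(2), of "k + l"] by simp
    ultimately have "frob (k + l - (m' + n')) (f (frob n' a') (frob m' b'))
      = frob (k + l - (m + n)) (f (frob n a) (frob m b))"
      using e[of m' n' a' b'] e[of m n a b] k l a b c by simp
    then have "rt (m' + n') (f (frob n' a') (frob m' b')) = rt (m + n) (f (frob n a) (frob m b))"
      using k l a b c op by (subst rt_eq_iff) (auto intro!: exI[of _ "k + l"])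
    then show "?F x y = ?F (m, a) (n, b)" by (simp add: d)
  qed (use a b in auto)
  then show ?thesis by (simp add: split_def)
qed

text \<open>At equal levels, the move to level \<open>n + n\<close> in the definition is undone by
  \<open>rt_shift\<close>.\<close>

lemma rt_mult:
  assumes "a \<in> carrier R" "b \<in> carrier R"
  shows "rt n a \<otimes>\<^bsub>Perf\<^esub> rt n b = rt n (a \<otimes> b)"
proof -
  have "rt n a \<otimes>\<^bsub>Perf\<^esub> rt n b = rt (n + n) (frob n a \<otimes> frob n b)"
    using rt_op_wd[of "(\<otimes>)" a b n n] assms frob_mult
    by (simp add: perfect_closure_def rt_def[symmetric] frob_def[symmetric])
  then show ?thesis using rt_shift[of "a \<otimes> b" n n] assms by (simp add: frob_mult)
qed

lemma rt_add:
  assumes "a \<in> carrier R" "b \<in> carrier R"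
  shows "rt n a \<oplus>\<^bsub>Perf\<^esub> rt n b = rt n (a \<oplus> b)"
proof -
  have "rt n a \<oplus>\<^bsub>Perf\<^esub> rt n b = rt (n + n) (frob n a \<oplus> frob n b)"
    using rt_op_wd[of "(\<oplus>)" a b n n] assms frob_add
    by (simp add: perfect_closure_def rt_def[symmetric] frob_def[symmetric])
  then show ?thesis using rt_shift[of "a \<oplus> b" n n] assms by (simp add: frob_add)
qed

lemma frob_zero [simp]: "frob n \<zero> = \<zero>"
  using p_pos by (simp add: frob_def nat_pow_zero)

lemma Perf_zero: "\<zero>\<^bsub>Perf\<^esub> = rt n \<zero>"
  using rt_shift[of \<zero> 0 n] by (simp add: perfect_closure_def rt_def)

lemma Perf_one: "\<one>\<^bsub>Perf\<^esub> = rt n \<one>"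
  using rt_shift[of \<one> 0 n] by (simp add: perfect_closure_def rt_def)

lemma Perf_cases3:
  assumes "x \<in> carrier Perf" "y \<in> carrier Perf" "z \<in> carrier Perf"
  obtains n a b c where "a \<in> carrier R" "b \<in> carrier R" "c \<in> carrier R"
    "x = rt n a" "y = rt n b" "z = rt n c"
proof -
  define s where "s = (\<lambda>i :: nat. if i = 0 then x else if i = 1 then y else z)"
  have "s i \<in> carrier Perf" if "i \<in> {0, 1, 2}" for i using assms by (simp add: s_def)
  then obtain n d where "\<forall>i\<in>{0, 1, 2 :: nat}. d i \<in> carrier R \<and> s i = rt n (d i)"
    using Perf_common_level[of "{0, 1, 2}" s] by blast
  then show thesis using that[of "d 0" "d 1" "d 2" n] by (simp add: s_def)
qed

lemma Perf_cring: "cring Perf"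
proof (rule cringI)
  show "abelian_group Perf"
  proof (rule abelian_groupI)
    fix x y z assume c: "x \<in> carrier Perf" "y \<in> carrier Perf" "z \<in> carrier Perf"
    obtain n a b c where d: "a \<in> carrier R" "b \<in> carrier R" "c \<in> carrier R"
      "x = rt n a" "y = rt n b" "z = rt n c" using Perf_cases3[OF c] .
    show "x \<oplus>\<^bsub>Perf\<^esub> y \<oplus>\<^bsub>Perf\<^esub> z = x \<oplus>\<^bsub>Perf\<^esub> (y \<oplus>\<^bsub>Perf\<^esub> z)"
      using d by (simp add: rt_add a_assoc)
  next
    fix x y assume c: "x \<in> carrier Perf" "y \<in> carrier Perf"
    obtain n a b where d: "a \<in> carrier R" "b \<in> carrier R" "x = rt n a" "y = rt n b"
      using Perf_cases3[OF c c(1)] .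
    show "x \<oplus>\<^bsub>Perf\<^esub> y \<in> carrier Perf" "x \<oplus>\<^bsub>Perf\<^esub> y = y \<oplus>\<^bsub>Perf\<^esub> x"
      using d by (simp_all add: rt_add a_comm)
  next
    fix x assume "x \<in> carrier Perf"
    then obtain n a where d: "a \<in> carrier R" "x = rt n a" by (rule Perf_cases)
    show "\<zero>\<^bsub>Perf\<^esub> \<oplus>\<^bsub>Perf\<^esub> x = x" using d by (simp add: rt_add Perf_zero[of n])
    show "\<exists>y\<in>carrier Perf. y \<oplus>\<^bsub>Perf\<^esub> x = \<zero>\<^bsub>Perf\<^esub>"
      using d by (intro bexI[of _ "rt n (\<ominus> a)"]) (simp_all add: rt_add Perf_zero[of n] l_neg)
  qed (simp add: Perf_zero[of 0])
  show "comm_monoid Perf"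
  proof (rule comm_monoidI)
    fix x y z assume c: "x \<in> carrier Perf" "y \<in> carrier Perf" "z \<in> carrier Perf"
    obtain n a b c where d: "a \<in> carrier R" "b \<in> carrier R" "c \<in> carrier R"
      "x = rt n a" "y = rt n b" "z = rt n c" using Perf_cases3[OF c] .
    show "x \<otimes>\<^bsub>Perf\<^esub> y \<otimes>\<^bsub>Perf\<^esub> z = x \<otimes>\<^bsub>Perf\<^esub> (y \<otimes>\<^bsub>Perf\<^esub> z)"
      using d by (simp add: rt_mult m_assoc)
  next
    fix x y assume c: "x \<in> carrier Perf" "y \<in> carrier Perf"
    obtain n a b where d: "a \<in> carrier R" "b \<in> carrier R" "x = rt n a" "y = rt n b"
      using Perf_cases3[OF c c(1)] .
    show "x \<otimes>\<^bsub>Perf\<^esub> y \<in> carrier Perf" "x \<otimes>\<^bsub>Perf\<^esub> y = y \<otimes>\<^bsub>Perf\<^esub> x"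
      using d by (simp_all add: rt_mult m_comm)
  next
    fix x assume "x \<in> carrier Perf"
    then obtain n a where d: "a \<in> carrier R" "x = rt n a" by (rule Perf_cases)
    show "\<one>\<^bsub>Perf\<^esub> \<otimes>\<^bsub>Perf\<^esub> x = x" using d by (simp add: rt_mult Perf_one[of n])
  qed (simp add: Perf_one[of 0])
  fix x y z assume c: "x \<in> carrier Perf" "y \<in> carrier Perf" "z \<in> carrier Perf"
  obtain n a b c where d: "a \<in> carrier R" "b \<in> carrier R" "c \<in> carrier R"
    "x = rt n a" "y = rt n b" "z = rt n c" using Perf_cases3[OF c] .
  show "(x \<oplus>\<^bsub>Perf\<^esub> y) \<otimes>\<^bsub>Perf\<^esub> z = x \<otimes>\<^bsub>Perf\<^esub> z \<oplus>\<^bsub>Perf\<^esub> y \<otimes>\<^bsub>Perf\<^esub> z"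
    using d by (simp add: rt_mult rt_add l_distr)
qed

lemma rt_hom: "ring_hom_cring R Perf (rt n)"
  by (intro ring_hom_cring.intro ring_hom_cring_axioms.intro cring_axioms Perf_cring ring_hom_memI)
    (auto simp: rt_mult rt_add Perf_one[of n])

lemma perfect_embed_eq_rt: "a \<in> carrier R \<Longrightarrow> perfect_embed R p a = rt n (frob n a)"
  using rt_shift[of a 0 n] by (simp add: perfect_embed_def rt_def)

lemma perfect_embed_hom: "ring_hom_cring R Perf (perfect_embed R p)"
proof -
  have "perfect_embed R p = rt 0" by (simp add: perfect_embed_def rt_def fun_eq_iff)
  then show ?thesis using rt_hom by simp
qed

text \<open>At a common level \<open>n\<close> the relation concerns Frobenius images in
  \<open>R\<close>; there it may hold only after \<open>k\<close> further applications of Frobenius.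
  Flatness of \<open>frob (n + k)\<close> lifts it, and \<open>rt (n + k)\<close> carries the lift
  to the limit.\<close>

lemma perfect_closure_flat:
  assumes "F.flat"
  shows "ring_hom_cring.flat R Perf (perfect_embed R p)"
proof -
  interpret emb: ring_hom_cring R Perf "perfect_embed R p" by (rule perfect_embed_hom)
  show ?thesis
    unfolding emb.flat_def
  proof (intro allI impI emb.relations_liftI)
    fix A :: "nat set" and a s
    assume A: "finite A" and a: "a \<in> A \<rightarrow> carrier R" and s: "s \<in> A \<rightarrow> carrier Perf"
      and s0: "(\<Oplus>\<^bsub>Perf\<^esub>i\<in>A. perfect_embed R p (a i) \<otimes>\<^bsub>Perf\<^esub> s i) = \<zero>\<^bsub>Perf\<^esub>"
    have ai: "a i \<in> carrier R" if "i \<in> A" for i using funcset_mem[OF a that] .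
    have "\<exists>n b. \<forall>i\<in>A. b i \<in> carrier R \<and> s i = rt n (b i)"
      by (rule Perf_common_level[OF A funcset_mem[OF s]])
    then obtain n b where nb: "\<forall>i\<in>A. b i \<in> carrier R \<and> s i = rt n (b i)" by (elim exE)
    have b: "b i \<in> carrier R" and sb: "s i = rt n (b i)" if "i \<in> A" for i
      using nb that by simp_all
    interpret rt: ring_hom_cring R Perf "rt n" by (rule rt_hom)
    define x where "x = (\<Oplus>i\<in>A. frob n (a i) \<otimes> b i)"
    have x: "x \<in> carrier R" unfolding x_def using ai b by (intro finsum_closed) auto
    have "rt n x = (\<Oplus>\<^bsub>Perf\<^esub>i\<in>A. (rt n \<circ> (\<lambda>i. frob n (a i) \<otimes> b i)) i)"
      unfolding x_def using ai b by (intro rt.hom_finsum) auto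
    also have "\<dots> = (\<Oplus>\<^bsub>Perf\<^esub>i\<in>A. perfect_embed R p (a i) \<otimes>\<^bsub>Perf\<^esub> s i)"
    proof (rule emb.S.finsum_cong')
      fix i assume i: "i \<in> A"
      show "(rt n \<circ> (\<lambda>i. frob n (a i) \<otimes> b i)) i = perfect_embed R p (a i) \<otimes>\<^bsub>Perf\<^esub> s i"
        using ai[OF i] b[OF i] sb[OF i] perfect_embed_eq_rt[of "a i" n] by simp
    next
      show "(\<lambda>i. perfect_embed R p (a i) \<otimes>\<^bsub>Perf\<^esub> s i) \<in> A \<rightarrow> carrier Perf"
        by (intro Pi_I emb.S.m_closed emb.hom_closed ai funcset_mem[OF s])
    qed (rule refl)
    finally have "rt n x = (\<Oplus>\<^bsub>Perf\<^esub>i\<in>A. perfect_embed R p (a i) \<otimes>\<^bsub>Perf\<^esub> s i)" .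
    then have "rt n x = rt n \<zero>" using s0 by (simp only: rt.hom_zero)
    then obtain k where "frob k x = \<zero>" using rt_eq_iff[OF x zero_closed, of n n] by auto
    interpret fk: ring_hom_cring R R "frob k" by (rule frob_hom)
    interpret f: ring_hom_cring R R "frob (n + k)" by (rule frob_hom)
    have "(\<Oplus>i\<in>A. frob (n + k) (a i) \<otimes> frob k (b i)) = frob k x"
      unfolding x_def using ai b
      by (subst fk.hom_finsum) (auto simp: comp_def frob_mult frob_frob add.commute intro!: finsum_cong')
    then have "(\<Oplus>i\<in>A. frob (n + k) (a i) \<otimes> frob k (b i)) = \<zero>" using \<open>frob k x = \<zero>\<close> by simp
    moreover have "f.relations_lift A a"
      using frob_flat[OF assms, of "n + k"] A a unfolding f.flat_def by blast
    ultimately have "f.hom_span A (relations A a) (\<lambda>i. frob k (b i))"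
      using f.relations_liftD[of A a "\<lambda>i. frob k (b i)"] b by auto
    \<comment> \<open>\<open>perfect_embed\<close> is \<open>rt (n + k)\<close> after
      \<open>frob (n + k)\<close>, and \<open>rt_shift\<close> identifies the image of
      \<open>frob k (b i)\<close> with \<open>s i\<close>.\<close>
    from hom_span_map[OF frob_hom rt_hom perfect_embed_hom perfect_embed_eq_rt relations_funcset this]
    show "emb.hom_span A (relations A a) s"
      by (rule emb.hom_span_cong) (auto simp: sb b rt_shift)
  qed
qed

end

section \<open>Base change along a flat homomorphism\<close>

lemma (in module) finsum_smult_rdistr:
  "\<lbrakk>finite A; x \<in> carrier M; f \<in> A \<rightarrow> carrier R\<rbrakk> \<Longrightarrow> (\<Oplus>i\<in>A. f i) \<odot>\<^bsub>M\<^esub> x = (\<Oplus>\<^bsub>M\<^esub>i\<in>A. f i \<odot>\<^bsub>M\<^esub> x)"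
proof (induction set: finite)
  case (insert i A)
  then show ?case by (simp add: Pi_def smult_l_distr)
qed simp

context module
begin

definition module_relations :: "'i set \<Rightarrow> ('i \<Rightarrow> 'c) \<Rightarrow> ('i \<Rightarrow> 'a) set"
  where "module_relations A x = {c \<in> A \<rightarrow> carrier R. (\<Oplus>\<^bsub>M\<^esub>i\<in>A. c i \<odot>\<^bsub>M\<^esub> x i) = \<zero>\<^bsub>M\<^esub>}"

lemma module_relations_funcset: "module_relations A x \<subseteq> A \<rightarrow> carrier R"
  unfolding module_relations_def by blast

lemma finsum_smult_swap:
  assumes "finite A" "finite B" "\<And>i. i \<in> A \<Longrightarrow> x i \<in> carrier M" "\<And>b. b \<in> B \<Longrightarrow> c b \<in> carrier R"
    and H: "\<And>b i. b \<in> B \<Longrightarrow> i \<in> A \<Longrightarrow> H b i \<in> carrier R"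
  shows "(\<Oplus>\<^bsub>M\<^esub>i\<in>A. (\<Oplus>b\<in>B. H b i \<otimes> c b) \<odot>\<^bsub>M\<^esub> x i) = (\<Oplus>\<^bsub>M\<^esub>b\<in>B. c b \<odot>\<^bsub>M\<^esub> (\<Oplus>\<^bsub>M\<^esub>i\<in>A. H b i \<odot>\<^bsub>M\<^esub> x i))"
proof -
  have "(\<Oplus>\<^bsub>M\<^esub>i\<in>A. (\<Oplus>b\<in>B. H b i \<otimes> c b) \<odot>\<^bsub>M\<^esub> x i) = (\<Oplus>\<^bsub>M\<^esub>i\<in>A. \<Oplus>\<^bsub>M\<^esub>b\<in>B. (H b i \<otimes> c b) \<odot>\<^bsub>M\<^esub> x i)"
    using assms by (intro M.finsum_cong' finsum_smult_rdistr) (auto intro!: M.finsum_closed)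
  also have "\<dots> = (\<Oplus>\<^bsub>M\<^esub>b\<in>B. \<Oplus>\<^bsub>M\<^esub>i\<in>A. (H b i \<otimes> c b) \<odot>\<^bsub>M\<^esub> x i)"
    using assms by (intro M.finsum_swap) auto
  also have "\<dots> = (\<Oplus>\<^bsub>M\<^esub>b\<in>B. \<Oplus>\<^bsub>M\<^esub>i\<in>A. c b \<odot>\<^bsub>M\<^esub> (H b i \<odot>\<^bsub>M\<^esub> x i))"
  proof (intro M.finsum_cong' refl)
    show "(H b i \<otimes> c b) \<odot>\<^bsub>M\<^esub> x i = c b \<odot>\<^bsub>M\<^esub> (H b i \<odot>\<^bsub>M\<^esub> x i)" if "b \<in> B" "i \<in> A" for b i
      using assms that R.m_comm[of "H b i" "c b"] by (simp add: smult_assoc1)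
  qed (use assms in \<open>auto intro!: M.finsum_closed\<close>)
  also have "\<dots> = (\<Oplus>\<^bsub>M\<^esub>b\<in>B. c b \<odot>\<^bsub>M\<^esub> (\<Oplus>\<^bsub>M\<^esub>i\<in>A. H b i \<odot>\<^bsub>M\<^esub> x i))"
    using assms by (intro M.finsum_cong' refl finsum_smult_ldistr[symmetric]) (auto intro!: M.finsum_closed)
  finally show ?thesis .
qed

lemma module_relations_push:
  assumes A: "finite A" and B: "finite B" and x: "\<And>i. i \<in> A \<Longrightarrow> x i \<in> carrier M"
    and H: "\<And>b i. b \<in> B \<Longrightarrow> i \<in> A \<Longrightarrow> H b i \<in> carrier R"
    and c: "c \<in> module_relations B (\<lambda>b. \<Oplus>\<^bsub>M\<^esub>i\<in>A. H b i \<odot>\<^bsub>M\<^esub> x i)"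
  shows "(\<lambda>i. \<Oplus>b\<in>B. H b i \<otimes> c b) \<in> module_relations A x"
proof -
  have cb: "c b \<in> carrier R" if "b \<in> B" for b
    using subsetD[OF module_relations_funcset c] that by auto
  have "(\<Oplus>\<^bsub>M\<^esub>i\<in>A. (\<Oplus>b\<in>B. H b i \<otimes> c b) \<odot>\<^bsub>M\<^esub> x i) = \<zero>\<^bsub>M\<^esub>"
    using c finsum_smult_swap[OF A B x cb H] by (simp add: module_relations_def)
  then show ?thesis using H cb by (auto simp: module_relations_def intro!: R.finsum_closed)
qed

lemma finsum_smult_delta:
  assumes "finite A" "k \<in> A" "\<And>i. i \<in> A \<Longrightarrow> x i \<in> carrier M" "r \<in> carrier R"
  shows "(\<Oplus>\<^bsub>M\<^esub>i\<in>A. (if i = k then r else \<zero>) \<odot>\<^bsub>M\<^esub> x i) = r \<odot>\<^bsub>M\<^esub> x k"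
proof -
  have "(\<Oplus>\<^bsub>M\<^esub>i\<in>A. (if i = k then r else \<zero>) \<odot>\<^bsub>M\<^esub> x i) = (\<Oplus>\<^bsub>M\<^esub>i\<in>A. if i = k then r \<odot>\<^bsub>M\<^esub> x k else \<zero>\<^bsub>M\<^esub>)"
    using assms by (intro M.finsum_cong') auto
  also have "\<dots> = r \<odot>\<^bsub>M\<^esub> x k" using assms by (intro M.finsum_delta) auto
  finally show ?thesis .
qed

lemma module_relations_minus:
  assumes "finite A" and x: "\<And>i. i \<in> A \<Longrightarrow> x i \<in> carrier M"
    and a: "a \<in> A \<rightarrow> carrier R" and b: "b \<in> A \<rightarrow> carrier R"
    and eq: "(\<Oplus>\<^bsub>M\<^esub>i\<in>A. a i \<odot>\<^bsub>M\<^esub> x i) = (\<Oplus>\<^bsub>M\<^esub>i\<in>A. b i \<odot>\<^bsub>M\<^esub> x i)"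
  shows "(\<lambda>i. a i \<ominus> b i) \<in> module_relations A x"
proof -
  have ab: "a i \<in> carrier R" "b i \<in> carrier R" if "i \<in> A" for i using a b that by auto
  let ?s = "\<lambda>f. \<Oplus>\<^bsub>M\<^esub>i\<in>A. f i \<odot>\<^bsub>M\<^esub> x i"
  have cl: "?s f \<in> carrier M" if "\<And>i. i \<in> A \<Longrightarrow> f i \<in> carrier R" for f
    using that x by (intro M.finsum_closed) auto
  have "?s a = (\<Oplus>\<^bsub>M\<^esub>i\<in>A. (a i \<ominus> b i) \<odot>\<^bsub>M\<^esub> x i \<oplus>\<^bsub>M\<^esub> b i \<odot>\<^bsub>M\<^esub> x i)"
  proof (rule M.finsum_cong')
    fix i assume i: "i \<in> A"
    have "a i = (a i \<ominus> b i) \<oplus> b i" using ab[OF i] by (rule R.minus_add_cancel_right)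
    then show "a i \<odot>\<^bsub>M\<^esub> x i = (a i \<ominus> b i) \<odot>\<^bsub>M\<^esub> x i \<oplus>\<^bsub>M\<^esub> b i \<odot>\<^bsub>M\<^esub> x i"
      using ab[OF i] x[OF i] smult_l_distr[of "a i \<ominus> b i" "b i" "x i"] by simp
  qed (use ab x in auto)
  also have "\<dots> = ?s (\<lambda>i. a i \<ominus> b i) \<oplus>\<^bsub>M\<^esub> ?s b" using ab x by (intro M.finsum_addf) auto
  finally have "?s (\<lambda>i. a i \<ominus> b i) \<oplus>\<^bsub>M\<^esub> ?s b = ?s b" using eq by simp
  then have "?s (\<lambda>i. a i \<ominus> b i) = \<zero>\<^bsub>M\<^esub>"
    using cl[of "\<lambda>i. a i \<ominus> b i"] cl[of b] ab by (simp add: M.add.r_cancel_one)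
  then show ?thesis using ab by (auto simp: module_relations_def)
qed

end

section \<open>When a sum of tensors vanishes\<close>

locale base_change_module = ring_hom_cring R S h + L: module R L
  for R (structure) and S (structure) and h and L
begin

text \<open>Makes the coefficients explicit, indexed by natural numbers because \<open>flat\<close>
  speaks of families so indexed.\<close>

lemma hom_span_imp_sum:
  assumes V: "V \<subseteq> A \<rightarrow> carrier R" and "hom_span A V s"
  shows "\<exists>(m :: nat) c t. (\<forall>k<m. c k \<in> V \<and> t k \<in> carrier S) \<and>
    (\<forall>i\<in>A. s i = (\<Oplus>\<^bsub>S\<^esub>k\<in>{..<m}. h (c k i) \<otimes>\<^bsub>S\<^esub> t k))"
  using assms(2)
proof (induction rule: hom_span.induct)
  case (zero s)
  then show ?case by (intro exI[of _ 0]) auto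
next
  case (add s c t s')
  from add.IH obtain m c' t' where "(\<forall>k<(m :: nat). c' k \<in> V \<and> t' k \<in> carrier S) \<and>
    (\<forall>i\<in>A. s i = (\<Oplus>\<^bsub>S\<^esub>k\<in>{..<m}. h (c' k i) \<otimes>\<^bsub>S\<^esub> t' k))" by (elim exE)
  note m = conjunct1[OF this] conjunct2[OF this]
  define c'' where "c'' = c'(m := c)"
  define t'' where "t'' = t'(m := t)"
  have ct: "\<forall>k<Suc m. c'' k \<in> V \<and> t'' k \<in> carrier S"
    using m(1) add.hyps(2,3) by (simp add: c''_def t''_def less_Suc_eq)
  have "s' i = (\<Oplus>\<^bsub>S\<^esub>k\<in>{..<Suc m}. h (c'' k i) \<otimes>\<^bsub>S\<^esub> t'' k)" if i: "i \<in> A" for i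
  proof -
    have cl: "h (c'' k i) \<otimes>\<^bsub>S\<^esub> t'' k \<in> carrier S" if "k < Suc m" for k
    proof -
      have "c'' k \<in> A \<rightarrow> carrier R" "t'' k \<in> carrier S" using V ct that by blast+
      then show ?thesis using funcset_mem[of "c'' k" A] i by simp
    qed
    have eq: "(\<Oplus>\<^bsub>S\<^esub>k\<in>{..<m}. h (c'' k i) \<otimes>\<^bsub>S\<^esub> t'' k) = (\<Oplus>\<^bsub>S\<^esub>k\<in>{..<m}. h (c' k i) \<otimes>\<^bsub>S\<^esub> t' k)"
    proof (rule S.finsum_cong')
      show "(\<lambda>k. h (c' k i) \<otimes>\<^bsub>S\<^esub> t' k) \<in> {..<m} \<rightarrow> carrier S"
      proof (rule Pi_I)
        show "h (c' k i) \<otimes>\<^bsub>S\<^esub> t' k \<in> carrier S" if "k \<in> {..<m}" for k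
          using cl[of k] that by (simp add: c''_def t''_def)
      qed
    qed (simp_all add: c''_def t''_def)
    have "(\<Oplus>\<^bsub>S\<^esub>k\<in>insert m {..<m}. h (c'' k i) \<otimes>\<^bsub>S\<^esub> t'' k)
      = h (c'' m i) \<otimes>\<^bsub>S\<^esub> t'' m \<oplus>\<^bsub>S\<^esub> (\<Oplus>\<^bsub>S\<^esub>k\<in>{..<m}. h (c'' k i) \<otimes>\<^bsub>S\<^esub> t'' k)"
      using cl by (intro S.finsum_insert) auto
    also have "\<dots> = h (c i) \<otimes>\<^bsub>S\<^esub> t \<oplus>\<^bsub>S\<^esub> s i" unfolding eq using m(2) i by (simp add: c''_def t''_def)
    also have "\<dots> = s' i"
      using add.hyps(4)[OF i] hom_span_closed[OF add.hyps(1) V i] cl[of m]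
      by (simp add: S.a_comm c''_def t''_def)
    finally show ?thesis by (simp add: lessThan_Suc)
  qed
  then show ?case using ct by (intro exI[of _ "Suc m"] exI[of _ c''] exI[of _ t'']) simp
qed

lemma hom_span_mono:
  assumes Y: "finite Z" "Y \<subseteq> Z" and x: "\<And>i. i \<in> Z \<Longrightarrow> x i \<in> carrier L"
    and "hom_span Y (L.module_relations Y x) s" "\<And>i. i \<in> Z - Y \<Longrightarrow> s i = \<zero>\<^bsub>S\<^esub>"
  shows "hom_span Z (L.module_relations Z x) s"
proof -
  have "hom_span Z (L.module_relations Z x) (\<lambda>i. if i \<in> Y then s i else \<zero>\<^bsub>S\<^esub>)"
    using assms(4)
  proof (induction rule: hom_span.induct)
    case (zero s)
    then show ?case by (intro hom_span.zero) auto
  next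
    case (add s c t s')
    define c' where "c' i = (if i \<in> Y then c i else \<zero>)" for i
    have c: "c i \<in> carrier R" if "i \<in> Y" for i
      using add.hyps(2) that by (auto simp: L.module_relations_def)
    have "(\<Oplus>\<^bsub>L\<^esub>i\<in>Y. c i \<odot>\<^bsub>L\<^esub> x i) = (\<Oplus>\<^bsub>L\<^esub>i\<in>Z. c' i \<odot>\<^bsub>L\<^esub> x i)"
      using Y x c by (intro L.M.add.finprod_mono_neutral_cong_left) (auto simp: c'_def)
    then have "c' \<in> L.module_relations Z x"
      using add.hyps(2) c by (auto simp: L.module_relations_def c'_def)
    then show ?case
      by (rule hom_span.add[OF add.IH _ add.hyps(3)]) (use add.hyps(3,4) in \<open>auto simp: c'_def\<close>)
  qed
  then show ?thesis by (rule hom_span_cong) (use assms(5) in auto)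
qed

abbreviation "frees \<equiv> free_Abelian_group (carrier L \<times> carrier S)"
abbreviation "rels \<equiv> generate frees (tensor_relators R S h L)"

lemma relators_carrier: "tensor_relators R S h L \<subseteq> carrier frees"
proof -
  have fo: "frag_of z \<in> carrier frees \<longleftrightarrow> z \<in> carrier L \<times> carrier S" for z by (simp add: keys_frag_of)
  have df: "a - b \<in> carrier frees" if "a \<in> carrier frees" "b \<in> carrier frees" for a b
    using that keys_diff[of a b] by auto
  show ?thesis
    unfolding tensor_relators_def by (auto simp only: Un_subset_iff intro!: df) (auto simp: keys_frag_of)
qed

lemma rels_subgroup: "subgroup rels frees"
  by (rule group.generate_is_subgroup[OF group_free_Abelian_group relators_carrier])

lemma rels_carrier: "c \<in> rels \<Longrightarrow> c \<in> carrier frees"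
  using subgroup.subset[OF rels_subgroup] by blast

lemma rels_zero: "0 \<in> rels" using subgroup.one_closed[OF rels_subgroup] by simp
lemma rels_add: "c \<in> rels \<Longrightarrow> d \<in> rels \<Longrightarrow> c + d \<in> rels"
  using subgroup.m_closed[OF rels_subgroup] by simp
lemma rels_uminus: "c \<in> rels \<Longrightarrow> - c \<in> rels"
  using subgroup.m_inv_closed[OF rels_subgroup, of c] rels_carrier[of c] by simp
lemma rels_diff: "c \<in> rels \<Longrightarrow> d \<in> rels \<Longrightarrow> c - d \<in> rels"
  using rels_add[OF _ rels_uminus, of c d] by simp
lemma rels_sum: "(\<And>i. i \<in> A \<Longrightarrow> f i \<in> rels) \<Longrightarrow> sum f A \<in> rels"
  by (induction A rule: infinite_finite_induct) (auto simp: rels_zero intro: rels_add)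
lemma rels_trans: "c - d \<in> rels \<Longrightarrow> d - e \<in> rels \<Longrightarrow> c - e \<in> rels"
  using rels_add[of "c - d" "d - e"] by simp

text \<open>Closure under differences covers both the product and the inverse rule of
  \<open>generate\<close>.\<close>

lemma rels_induct [consumes 1, case_names zero relator diff]:
  assumes "c \<in> rels" "P 0" "\<And>c. c \<in> tensor_relators R S h L \<Longrightarrow> P c"
    and "\<And>c d. c \<in> rels \<Longrightarrow> d \<in> rels \<Longrightarrow> P c \<Longrightarrow> P d \<Longrightarrow> P (c - d)"
  shows "P c"
  using assms(1)
proof (induction rule: generate.induct)
  case one
  then show ?case using assms(2) by simp
next
  case (incl c)
  then show ?case by (rule assms(3))
next
  case (inv c)
  have "c \<in> carrier frees" using inv relators_carrier by blast
  moreover have "P (0 - c)" using assms(2-4) inv rels_zero generate.incl[OF inv, of frees] by blast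
  ultimately show ?case by simp
next
  case (eng c d)
  have "P (0 - d)" using assms(2,4) eng rels_zero by blast
  then have "P (c - (0 - d))" using assms(4) eng rels_diff[OF rels_zero] by blast
  then show ?case by simp
qed

lemma tensor_add_left:
  "x \<in> carrier L \<Longrightarrow> y \<in> carrier L \<Longrightarrow> s \<in> carrier S \<Longrightarrow>
    frag_of (x \<oplus>\<^bsub>L\<^esub> y, s) - frag_of (x, s) - frag_of (y, s) \<in> rels"
  by (rule generate.incl) (unfold tensor_relators_def, blast)

lemma tensor_add_right:
  "x \<in> carrier L \<Longrightarrow> s \<in> carrier S \<Longrightarrow> t \<in> carrier S \<Longrightarrow>
    frag_of (x, s \<oplus>\<^bsub>S\<^esub> t) - frag_of (x, s) - frag_of (x, t) \<in> rels"
  by (rule generate.incl) (unfold tensor_relators_def, blast)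

lemma tensor_smult:
  "r \<in> carrier R \<Longrightarrow> x \<in> carrier L \<Longrightarrow> s \<in> carrier S \<Longrightarrow>
    frag_of (r \<odot>\<^bsub>L\<^esub> x, s) - frag_of (x, h r \<otimes>\<^bsub>S\<^esub> s) \<in> rels"
  by (rule generate.incl) (unfold tensor_relators_def, blast)

lemma tensor_zero_left: "s \<in> carrier S \<Longrightarrow> frag_of (\<zero>\<^bsub>L\<^esub>, s) \<in> rels"
  using rels_uminus[OF tensor_add_left[of "\<zero>\<^bsub>L\<^esub>" "\<zero>\<^bsub>L\<^esub>" s]] by simp

lemma tensor_zero_right: "x \<in> carrier L \<Longrightarrow> frag_of (x, \<zero>\<^bsub>S\<^esub>) \<in> rels"
  using rels_uminus[OF tensor_add_right[of x "\<zero>\<^bsub>S\<^esub>" "\<zero>\<^bsub>S\<^esub>"]] by simp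

lemma tensor_finsum_left:
  assumes "finite A" "\<And>i. i \<in> A \<Longrightarrow> x i \<in> carrier L" "s \<in> carrier S"
  shows "frag_of (\<Oplus>\<^bsub>L\<^esub>i\<in>A. x i, s) - (\<Sum>i\<in>A. frag_of (x i, s)) \<in> rels"
  using assms(1,2)
proof (induction A)
  case empty
  then show ?case using tensor_zero_left assms(3) by simp
next
  case (insert j A)
  have "(\<Oplus>\<^bsub>L\<^esub>i\<in>A. x i) \<in> carrier L" using insert by (intro L.M.finsum_closed) auto
  then have "frag_of (x j \<oplus>\<^bsub>L\<^esub> (\<Oplus>\<^bsub>L\<^esub>i\<in>A. x i), s) - frag_of (x j, s) - frag_of (\<Oplus>\<^bsub>L\<^esub>i\<in>A. x i, s) \<in> rels"
    using insert assms(3) by (intro tensor_add_left) auto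
  moreover have "(\<Oplus>\<^bsub>L\<^esub>i\<in>insert j A. x i) = x j \<oplus>\<^bsub>L\<^esub> (\<Oplus>\<^bsub>L\<^esub>i\<in>A. x i)"
    using insert by (intro L.M.finsum_insert) auto
  moreover have "frag_of (\<Oplus>\<^bsub>L\<^esub>i\<in>A. x i, s) - (\<Sum>i\<in>A. frag_of (x i, s)) \<in> rels" using insert by simp
  ultimately show ?case
    using rels_add insert.hyps by (fastforce simp: algebra_simps)
qed

text \<open>Represents the sum of the tensors of \<open>x i\<close> with \<open>s i\<close> in the
  free group; the \<open>x i\<close> may repeat.\<close>

definition comb :: "'i set \<Rightarrow> ('i \<Rightarrow> _) \<Rightarrow> ('i \<Rightarrow> _) \<Rightarrow> _"
  where "comb A x s = (\<Sum>i\<in>A. frag_of (x i, s i))"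

lemma comb_add:
  assumes "\<And>i. i \<in> A \<Longrightarrow> x i \<in> carrier L" "\<And>i. i \<in> A \<Longrightarrow> s i \<in> carrier S" "\<And>i. i \<in> A \<Longrightarrow> t i \<in> carrier S"
  shows "comb A x (\<lambda>i. s i \<oplus>\<^bsub>S\<^esub> t i) - comb A x s - comb A x t \<in> rels"
  unfolding comb_def sum_subtractf[symmetric] using assms by (intro rels_sum tensor_add_right)

lemma comb_smult_left:
  assumes "\<And>i. i \<in> A \<Longrightarrow> x i \<in> carrier L" "\<And>i. i \<in> A \<Longrightarrow> c i \<in> carrier R" "\<And>i. i \<in> A \<Longrightarrow> s i \<in> carrier S"
  shows "comb A (\<lambda>i. c i \<odot>\<^bsub>L\<^esub> x i) s - comb A x (\<lambda>i. h (c i) \<otimes>\<^bsub>S\<^esub> s i) \<in> rels"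
  unfolding comb_def sum_subtractf[symmetric] using assms by (intro rels_sum tensor_smult)

lemma comb_finsum_left:
  assumes A: "finite A" and x: "\<And>i. i \<in> A \<Longrightarrow> x i \<in> carrier L" and c: "\<And>i. i \<in> A \<Longrightarrow> c i \<in> carrier R"
    and t: "t \<in> carrier S"
  shows "frag_of (\<Oplus>\<^bsub>L\<^esub>i\<in>A. c i \<odot>\<^bsub>L\<^esub> x i, t) - comb A x (\<lambda>i. h (c i) \<otimes>\<^bsub>S\<^esub> t) \<in> rels"
proof (rule rels_trans)
  show "frag_of (\<Oplus>\<^bsub>L\<^esub>i\<in>A. c i \<odot>\<^bsub>L\<^esub> x i, t) - (\<Sum>i\<in>A. frag_of (c i \<odot>\<^bsub>L\<^esub> x i, t)) \<in> rels"
    using assms by (intro tensor_finsum_left) auto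
  show "(\<Sum>i\<in>A. frag_of (c i \<odot>\<^bsub>L\<^esub> x i, t)) - comb A x (\<lambda>i. h (c i) \<otimes>\<^bsub>S\<^esub> t) \<in> rels"
    using comb_smult_left[of A x c "\<lambda>_. t"] assms by (simp add: comb_def)
qed

text \<open>For a relation \<open>c\<close>, moving the coefficients across the tensor sign turns
  the sum of the tensors of \<open>x i\<close> with \<open>h (c i) t\<close> into the tensor of zero
  with \<open>t\<close>.\<close>

lemma comb_mem_rels_if:
  assumes A: "finite A" and x: "\<And>i. i \<in> A \<Longrightarrow> x i \<in> carrier L"
    and "hom_span A (L.module_relations A x) s"
  shows "comb A x s \<in> rels"
  using assms(3)
proof (induction rule: hom_span.induct)
  case (zero s)
  then show ?case using x by (auto simp: comb_def intro!: rels_sum tensor_zero_right)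
next
  case (add s c t s')
  have c: "c i \<in> carrier R" if "i \<in> A" for i
    using subsetD[OF L.module_relations_funcset add.hyps(2)] that by auto
  have s: "s i \<in> carrier S" if "i \<in> A" for i
    using hom_span_closed[OF add.hyps(1) L.module_relations_funcset that] .
  have ct: "h (c i) \<otimes>\<^bsub>S\<^esub> t \<in> carrier S" if "i \<in> A" for i using c that add.hyps(3) by auto
  have "comb A x s' = comb A x (\<lambda>i. s i \<oplus>\<^bsub>S\<^esub> h (c i) \<otimes>\<^bsub>S\<^esub> t)"
    unfolding comb_def using add.hyps(4) by (intro sum.cong) auto
  then have 1: "comb A x s' - comb A x s - comb A x (\<lambda>i. h (c i) \<otimes>\<^bsub>S\<^esub> t) \<in> rels"
    using comb_add[OF x s ct] by simp
  have "frag_of (\<Oplus>\<^bsub>L\<^esub>i\<in>A. c i \<odot>\<^bsub>L\<^esub> x i, t) - comb A x (\<lambda>i. h (c i) \<otimes>\<^bsub>S\<^esub> t) \<in> rels"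
    by (intro comb_finsum_left A x c add.hyps(3))
  then have "frag_of (\<zero>\<^bsub>L\<^esub>, t) - comb A x (\<lambda>i. h (c i) \<otimes>\<^bsub>S\<^esub> t) \<in> rels"
    using add.hyps(2) by (simp add: L.module_relations_def)
  then have 2: "comb A x (\<lambda>i. h (c i) \<otimes>\<^bsub>S\<^esub> t) \<in> rels"
    using rels_diff[OF tensor_zero_left[OF add.hyps(3)]] by fastforce
  show ?case using rels_add[OF rels_add[OF 1 2] add.IH] by simp
qed

text \<open>\<open>coef y c\<close> is the \<open>y\<close>-coordinate of the image of \<open>c\<close> in the free \<open>S\<close>-module on \<open>L\<close>.\<close>

definition coef where
  "coef y = (SOME f. f \<in> hom frees (add_monoid S) \<and>
    (\<forall>z\<in>carrier L \<times> carrier S. f (frag_of z) = (if fst z = y then snd z else \<zero>\<^bsub>S\<^esub>)))"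

lemma coef:
  shows coef_hom: "coef y \<in> hom frees (add_monoid S)"
    and coef_frag: "x \<in> carrier L \<Longrightarrow> s \<in> carrier S \<Longrightarrow>
      coef y (frag_of (x, s)) = (if x = y then s else \<zero>\<^bsub>S\<^esub>)"
proof -
  have "comm_group (add_monoid S)" by (rule S.a_comm_group)
  then obtain f where "f \<in> hom frees (add_monoid S)"
    "\<And>z. z \<in> carrier L \<times> carrier S \<Longrightarrow> f (frag_of z) = (if fst z = y then snd z else \<zero>\<^bsub>S\<^esub>)"
    by (rule comm_group.free_Abelian_group_universal
        [of "add_monoid S" "\<lambda>z. if fst z = y then snd z else \<zero>\<^bsub>S\<^esub>" "carrier L \<times> carrier S"]) auto
  then have "\<exists>f. f \<in> hom frees (add_monoid S) \<and>
    (\<forall>z\<in>carrier L \<times> carrier S. f (frag_of z) = (if fst z = y then snd z else \<zero>\<^bsub>S\<^esub>))" by blast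
  from someI_ex[OF this]
  have *: "coef y \<in> hom frees (add_monoid S)"
    "\<forall>z\<in>carrier L \<times> carrier S. coef y (frag_of z) = (if fst z = y then snd z else \<zero>\<^bsub>S\<^esub>)"
    by (simp_all add: coef_def)
  show "coef y \<in> hom frees (add_monoid S)" by (rule *)
  show "x \<in> carrier L \<Longrightarrow> s \<in> carrier S \<Longrightarrow> coef y (frag_of (x, s)) = (if x = y then s else \<zero>\<^bsub>S\<^esub>)"
    using *(2) by simp
qed

lemma frees_add: "c \<in> carrier frees \<Longrightarrow> d \<in> carrier frees \<Longrightarrow> c + d \<in> carrier frees"
  using keys_add[of c d] by auto

lemma frees_diff: "c \<in> carrier frees \<Longrightarrow> d \<in> carrier frees \<Longrightarrow> c - d \<in> carrier frees"
  using keys_diff[of c d] by auto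

lemma frees_frag: "x \<in> carrier L \<Longrightarrow> s \<in> carrier S \<Longrightarrow> frag_of (x, s) \<in> carrier frees"
  by (simp add: keys_frag_of)

lemma coef_closed: "c \<in> carrier frees \<Longrightarrow> coef y c \<in> carrier S"
  using hom_in_carrier[OF coef_hom, of c] by simp

lemma coef_add:
  "c \<in> carrier frees \<Longrightarrow> d \<in> carrier frees \<Longrightarrow> coef y (c + d) = coef y c \<oplus>\<^bsub>S\<^esub> coef y d"
  using Group.hom_mult[OF coef_hom, of c d] by simp

lemma coef_zero: "coef y 0 = \<zero>\<^bsub>S\<^esub>"
  using coef_add[of 0 0 y] coef_closed[of 0 y] by simp

lemma coef_diff:
  assumes "c \<in> carrier frees" "d \<in> carrier frees"
  shows "coef y (c - d) = coef y c \<ominus>\<^bsub>S\<^esub> coef y d"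
proof -
  have "coef y c = coef y (c - d) \<oplus>\<^bsub>S\<^esub> coef y d"
    using coef_add[OF frees_diff[OF assms] assms(2), of y] by simp
  moreover have "x = x \<oplus>\<^bsub>S\<^esub> y \<ominus>\<^bsub>S\<^esub> y" if "x \<in> carrier S" "y \<in> carrier S" for x y
    using that by algebra
  ultimately show ?thesis
    using coef_closed[OF frees_diff[OF assms]] coef_closed[OF assms(2)] by metis
qed

lemma coef_comb:
  assumes "finite A" "\<And>i. i \<in> A \<Longrightarrow> x i \<in> carrier L" "\<And>i. i \<in> A \<Longrightarrow> s i \<in> carrier S"
  shows "comb A x s \<in> carrier frees \<and> coef y (comb A x s) = (\<Oplus>\<^bsub>S\<^esub>i\<in>A. if x i = y then s i else \<zero>\<^bsub>S\<^esub>)"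
  using assms
proof (induction A)
  case empty
  then show ?case by (simp add: comb_def coef_zero)
next
  case (insert j A)
  then have IH: "comb A x s \<in> carrier frees" "coef y (comb A x s) = (\<Oplus>\<^bsub>S\<^esub>i\<in>A. if x i = y then s i else \<zero>\<^bsub>S\<^esub>)"
    by auto
  have j: "frag_of (x j, s j) \<in> carrier frees" using insert by (intro frees_frag) auto
  have "comb (insert j A) x s = frag_of (x j, s j) + comb A x s" using insert by (simp add: comb_def)
  moreover have "(\<Oplus>\<^bsub>S\<^esub>i\<in>insert j A. if x i = y then s i else \<zero>\<^bsub>S\<^esub>)
    = (if x j = y then s j else \<zero>\<^bsub>S\<^esub>) \<oplus>\<^bsub>S\<^esub> (\<Oplus>\<^bsub>S\<^esub>i\<in>A. if x i = y then s i else \<zero>\<^bsub>S\<^esub>)"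
    using insert by (intro S.finsum_insert) auto
  ultimately show ?case
    using IH coef_add[OF j IH(1), of y] frees_add[OF j IH(1)] coef_frag[of "x j" "s j" y] insert by simp
qed

text \<open>Exactness of \<open>K \<otimes> S \<rightarrow> S\<^sup>(\<^sup>L\<^sup>) \<rightarrow> L \<otimes> S \<rightarrow> 0\<close>, where \<open>K\<close> is the kernel of \<open>R\<^sup>(\<^sup>L\<^sup>) \<rightarrow> L\<close>.\<close>

lemma coef_rels:
  assumes "c \<in> rels"
  shows "\<exists>Y. finite Y \<and> Y \<subseteq> carrier L \<and> (\<forall>y\<in>carrier L - Y. coef y c = \<zero>\<^bsub>S\<^esub>) \<and>
    hom_span Y (L.module_relations Y (\<lambda>y. y)) (\<lambda>y. coef y c)"
  using assms
proof (induction rule: rels_induct)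
  case zero
  show ?case by (rule exI[of _ "{}"]) (auto simp: coef_zero intro: hom_span.zero)
next
  case (diff c d)
  obtain Y where Y: "finite Y" "Y \<subseteq> carrier L" "\<forall>y\<in>carrier L - Y. coef y c = \<zero>\<^bsub>S\<^esub>"
    "hom_span Y (L.module_relations Y (\<lambda>y. y)) (\<lambda>y. coef y c)" using diff.IH(1) by (elim exE conjE)
  obtain Z where Z: "finite Z" "Z \<subseteq> carrier L" "\<forall>y\<in>carrier L - Z. coef y d = \<zero>\<^bsub>S\<^esub>"
    "hom_span Z (L.module_relations Z (\<lambda>y. y)) (\<lambda>y. coef y d)" using diff.IH(2) by (elim exE conjE)
  let ?V = "L.module_relations (Y \<union> Z) (\<lambda>y. y)"
  have cd: "c \<in> carrier frees" "d \<in> carrier frees" by (rule rels_carrier[OF diff.hyps(1)], rule rels_carrier[OF diff.hyps(2)])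
  note cl = coef_closed[OF cd(1)] coef_closed[OF cd(2)]
  have 1: "hom_span (Y \<union> Z) ?V (\<lambda>y. coef y c)"
    by (rule hom_span_mono[OF _ _ _ Y(4)]) (use Y Z in auto)
  have 2: "hom_span (Y \<union> Z) ?V (\<lambda>y. coef y d)"
    by (rule hom_span_mono[OF _ _ _ Z(4)]) (use Y Z in auto)
  have "hom_span (Y \<union> Z) ?V (\<lambda>y. coef y c \<oplus>\<^bsub>S\<^esub> (\<ominus>\<^bsub>S\<^esub> \<one>\<^bsub>S\<^esub>) \<otimes>\<^bsub>S\<^esub> coef y d)"
    by (intro hom_span_add hom_span_smult L.module_relations_funcset 1 2) simp
  then have "hom_span (Y \<union> Z) ?V (\<lambda>y. coef y (c - d))"
    by (rule hom_span_cong) (simp add: coef_diff[OF cd] cl S.l_minus a_minus_def)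
  moreover have "coef y (c - d) = \<zero>\<^bsub>S\<^esub>" if "y \<in> carrier L - (Y \<union> Z)" for y
    using that Y(3) Z(3) by (simp add: coef_diff[OF cd] a_minus_def)
  ultimately show ?case using Y Z by (intro exI[of _ "Y \<union> Z"]) auto
next
  case (relator c)
  let ?\<delta> = "\<lambda>w y r. if y = w then r else \<zero>"
  show ?case
    using relator[unfolded tensor_relators_def Un_iff mem_Collect_eq]
  proof (elim disjE exE conjE, goal_cases)
    case (1 x y s)
    note 1 = 1(2-4,1)
    define Y where "Y = {x \<oplus>\<^bsub>L\<^esub> y, x, y}"
    have Y: "finite Y" "Y \<subseteq> carrier L" using 1 by (auto simp: Y_def)
    \<comment> \<open>The image of the relator is \<open>s\<close> times a relation in
      \<open>L\<close>. Indicator vectors are added and subtracted because \<open>x\<close>,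
      \<open>y\<close> and their sum may coincide.\<close>
    define \<kappa> where "\<kappa> z = (?\<delta> (x \<oplus>\<^bsub>L\<^esub> y) z \<one> \<ominus> (?\<delta> x z \<one> \<oplus> ?\<delta> y z \<one>))" for z
    have d: "(\<Oplus>\<^bsub>L\<^esub>z\<in>Y. ?\<delta> w z \<one> \<odot>\<^bsub>L\<^esub> z) = w" if "w \<in> Y" for w
      using L.finsum_smult_delta[OF Y(1) that, of "\<lambda>z. z" \<one>] Y(2) that by auto
    have "(\<Oplus>\<^bsub>L\<^esub>z\<in>Y. (?\<delta> x z \<one> \<oplus> ?\<delta> y z \<one>) \<odot>\<^bsub>L\<^esub> z)
      = (\<Oplus>\<^bsub>L\<^esub>z\<in>Y. ?\<delta> x z \<one> \<odot>\<^bsub>L\<^esub> z \<oplus>\<^bsub>L\<^esub> ?\<delta> y z \<one> \<odot>\<^bsub>L\<^esub> z)"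
      using Y(2) by (intro L.M.finsum_cong') (auto simp: L.smult_l_distr simp del: L.smult_one)
    also have "\<dots> = (\<Oplus>\<^bsub>L\<^esub>z\<in>Y. ?\<delta> x z \<one> \<odot>\<^bsub>L\<^esub> z) \<oplus>\<^bsub>L\<^esub> (\<Oplus>\<^bsub>L\<^esub>z\<in>Y. ?\<delta> y z \<one> \<odot>\<^bsub>L\<^esub> z)"
      using Y(2) by (intro L.M.finsum_addf) auto
    finally have sum: "(\<Oplus>\<^bsub>L\<^esub>z\<in>Y. (?\<delta> x z \<one> \<oplus> ?\<delta> y z \<one>) \<odot>\<^bsub>L\<^esub> z) = x \<oplus>\<^bsub>L\<^esub> y"
      using d[of x] d[of y] by (simp add: Y_def)
    have "\<kappa> \<in> L.module_relations Y (\<lambda>z. z)"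
      unfolding \<kappa>_def
      by (rule L.module_relations_minus[OF Y(1)])
        (use Y d[of "x \<oplus>\<^bsub>L\<^esub> y"] sum in \<open>auto simp: Y_def\<close>)
    from hom_span_single[OF L.module_relations_funcset this 1(3)]
    have "hom_span Y (L.module_relations Y (\<lambda>z. z)) (\<lambda>z. coef z c)"
    proof (rule hom_span_cong)
      fix z
      note f = frees_frag[OF _ 1(3)] 1(1,2)
      have "coef z c = (if x \<oplus>\<^bsub>L\<^esub> y = z then s else \<zero>\<^bsub>S\<^esub>) \<ominus>\<^bsub>S\<^esub> (if x = z then s else \<zero>\<^bsub>S\<^esub>)
          \<ominus>\<^bsub>S\<^esub> (if y = z then s else \<zero>\<^bsub>S\<^esub>)"
        using 1 coef_frag[of _ s z] by (simp add: coef_diff frees_frag frees_diff del: carrier_free_Abelian_group_iff)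
      then show "coef z c = h (\<kappa> z) \<otimes>\<^bsub>S\<^esub> s"
        using 1(3) by (auto simp: \<kappa>_def a_minus_def S.l_distr S.l_minus S.minus_add S.a_assoc)
    qed
    moreover have "coef z c = \<zero>\<^bsub>S\<^esub>" if "z \<in> carrier L - Y" for z
      using that 1 coef_frag[of _ s z] by (auto simp: Y_def a_minus_def coef_diff frees_frag frees_diff
          simp del: carrier_free_Abelian_group_iff)
    ultimately show ?thesis using Y by blast
  next
    case (2 x s t)
    note 2 = 2(2-4,1)
    \<comment> \<open>Additivity in the second factor already holds in the free
      \<open>S\<close>-module, so this relator has image zero.\<close>
    have "coef z c = (if x = z then s \<oplus>\<^bsub>S\<^esub> t else \<zero>\<^bsub>S\<^esub>) \<ominus>\<^bsub>S\<^esub> (if x = z then s else \<zero>\<^bsub>S\<^esub>)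
          \<ominus>\<^bsub>S\<^esub> (if x = z then t else \<zero>\<^bsub>S\<^esub>)" for z
      using 2 coef_frag[of x _ z] by (simp add: coef_diff frees_frag frees_diff del: carrier_free_Abelian_group_iff)
    moreover have "s \<oplus>\<^bsub>S\<^esub> t \<ominus>\<^bsub>S\<^esub> s \<ominus>\<^bsub>S\<^esub> t = \<zero>\<^bsub>S\<^esub>" using 2(2,3) by algebra
    ultimately have "coef z c = \<zero>\<^bsub>S\<^esub>" for z by (simp add: a_minus_def)
    then show ?thesis by (intro exI[of _ "{}"]) (auto intro: hom_span.zero)
  next
    case (3 r x s)
    note 3 = 3(2-4,1)
    define Y where "Y = {r \<odot>\<^bsub>L\<^esub> x, x}"
    have Y: "finite Y" "Y \<subseteq> carrier L" using 3 by (auto simp: Y_def)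
    define \<kappa> where "\<kappa> z = (?\<delta> (r \<odot>\<^bsub>L\<^esub> x) z \<one> \<ominus> ?\<delta> x z r)" for z
    have "(\<Oplus>\<^bsub>L\<^esub>z\<in>Y. ?\<delta> (r \<odot>\<^bsub>L\<^esub> x) z \<one> \<odot>\<^bsub>L\<^esub> z) = \<one> \<odot>\<^bsub>L\<^esub> (r \<odot>\<^bsub>L\<^esub> x)"
      using Y by (intro L.finsum_smult_delta) (auto simp: Y_def)
    moreover have "(\<Oplus>\<^bsub>L\<^esub>z\<in>Y. ?\<delta> x z r \<odot>\<^bsub>L\<^esub> z) = r \<odot>\<^bsub>L\<^esub> x"
      using Y 3 by (intro L.finsum_smult_delta) (auto simp: Y_def)
    ultimately have sum: "(\<Oplus>\<^bsub>L\<^esub>z\<in>Y. ?\<delta> (r \<odot>\<^bsub>L\<^esub> x) z \<one> \<odot>\<^bsub>L\<^esub> z) = (\<Oplus>\<^bsub>L\<^esub>z\<in>Y. ?\<delta> x z r \<odot>\<^bsub>L\<^esub> z)"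
      using 3 by simp
    have "\<kappa> \<in> L.module_relations Y (\<lambda>z. z)"
      unfolding \<kappa>_def by (rule L.module_relations_minus[OF Y(1) _ _ _ sum]) (use Y 3 in auto)
    from hom_span_single[OF L.module_relations_funcset this 3(3)]
    have "hom_span Y (L.module_relations Y (\<lambda>z. z)) (\<lambda>z. coef z c)"
    proof (rule hom_span_cong)
      fix z
      have "coef z c = (if r \<odot>\<^bsub>L\<^esub> x = z then s else \<zero>\<^bsub>S\<^esub>) \<ominus>\<^bsub>S\<^esub> (if x = z then h r \<otimes>\<^bsub>S\<^esub> s else \<zero>\<^bsub>S\<^esub>)"
        using 3 coef_frag[of _ _ z] by (simp add: coef_diff frees_frag del: carrier_free_Abelian_group_iff)
      then show "coef z c = h (\<kappa> z) \<otimes>\<^bsub>S\<^esub> s"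
        using 3(1,3) by (auto simp: \<kappa>_def a_minus_def S.l_distr S.l_minus)
    qed
    moreover have "coef z c = \<zero>\<^bsub>S\<^esub>" if "z \<in> carrier L - Y" for z
      using that 3 coef_frag[of _ _ z] by (auto simp: Y_def a_minus_def coef_diff frees_frag
          simp del: carrier_free_Abelian_group_iff)
    ultimately show ?thesis using Y by blast
  qed
qed

end

context base_change_module
begin

text \<open>Relations on \<open>A\<close> are the kernel of the \<open>j\<close>-th coordinate on
  relations on \<open>insert j A\<close>, and flatness preserves kernels. Concretely,
  \<open>t\<close> is a relation between the entries \<open>c k j\<close>; lifting it combines the
  \<open>c k\<close> into relations that vanish at \<open>j\<close>.\<close>

lemma hom_span_drop:
  assumes flat and A: "finite A" "j \<notin> A" and x: "\<And>i. i \<in> insert j A \<Longrightarrow> x i \<in> carrier L"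
    and s: "hom_span (insert j A) (L.module_relations (insert j A) x) s" and sj: "s j = \<zero>\<^bsub>S\<^esub>"
  shows "hom_span A (L.module_relations A x) s"
proof -
  from hom_span_imp_sum[OF L.module_relations_funcset s]
  obtain m :: nat and c t where ct: "\<forall>k<m. c k \<in> L.module_relations (insert j A) x \<and> t k \<in> carrier S"
    and si: "\<forall>i\<in>insert j A. s i = (\<Oplus>\<^bsub>S\<^esub>k\<in>{..<m}. h (c k i) \<otimes>\<^bsub>S\<^esub> t k)" by (elim exE conjE)
  have ck: "c k i \<in> carrier R" if "k \<in> {..<m}" "i \<in> insert j A" for k i
  proof -
    have "c k \<in> insert j A \<rightarrow> carrier R" using ct that(1) by (simp add: L.module_relations_def)
    then show ?thesis using that(2) by (rule funcset_mem)
  qed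
  have crel: "(\<Oplus>\<^bsub>L\<^esub>i\<in>insert j A. c k i \<odot>\<^bsub>L\<^esub> x i) = \<zero>\<^bsub>L\<^esub>" if "k \<in> {..<m}" for k
    using ct that by (simp add: L.module_relations_def)
  have t: "t \<in> {..<m} \<rightarrow> carrier S" using ct by auto
  have cj: "(\<lambda>k. c k j) \<in> {..<m} \<rightarrow> carrier R" using ck by auto
  have "(\<Oplus>\<^bsub>S\<^esub>k\<in>{..<m}. h (c k j) \<otimes>\<^bsub>S\<^esub> t k) = \<zero>\<^bsub>S\<^esub>" using si sj by simp
  moreover have "relations_lift {..<m} (\<lambda>k. c k j)"
    using \<open>flat\<close> cj unfolding flat_def by simp
  ultimately have "hom_span {..<m} (R.relations {..<m} (\<lambda>k. c k j)) t"
    using relations_liftD t by blast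
  then have "hom_span A (L.module_relations A x) (\<lambda>i. \<Oplus>\<^bsub>S\<^esub>k\<in>{..<m}. h (c k i) \<otimes>\<^bsub>S\<^esub> t k)"
  proof (rule hom_span_push[OF finite_lessThan R.relations_funcset, rotated -1])
    show "c k i \<in> carrier R" if "k \<in> {..<m}" "i \<in> A" for k i using ck that by simp
    fix e assume e: "e \<in> R.relations {..<m} (\<lambda>k. c k j)"
    have ek: "e k \<in> carrier R" if "k \<in> {..<m}" for k
      using subsetD[OF R.relations_funcset e] that by auto
    define d where "d i = (\<Oplus>k\<in>{..<m}. c k i \<otimes> e k)" for i
    have dc: "d i \<in> carrier R" if "i \<in> insert j A" for i
      unfolding d_def using ck[OF _ that] ek by (intro R.finsum_closed) auto
    have dj: "d j = \<zero>" using e by (simp add: d_def R.relations_def)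
    have "(\<Oplus>\<^bsub>L\<^esub>i\<in>insert j A. d i \<odot>\<^bsub>L\<^esub> x i)
      = (\<Oplus>\<^bsub>L\<^esub>k\<in>{..<m}. e k \<odot>\<^bsub>L\<^esub> (\<Oplus>\<^bsub>L\<^esub>i\<in>insert j A. c k i \<odot>\<^bsub>L\<^esub> x i))"
      unfolding d_def using A(1) x ek ck by (intro L.finsum_smult_swap) auto
    also have "\<dots> = \<zero>\<^bsub>L\<^esub>" using crel ek by (intro L.M.add.finprod_one_eqI) simp
    finally have "(\<Oplus>\<^bsub>L\<^esub>i\<in>insert j A. d i \<odot>\<^bsub>L\<^esub> x i) = \<zero>\<^bsub>L\<^esub>" .
    moreover have "(\<Oplus>\<^bsub>L\<^esub>i\<in>insert j A. d i \<odot>\<^bsub>L\<^esub> x i) = d j \<odot>\<^bsub>L\<^esub> x j \<oplus>\<^bsub>L\<^esub> (\<Oplus>\<^bsub>L\<^esub>i\<in>A. d i \<odot>\<^bsub>L\<^esub> x i)"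
      using A dc x by (intro L.M.finsum_insert) auto
    moreover have "(\<Oplus>\<^bsub>L\<^esub>i\<in>A. d i \<odot>\<^bsub>L\<^esub> x i) \<in> carrier L"
      using dc x by (intro L.M.finsum_closed) auto
    ultimately have "(\<Oplus>\<^bsub>L\<^esub>i\<in>A. d i \<odot>\<^bsub>L\<^esub> x i) = \<zero>\<^bsub>L\<^esub>" using dj x by simp
    then show "(\<lambda>i. \<Oplus>k\<in>{..<m}. c k i \<otimes> e k) \<in> L.module_relations A x"
      using dc by (simp add: L.module_relations_def d_def[symmetric])
  qed
  then show ?thesis by (rule hom_span_cong) (use si in simp)
qed

lemma hom_span_restrict:
  assumes flat and "finite D" and A: "finite A" "A \<inter> D = {}"
    and x: "\<And>i. i \<in> A \<union> D \<Longrightarrow> x i \<in> carrier L"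
    and "hom_span (A \<union> D) (L.module_relations (A \<union> D) x) s" "\<And>i. i \<in> D \<Longrightarrow> s i = \<zero>\<^bsub>S\<^esub>"
  shows "hom_span A (L.module_relations A x) s"
  using assms(2,4-7)
proof (induction D)
  case empty
  then show ?case by simp
next
  case (insert j D)
  have "hom_span (A \<union> D) (L.module_relations (A \<union> D) x) s"
    by (rule hom_span_drop[OF \<open>flat\<close>, of _ j])
      (use insert.prems insert.hyps A(1) in auto)
  then show ?case using insert by auto
qed

text \<open>\<open>coef_rels\<close> yields relations on an unknown finite subset of
  \<open>L\<close>, indexed by the elements themselves. Flatness cuts it down to the elements that
  occur, and a section of \<open>x\<close> leads back to the index set \<open>A\<close>, where
  values may repeat.\<close>

lemma comb_mem_rels_only_if:
  assumes flat and A: "finite A" and x: "\<And>i. i \<in> A \<Longrightarrow> x i \<in> carrier L"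
    and s: "\<And>i. i \<in> A \<Longrightarrow> s i \<in> carrier S" and rels: "comb A x s \<in> rels"
  shows "hom_span A (L.module_relations A x) s"
proof -
  define B where "B = x ` A"
  define t where "t y = (\<Oplus>\<^bsub>S\<^esub>i\<in>A. if x i = y then s i else \<zero>\<^bsub>S\<^esub>)" for y
  have tc: "t y \<in> carrier S" for y unfolding t_def using s by (intro S.finsum_closed) auto
  have coef_t: "coef y (comb A x s) = t y" for y using coef_comb[OF A x s] by (simp add: t_def)
  have t0: "t y = \<zero>\<^bsub>S\<^esub>" if "y \<notin> B" for y
    unfolding t_def using that by (intro S.add.finprod_one_eqI) (auto simp: B_def)
  obtain Y where Y: "finite Y" "Y \<subseteq> carrier L" "\<forall>y\<in>carrier L - Y. t y = \<zero>\<^bsub>S\<^esub>"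
    "hom_span Y (L.module_relations Y (\<lambda>y. y)) t"
    using coef_rels[OF rels] unfolding coef_t by (elim exE conjE)
  have B: "finite B" "B \<subseteq> carrier L" using A x by (auto simp: B_def)
  have Z: "B \<union> (Y - B) = B \<union> Y" by auto
  have "hom_span (B \<union> Y) (L.module_relations (B \<union> Y) (\<lambda>y. y)) t"
    by (rule hom_span_mono[OF _ _ _ Y(4)]) (use Y B in auto)
  then have tB: "hom_span B (L.module_relations B (\<lambda>y. y)) t"
    by (intro hom_span_restrict[OF \<open>flat\<close>, of "Y - B" B]) (use Y B t0 in \<open>auto simp: Z\<close>)
  \<comment> \<open>One chosen index per value. The vector \<open>s\<close> is the collected
    coefficients \<open>t\<close>, placed at the chosen indices, plus \<open>s i\<close> times the
    difference of the unit vectors at \<open>i\<close> and \<open>\<sigma> (x i)\<close>, summed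
    over \<open>i\<close>. These differences are relations.\<close>
  define \<sigma> where "\<sigma> = inv_into A x"
  have \<sigma>: "\<sigma> y \<in> A" "x (\<sigma> y) = y" if "y \<in> B" for y
    using that by (auto simp: \<sigma>_def B_def inv_into_into f_inv_into_f)
  have xB: "x i \<in> B" if "i \<in> A" for i using that by (simp add: B_def)
  define H where "H y i = (if i = \<sigma> y then \<one> else \<zero>)" for y i
  have "hom_span A (L.module_relations A x) (\<lambda>i. \<Oplus>\<^bsub>S\<^esub>y\<in>B. h (H y i) \<otimes>\<^bsub>S\<^esub> t y)"
  proof (rule hom_span_push[OF B(1) L.module_relations_funcset _ _ tB])
    show "H y i \<in> carrier R" for y i by (simp add: H_def)
    fix c assume c: "c \<in> L.module_relations B (\<lambda>y. y)"
    have cy: "c y \<in> carrier R" if "y \<in> B" for y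
      using subsetD[OF L.module_relations_funcset c] that by auto
    have Hx: "(\<Oplus>\<^bsub>L\<^esub>i\<in>A. H y i \<odot>\<^bsub>L\<^esub> x i) = y" if "y \<in> B" for y
      unfolding H_def using L.finsum_smult_delta[OF A \<sigma>(1)[OF that] x R.one_closed] \<sigma>(2)[OF that] B that
      by auto
    have "(\<Oplus>\<^bsub>L\<^esub>y\<in>B. c y \<odot>\<^bsub>L\<^esub> (\<Oplus>\<^bsub>L\<^esub>i\<in>A. H y i \<odot>\<^bsub>L\<^esub> x i)) = (\<Oplus>\<^bsub>L\<^esub>y\<in>B. c y \<odot>\<^bsub>L\<^esub> y)"
      using cy B Hx by (intro L.M.finsum_cong') auto
    then have "c \<in> L.module_relations B (\<lambda>y. \<Oplus>\<^bsub>L\<^esub>i\<in>A. H y i \<odot>\<^bsub>L\<^esub> x i)"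
      using c by (simp add: L.module_relations_def)
    then show "(\<lambda>i. \<Oplus>y\<in>B. H y i \<otimes> c y) \<in> L.module_relations A x"
      by (intro L.module_relations_push A B x) (auto simp: H_def)
  qed
  moreover have "hom_span A (L.module_relations A x)
      (\<lambda>k. \<Oplus>\<^bsub>S\<^esub>i\<in>A. h ((if k = i then \<one> else \<zero>) \<ominus> (if k = \<sigma> (x i) then \<one> else \<zero>)) \<otimes>\<^bsub>S\<^esub> s i)"
  proof (intro hom_span_sum hom_span_single L.module_relations_funcset s)
    fix i assume i: "i \<in> A"
    note \<sigma>i = \<sigma>[OF xB[OF i]]
    show "(\<lambda>k. (if k = i then \<one> else \<zero>) \<ominus> (if k = \<sigma> (x i) then \<one> else \<zero>)) \<in> L.module_relations A x"
      using L.finsum_smult_delta[OF A i x R.one_closed] L.finsum_smult_delta[OF A \<sigma>i(1) x R.one_closed]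
      by (intro L.module_relations_minus A x) (auto simp: \<sigma>i(2))
  qed
  ultimately have "hom_span A (L.module_relations A x) (\<lambda>k. (\<Oplus>\<^bsub>S\<^esub>y\<in>B. h (H y k) \<otimes>\<^bsub>S\<^esub> t y) \<oplus>\<^bsub>S\<^esub>
      (\<Oplus>\<^bsub>S\<^esub>i\<in>A. h ((if k = i then \<one> else \<zero>) \<ominus> (if k = \<sigma> (x i) then \<one> else \<zero>)) \<otimes>\<^bsub>S\<^esub> s i))"
    by (rule hom_span_add[OF L.module_relations_funcset])
  then show ?thesis
  proof (rule hom_span_cong)
    fix k assume k: "k \<in> A"
    define f where "f i = (if k = \<sigma> (x i) then s i else \<zero>\<^bsub>S\<^esub>)" for i
    have fc: "f i \<in> carrier S" if "i \<in> A" for i using s that by (simp add: f_def)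
    have "(\<Oplus>\<^bsub>S\<^esub>y\<in>B. h (H y k) \<otimes>\<^bsub>S\<^esub> t y)
      = (\<Oplus>\<^bsub>S\<^esub>y\<in>B. \<Oplus>\<^bsub>S\<^esub>i\<in>A. if y = x i then f i else \<zero>\<^bsub>S\<^esub>)"
    proof (rule S.finsum_cong')
      fix y assume y: "y \<in> B"
      have "h (H y k) \<otimes>\<^bsub>S\<^esub> t y = (\<Oplus>\<^bsub>S\<^esub>i\<in>A. h (H y k) \<otimes>\<^bsub>S\<^esub> (if x i = y then s i else \<zero>\<^bsub>S\<^esub>))"
        unfolding t_def using s A by (intro S.finsum_rdistr) (auto simp: H_def)
      also have "\<dots> = (\<Oplus>\<^bsub>S\<^esub>i\<in>A. if y = x i then f i else \<zero>\<^bsub>S\<^esub>)"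
        using s by (intro S.finsum_cong') (auto simp: H_def f_def)
      finally show "h (H y k) \<otimes>\<^bsub>S\<^esub> t y = (\<Oplus>\<^bsub>S\<^esub>i\<in>A. if y = x i then f i else \<zero>\<^bsub>S\<^esub>)" .
    qed (use fc in \<open>auto intro!: S.finsum_closed\<close>)
    also have "\<dots> = (\<Oplus>\<^bsub>S\<^esub>i\<in>A. \<Oplus>\<^bsub>S\<^esub>y\<in>B. if y = x i then f i else \<zero>\<^bsub>S\<^esub>)"
      using fc A B by (intro S.finsum_swap) auto
    also have "\<dots> = (\<Oplus>\<^bsub>S\<^esub>i\<in>A. f i)"
      using fc B xB by (intro S.finsum_cong' S.finsum_delta) auto
    finally have 1: "(\<Oplus>\<^bsub>S\<^esub>y\<in>B. h (H y k) \<otimes>\<^bsub>S\<^esub> t y) = (\<Oplus>\<^bsub>S\<^esub>i\<in>A. f i)" .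
    let ?g = "\<lambda>i. h ((if k = i then \<one> else \<zero>) \<ominus> (if k = \<sigma> (x i) then \<one> else \<zero>)) \<otimes>\<^bsub>S\<^esub> s i"
    have "(\<Oplus>\<^bsub>S\<^esub>i\<in>A. f i) \<oplus>\<^bsub>S\<^esub> (\<Oplus>\<^bsub>S\<^esub>i\<in>A. ?g i) = (\<Oplus>\<^bsub>S\<^esub>i\<in>A. f i \<oplus>\<^bsub>S\<^esub> ?g i)"
      using fc s by (intro S.finsum_addf[symmetric]) auto
    also have "\<dots> = (\<Oplus>\<^bsub>S\<^esub>i\<in>A. if i = k then s i else \<zero>\<^bsub>S\<^esub>)"
      using s by (intro S.finsum_cong') (auto simp: f_def a_minus_def S.l_minus S.l_distr S.r_neg S.a_ac)
    also have "\<dots> = (\<Oplus>\<^bsub>S\<^esub>i\<in>A. if i = k then s k else \<zero>\<^bsub>S\<^esub>)"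
      using s k by (intro S.finsum_cong') auto
    also have "\<dots> = s k" using A k s by (intro S.finsum_delta) auto
    finally show "s k = (\<Oplus>\<^bsub>S\<^esub>y\<in>B. h (H y k) \<otimes>\<^bsub>S\<^esub> t y) \<oplus>\<^bsub>S\<^esub> (\<Oplus>\<^bsub>S\<^esub>i\<in>A. ?g i)" unfolding 1 ..
  qed
qed

lemma comb_mem_rels_iff:
  assumes flat "finite A" "\<And>i. i \<in> A \<Longrightarrow> x i \<in> carrier L" "\<And>i. i \<in> A \<Longrightarrow> s i \<in> carrier S"
  shows "comb A x s \<in> rels \<longleftrightarrow> hom_span A (L.module_relations A x) s"
proof
  show "hom_span A (L.module_relations A x) s" if "comb A x s \<in> rels"
    by (rule comb_mem_rels_only_if[OF assms that])
  show "comb A x s \<in> rels" if "hom_span A (L.module_relations A x) s"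
    by (rule comb_mem_rels_if[OF assms(2,3) that])
qed

lemma comb_uminus:
  assumes "\<And>i. i \<in> A \<Longrightarrow> x i \<in> carrier L" "\<And>i. i \<in> A \<Longrightarrow> s i \<in> carrier S"
  shows "comb A x (\<lambda>i. \<ominus>\<^bsub>S\<^esub> s i) + comb A x s \<in> rels"
proof -
  have 1: "comb A x (\<lambda>i. \<ominus>\<^bsub>S\<^esub> s i \<oplus>\<^bsub>S\<^esub> s i) - comb A x (\<lambda>i. \<ominus>\<^bsub>S\<^esub> s i) - comb A x s \<in> rels"
    using assms by (intro comb_add) auto
  have 2: "comb A x (\<lambda>i. \<ominus>\<^bsub>S\<^esub> s i \<oplus>\<^bsub>S\<^esub> s i) \<in> rels"
    unfolding comb_def using assms by (intro rels_sum) (simp add: S.l_neg tensor_zero_right)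
  show ?thesis using rels_diff[OF 2 1] by (simp add: add.commute)
qed

lemma comb_minus:
  assumes "\<And>i. i \<in> A \<Longrightarrow> x i \<in> carrier L" "\<And>i. i \<in> A \<Longrightarrow> s i \<in> carrier S" "\<And>i. i \<in> A \<Longrightarrow> t i \<in> carrier S"
  shows "comb A x s - comb A x t - comb A x (\<lambda>i. s i \<ominus>\<^bsub>S\<^esub> t i) \<in> rels"
proof -
  have "comb A x (\<lambda>i. s i \<oplus>\<^bsub>S\<^esub> \<ominus>\<^bsub>S\<^esub> t i) - comb A x s - comb A x (\<lambda>i. \<ominus>\<^bsub>S\<^esub> t i) \<in> rels"
    using assms by (intro comb_add) auto
  from rels_uminus[OF rels_add[OF this comb_uminus[of A x t]]]
  show ?thesis using assms by (simp add: a_minus_def algebra_simps)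
qed

lemma comb_exists:
  assumes "c \<in> carrier frees"
  shows "\<exists>(n :: nat) x s. (\<forall>i<n. x i \<in> carrier L \<and> s i \<in> carrier S) \<and> c - comb {..<n} x s \<in> rels"
proof -
  have "Poly_Mapping.keys c \<subseteq> carrier L \<times> carrier S" using assms by simp
  then show ?thesis
  proof (induction rule: free_Abelian_group_induct[consumes 1])
    case 1
    show ?case by (intro exI[of _ 0]) (simp add: comb_def rels_zero)
  next
    case (2 c d)
    obtain n x s where n: "\<forall>i<n. x i \<in> carrier L \<and> s i \<in> carrier S" "c - comb {..<n :: nat} x s \<in> rels"
      using 2(3) by (elim exE conjE)
    obtain m y t where m: "\<forall>i<m. y i \<in> carrier L \<and> t i \<in> carrier S" "d - comb {..<m :: nat} y t \<in> rels"
      using 2(4) by (elim exE conjE)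
    define w where "w i = (if i < n then x i else y (i - n))" for i
    \<comment> \<open>The induction for free abelian groups joins elements by subtraction, hence the
      sign.\<close>
    define r where "r i = (if i < n then s i else \<ominus>\<^bsub>S\<^esub> t (i - n))" for i
    have "comb {..<n + m} w r = comb {..<n} w r + comb {n..<n + m} w r"
      unfolding comb_def by (subst sum.union_disjoint[symmetric]) (auto intro!: sum.cong)
    also have "comb {n..<n + m} w r = comb {..<m} y (\<lambda>i. \<ominus>\<^bsub>S\<^esub> t i)"
      unfolding comb_def using sum.shift_bounds_nat_ivl[of "\<lambda>i. frag_of (w i, r i)" 0 n m]
      by (simp add: w_def r_def lessThan_atLeast0 add.commute)
    also have "comb {..<n} w r = comb {..<n} x s"
      unfolding comb_def by (intro sum.cong) (auto simp: w_def r_def)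
    finally have eq: "comb {..<n + m} w r = comb {..<n} x s + comb {..<m} y (\<lambda>i. \<ominus>\<^bsub>S\<^esub> t i)" .
    have "comb {..<m} y (\<lambda>i. \<ominus>\<^bsub>S\<^esub> t i) + comb {..<m} y t \<in> rels" using m by (intro comb_uminus) auto
    from rels_diff[OF rels_diff[OF n(2) m(2)] this]
    have "c - d - comb {..<n + m} w r \<in> rels" unfolding eq by (simp add: algebra_simps)
    moreover have "\<forall>i<n + m. w i \<in> carrier L \<and> r i \<in> carrier S"
      using n(1) m(1) by (auto simp: w_def r_def)
    ultimately show ?case by blast
  next
    case (3 z)
    then show ?case
      by (intro exI[of _ 1] exI[of _ "\<lambda>_. fst z"] exI[of _ "\<lambda>_. snd z"])
        (auto simp: comb_def rels_zero)
  qed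
qed

text \<open>The action of \<open>S\<close> on representatives that underlies \<open>smult\<close> of
  \<open>base_change\<close>.\<close>

definition scale where "scale a = frag_extend (\<lambda>(x, t). frag_of (x, a \<otimes>\<^bsub>S\<^esub> t))"

lemma scale_frag [simp]: "scale a (frag_of (x, s)) = frag_of (x, a \<otimes>\<^bsub>S\<^esub> s)"
  by (simp add: scale_def)

lemma scale_diff: "scale a (c - d) = scale a c - scale a d"
  by (simp add: scale_def frag_extend_diff)

lemma scale_add: "scale a (c + d) = scale a c + scale a d"
  by (simp add: scale_def frag_extend_add)

lemma scale_comb: "finite A \<Longrightarrow> scale a (comb A x s) = comb A x (\<lambda>i. a \<otimes>\<^bsub>S\<^esub> s i)"
  by (simp add: scale_def comb_def frag_extend_sum)

lemma scale_closed:
  assumes "a \<in> carrier S" "c \<in> carrier frees"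
  shows "scale a c \<in> carrier frees"
proof -
  have "Poly_Mapping.keys (scale a c) \<subseteq> (\<Union>z\<in>Poly_Mapping.keys c. {(fst z, a \<otimes>\<^bsub>S\<^esub> snd z)})"
    unfolding scale_def using keys_frag_extend[of "\<lambda>(x, t). frag_of (x, a \<otimes>\<^bsub>S\<^esub> t)" c]
    by (simp add: split_def keys_frag_of)
  also have "\<dots> \<subseteq> carrier L \<times> carrier S" using assms by auto
  finally show ?thesis by simp
qed

lemma scale_rels:
  assumes a: "a \<in> carrier S" and "c \<in> rels"
  shows "scale a c \<in> rels"
  using assms(2)
proof (induction rule: rels_induct)
  case zero
  then show ?case by (simp add: scale_def rels_zero)
next
  case (diff c d)
  then show ?case by (simp add: scale_diff rels_diff)
next
  case (relator c)
  show ?case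
    using relator[unfolded tensor_relators_def Un_iff mem_Collect_eq]
  proof (elim disjE exE conjE, goal_cases)
    case (1 x y s)
    then show ?case using a tensor_add_left[of x y "a \<otimes>\<^bsub>S\<^esub> s"] by (simp add: scale_diff)
  next
    case (2 x s t)
    then show ?case
      using a tensor_add_right[of x "a \<otimes>\<^bsub>S\<^esub> s" "a \<otimes>\<^bsub>S\<^esub> t"] by (simp add: scale_diff S.r_distr)
  next
    case (3 r x s)
    then show ?case
      using a tensor_smult[of r x "a \<otimes>\<^bsub>S\<^esub> s"] by (simp add: scale_diff S.m_lcomm)
  qed
qed

text \<open>By \<open>annihilator_coset\<close>, this is the annihilator of the class of
  \<open>c\<close> in the tensor product.\<close>

definition ann where "ann c = {a \<in> carrier S. scale a c \<in> rels}"

lemma ann_cong: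
  assumes "c - d \<in> rels"
  shows "ann c = ann d"
proof -
  have "scale a c \<in> rels \<longleftrightarrow> scale a d \<in> rels" if a: "a \<in> carrier S" for a
  proof -
    have "scale a c - scale a d \<in> rels" using scale_rels[OF a assms] by (simp add: scale_diff)
    then show ?thesis using rels_add[of "scale a c - scale a d" "scale a d"]
        rels_diff[of "scale a c" "scale a c - scale a d"] by auto
  qed
  then show ?thesis by (auto simp: ann_def)
qed

lemma mem_ann_comb:
  assumes flat "finite A" "\<And>i. i \<in> A \<Longrightarrow> x i \<in> carrier L" "\<And>i. i \<in> A \<Longrightarrow> s i \<in> carrier S"
  shows "a \<in> ann (comb A x s) \<longleftrightarrow>
    a \<in> carrier S \<and> hom_span A (L.module_relations A x) (\<lambda>i. a \<otimes>\<^bsub>S\<^esub> s i)"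
proof -
  have "a \<in> carrier S \<Longrightarrow> comb A x (\<lambda>i. a \<otimes>\<^bsub>S\<^esub> s i) \<in> rels \<longleftrightarrow>
      hom_span A (L.module_relations A x) (\<lambda>i. a \<otimes>\<^bsub>S\<^esub> s i)"
    by (rule comb_mem_rels_iff[OF assms(1-3)]) (simp_all add: assms(4))
  then show ?thesis unfolding ann_def scale_comb[OF assms(2)] by blast
qed

abbreviation "BC \<equiv> base_change R S h L"

text \<open>\<open>rels\<close> is stable under \<open>scale\<close>, so the union in the definition
  of \<open>base_change\<close> runs over equal cosets.\<close>

lemma coset_scale:
  assumes "a \<in> carrier S" "c \<in> carrier frees"
  shows "a \<odot>\<^bsub>BC\<^esub> (rels #>\<^bsub>frees\<^esub> c) = rels #>\<^bsub>frees\<^esub> scale a c"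
proof -
  interpret F: group frees by (rule group_free_Abelian_group)
  have const: "rels #>\<^bsub>frees\<^esub> scale a d = rels #>\<^bsub>frees\<^esub> scale a c" if "d \<in> rels #>\<^bsub>frees\<^esub> c" for d
  proof -
    obtain k where k: "k \<in> rels" "d = k + c" using \<open>d \<in> _\<close> by (auto simp: r_coset_def)
    have "scale a d \<in> rels #>\<^bsub>frees\<^esub> scale a c"
      using scale_rels[OF assms(1) k(1)] by (auto simp: r_coset_def k(2) scale_add)
    then show ?thesis
      using F.repr_independence[OF _ scale_closed[OF assms] rels_subgroup] by simp
  qed
  have "a \<odot>\<^bsub>BC\<^esub> (rels #>\<^bsub>frees\<^esub> c) = (\<Union>d\<in>rels #>\<^bsub>frees\<^esub> c. rels #>\<^bsub>frees\<^esub> scale a d)"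
    by (simp only: base_change_def Let_def scale_def module.select_convs)
  also have "\<dots> = rels #>\<^bsub>frees\<^esub> scale a c"
    using F.rcos_self[OF assms(2) rels_subgroup] const by (intro UN_constant_eq ballI)
  finally show ?thesis .
qed

lemma annihilator_coset:
  assumes "c \<in> carrier frees"
  shows "annihilator S BC (rels #>\<^bsub>frees\<^esub> c) = ann c"
proof -
  interpret F: group frees by (rule group_free_Abelian_group)
  have zero: "\<zero>\<^bsub>BC\<^esub> = rels" by (simp add: base_change_def Let_def FactGroup_def)
  have "rels #>\<^bsub>frees\<^esub> d = rels \<longleftrightarrow> d \<in> rels" if "d \<in> carrier frees" for d
    using F.coset_join1[OF _ that rels_subgroup] F.coset_join2[OF that rels_subgroup]
      subgroup.subset[OF rels_subgroup] by blast
  then show ?thesis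
    using coset_scale[OF _ assms] scale_closed[OF _ assms]
    by (auto simp: annihilator_def ann_def zero simp del: carrier_free_Abelian_group_iff)
qed

lemma base_change_carrier: "carrier BC = (\<lambda>c. rels #>\<^bsub>frees\<^esub> c) ` carrier frees"
  by (auto simp: base_change_def Let_def FactGroup_def RCOSETS_def)

lemma strong_krull_base_change_iff:
  "P \<in> strong_krull_primes S BC \<longleftrightarrow> primeideal P S \<and>
    (\<forall>I. fg_ideal I S \<and> I \<subseteq> P \<longrightarrow> (\<exists>c\<in>carrier frees. I \<subseteq> ann c \<and> ann c \<subseteq> P))"
  unfolding strong_krull_primes_def base_change_carrier by (simp add: annihilator_coset del: carrier_free_Abelian_group_iff)

end

section \<open>Strong Krull primes of a cyclic module\<close>

lemma (in cring) annihilator_quotient: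
  assumes J: "ideal J R" and s: "s \<in> carrier R"
  shows "annihilator R (quotient_module R J) (J +> s) = colon J s"
proof -
  interpret J: ideal J R by fact
  have "a \<odot>\<^bsub>quotient_module R J\<^esub> (J +> s) = J +> (a \<otimes> s)" if "a \<in> carrier R" for a
    using that s J.rcoset_mult_add[of a s]
    by (simp add: quotient_module_def ring.extend_def FactRing_def)
  moreover have "\<zero>\<^bsub>quotient_module R J\<^esub> = J"
    by (simp add: quotient_module_def ring.extend_def FactRing_def)
  moreover have "J +> r = J \<longleftrightarrow> r \<in> J" if "r \<in> carrier R" for r
    using that a_coset_join1[OF _ that J.a_subgroup] a_coset_join2[OF that J.a_subgroup]
      J.a_subset by blast
  ultimately have "a \<odot>\<^bsub>quotient_module R J\<^esub> (J +> s) = \<zero>\<^bsub>quotient_module R J\<^esub> \<longleftrightarrow> a \<otimes> s \<in> J"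
    if "a \<in> carrier R" for a using that s by simp
  then show ?thesis unfolding annihilator_def colon_def by blast
qed

lemma (in cring) strong_krull_quotient_iff:
  assumes J: "ideal J R"
  shows "P \<in> strong_krull_primes R (quotient_module R J) \<longleftrightarrow> primeideal P R \<and>
    (\<forall>I. fg_ideal I R \<and> I \<subseteq> P \<longrightarrow> (\<exists>s\<in>carrier R. I \<subseteq> colon J s \<and> colon J s \<subseteq> P))"
proof -
  have "carrier (quotient_module R J) = (\<lambda>s. J +> s) ` carrier R"
    by (auto simp: quotient_module_def ring.extend_def FactRing_def A_RCOSETS_def' a_r_coset_def)
  then show ?thesis
    unfolding strong_krull_primes_def by (simp add: annihilator_quotient[OF J])
qed

context base_change_module
begin

lemma hom_span_mem_ideal:
  assumes q: "q \<subseteq> carrier R" and "hom_span A V f" and V: "\<And>c. c \<in> V \<Longrightarrow> c i \<in> q" and i: "i \<in> A"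
  shows "f i \<in> Idl\<^bsub>S\<^esub> (h ` q)"
  using assms(2)
proof (induction rule: hom_span.induct)
  have hq: "h ` q \<subseteq> carrier S" using q by auto
  note J = S.genideal_ideal[OF hq]
  {
    case (zero s)
    then show ?case using S.idealD(2)[OF J] i by simp
  next
    case (add s c t s')
    have "h (c i) \<in> Idl\<^bsub>S\<^esub> (h ` q)" using V[OF add.hyps(2)] S.genideal_self[OF hq] by auto
    then show ?case using add i S.idealD(3,7)[OF J] by simp
  }
qed

lemma hom_span_of_mem_ideal:
  assumes q: "q \<subseteq> carrier R" and A: "finite A" and x: "\<And>i. i \<in> A \<Longrightarrow> x i \<in> carrier L"
    and kill: "\<And>r i. r \<in> q \<Longrightarrow> i \<in> A \<Longrightarrow> r \<odot>\<^bsub>L\<^esub> x i = \<zero>\<^bsub>L\<^esub>"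
    and f: "\<And>i. i \<in> A \<Longrightarrow> f i \<in> Idl\<^bsub>S\<^esub> (h ` q)"
  shows "hom_span A (L.module_relations A x) f"
proof -
  note mrel = L.module_relations_funcset
  have hq: "h ` q \<subseteq> carrier S" using q by auto
  have fc: "f i \<in> carrier S" if "i \<in> A" for i
    using S.idealD(8)[OF S.genideal_ideal[OF hq] f[OF that]] .
  have unit: "hom_span A (L.module_relations A x) (\<lambda>k. if k = i then f i else \<zero>\<^bsub>S\<^esub>)" if i: "i \<in> A" for i
  proof -
    \<comment> \<open>The values admissible in a vector supported at \<open>i\<close> form an ideal
      of \<open>S\<close>. It contains the image of \<open>q\<close>, because \<open>q\<close> kills
      \<open>x i\<close>, and hence all of \<open>q S\<close>.\<close>
    define T where "T = {t \<in> carrier S. hom_span A (L.module_relations A x) (\<lambda>k. if k = i then t else \<zero>\<^bsub>S\<^esub>)}"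
    have "ideal T S"
    proof (rule S.cring_idealI)
      show "T \<subseteq> carrier S" by (auto simp: T_def)
      show "\<zero>\<^bsub>S\<^esub> \<in> T" by (auto simp: T_def intro: hom_span.zero)
      show "s \<oplus>\<^bsub>S\<^esub> t \<in> T" if "s \<in> T" "t \<in> T" for s t
        using that hom_span_add[OF mrel, of A x "\<lambda>k. if k = i then s else \<zero>\<^bsub>S\<^esub>" "\<lambda>k. if k = i then t else \<zero>\<^bsub>S\<^esub>"]
        by (auto simp: T_def elim!: hom_span_cong)
      show "a \<otimes>\<^bsub>S\<^esub> t \<in> T" if "a \<in> carrier S" "t \<in> T" for a t
        using that hom_span_smult[OF mrel, of A x "\<lambda>k. if k = i then t else \<zero>\<^bsub>S\<^esub>" a]
        by (auto simp: T_def elim!: hom_span_cong)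
    qed
    moreover have "h ` q \<subseteq> T"
    proof
      fix t assume "t \<in> h ` q"
      then obtain r where r: "r \<in> q" "t = h r" by auto
      have rc: "r \<in> carrier R" using r q by auto
      have "(\<lambda>k. if k = i then r else \<zero>) \<in> L.module_relations A x"
        using L.finsum_smult_delta[OF A i x rc] kill[OF r(1) i] rc by (auto simp: L.module_relations_def)
      from hom_span_single[OF mrel this S.one_closed]
      have "hom_span A (L.module_relations A x) (\<lambda>k. if k = i then t else \<zero>\<^bsub>S\<^esub>)"
        by (rule hom_span_cong) (use rc r in auto)
      then show "t \<in> T" using rc r by (auto simp: T_def)
    qed
    ultimately have "Idl\<^bsub>S\<^esub> (h ` q) \<subseteq> T" by (rule S.genideal_minimal)
    then show ?thesis using f[OF i] by (auto simp: T_def)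
  qed
  from hom_span_sum[OF mrel unit]
  have "hom_span A (L.module_relations A x) (\<lambda>k. \<Oplus>\<^bsub>S\<^esub>i\<in>A. if k = i then f i else \<zero>\<^bsub>S\<^esub>)" .
  then show ?thesis
  proof (rule hom_span_cong)
    fix k assume k: "k \<in> A"
    have "(\<Oplus>\<^bsub>S\<^esub>i\<in>A. if k = i then f i else \<zero>\<^bsub>S\<^esub>) = (\<Oplus>\<^bsub>S\<^esub>i\<in>A. if i = k then f k else \<zero>\<^bsub>S\<^esub>)"
      using fc by (intro S.finsum_cong') auto
    also have "\<dots> = f k" using A k fc by (intro S.finsum_delta) auto
    finally show "f k = (\<Oplus>\<^bsub>S\<^esub>i\<in>A. if k = i then f i else \<zero>\<^bsub>S\<^esub>)" ..
  qed
qed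

text \<open>By flatness, an element killed by finitely many ring elements comes from the submodule
  of \<open>L\<close> killed by them.\<close>

lemma comb_killed:
  assumes flat and "finite Q" and "Q \<subseteq> carrier R" "c \<in> carrier frees" "h ` Q \<subseteq> ann c"
  shows "\<exists>(n :: nat) x s. (\<forall>i<n. x i \<in> carrier L \<and> s i \<in> carrier S \<and> (\<forall>a\<in>Q. a \<odot>\<^bsub>L\<^esub> x i = \<zero>\<^bsub>L\<^esub>)) \<and>
    c - comb {..<n} x s \<in> rels"
  using assms(2,3,5)
proof (induction Q)
  case empty
  then show ?case using comb_exists[OF assms(4)] by simp
next
  case (insert a Q)
  have "\<exists>(n :: nat) x s. (\<forall>i<n. x i \<in> carrier L \<and> s i \<in> carrier S \<and> (\<forall>a\<in>Q. a \<odot>\<^bsub>L\<^esub> x i = \<zero>\<^bsub>L\<^esub>)) \<and>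
    c - comb {..<n} x s \<in> rels"
    using insert by auto
  then obtain n :: nat and x s where
    xs: "\<forall>i<n. x i \<in> carrier L \<and> s i \<in> carrier S \<and> (\<forall>a\<in>Q. a \<odot>\<^bsub>L\<^esub> x i = \<zero>\<^bsub>L\<^esub>)"
    and c: "c - comb {..<n} x s \<in> rels" by (elim exE conjE)
  have x: "x i \<in> carrier L" and s: "s i \<in> carrier S" and kx: "b \<in> Q \<Longrightarrow> b \<odot>\<^bsub>L\<^esub> x i = \<zero>\<^bsub>L\<^esub>"
    if "i \<in> {..<n}" for i b using xs that by auto
  have a: "a \<in> carrier R" using insert.prems by auto
  have Qc: "b \<in> carrier R" if "b \<in> Q" for b using insert.prems that by auto
  have "h a \<in> ann (comb {..<n} x s)" using insert.prems ann_cong[OF c] by auto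
  then have "comb {..<n} x (\<lambda>i. h a \<otimes>\<^bsub>S\<^esub> s i) \<in> rels" by (simp add: ann_def scale_comb)
  moreover have "comb {..<n} (\<lambda>i. a \<odot>\<^bsub>L\<^esub> x i) s - comb {..<n} x (\<lambda>i. h a \<otimes>\<^bsub>S\<^esub> s i) \<in> rels"
    using comb_smult_left[of "{..<n}" x "\<lambda>_. a" s] x s a by blast
  ultimately have "comb {..<n} (\<lambda>i. a \<odot>\<^bsub>L\<^esub> x i) s \<in> rels" using rels_add by fastforce
  \<comment> \<open>As \<open>h a\<close> kills the sum, the tensors of \<open>a x i\<close> with
    \<open>s i\<close> add up to zero, and the vanishing criterion produces relations between the
    \<open>a x i\<close>.\<close>
  then have "hom_span {..<n} (L.module_relations {..<n} (\<lambda>i. a \<odot>\<^bsub>L\<^esub> x i)) s"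
    using comb_mem_rels_iff[OF \<open>flat\<close>, of "{..<n}" "\<lambda>i. a \<odot>\<^bsub>L\<^esub> x i" s] x s a by blast
  from hom_span_imp_sum[OF L.module_relations_funcset this]
  obtain m :: nat and k t where kt: "\<forall>l<m. k l \<in> L.module_relations {..<n} (\<lambda>i. a \<odot>\<^bsub>L\<^esub> x i) \<and> t l \<in> carrier S"
    and st: "\<forall>i\<in>{..<n}. s i = (\<Oplus>\<^bsub>S\<^esub>l\<in>{..<m}. h (k l i) \<otimes>\<^bsub>S\<^esub> t l)" by (elim exE conjE)
  have t: "t l \<in> carrier S" if "l \<in> {..<m}" for l using kt that by auto
  have k: "k l i \<in> carrier R" if "l \<in> {..<m}" "i \<in> {..<n}" for l i
  proof -
    have "k l \<in> {..<n} \<rightarrow> carrier R" using kt that(1) by (simp add: L.module_relations_def)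
    then show ?thesis using that(2) by (rule funcset_mem)
  qed
  \<comment> \<open>A relation between the \<open>a x i\<close> combines the \<open>x i\<close> into
    an element killed by \<open>a\<close>. Being a combination of the \<open>x i\<close>, it is
    still killed by \<open>Q\<close>.\<close>
  define y where "y l = (\<Oplus>\<^bsub>L\<^esub>i\<in>{..<n}. k l i \<odot>\<^bsub>L\<^esub> x i)" for l
  have y: "y l \<in> carrier L" if "l \<in> {..<m}" for l
    unfolding y_def using k[OF that] x by (intro L.M.finsum_closed) auto
  have smult_y: "b \<odot>\<^bsub>L\<^esub> y l = (\<Oplus>\<^bsub>L\<^esub>i\<in>{..<n}. k l i \<odot>\<^bsub>L\<^esub> (b \<odot>\<^bsub>L\<^esub> x i))"
    if "b \<in> carrier R" "l \<in> {..<m}" for b l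
  proof -
    have "b \<odot>\<^bsub>L\<^esub> y l = (\<Oplus>\<^bsub>L\<^esub>i\<in>{..<n}. b \<odot>\<^bsub>L\<^esub> (k l i \<odot>\<^bsub>L\<^esub> x i))"
      unfolding y_def using that k x by (intro L.finsum_smult_ldistr) auto
    also have "\<dots> = (\<Oplus>\<^bsub>L\<^esub>i\<in>{..<n}. k l i \<odot>\<^bsub>L\<^esub> (b \<odot>\<^bsub>L\<^esub> x i))"
    proof (rule L.M.finsum_cong')
      fix i assume i: "i \<in> {..<n}"
      show "b \<odot>\<^bsub>L\<^esub> (k l i \<odot>\<^bsub>L\<^esub> x i) = k l i \<odot>\<^bsub>L\<^esub> (b \<odot>\<^bsub>L\<^esub> x i)"
        using that(1) k[OF that(2) i] x[OF i] R.m_comm[of b "k l i"]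
        by (simp add: L.smult_assoc1[symmetric])
    qed (use that k x in auto)
    finally show ?thesis .
  qed
  have ay: "a \<odot>\<^bsub>L\<^esub> y l = \<zero>\<^bsub>L\<^esub>" if "l \<in> {..<m}" for l
    using smult_y[OF a that] kt that by (simp add: L.module_relations_def)
  have qy: "b \<odot>\<^bsub>L\<^esub> y l = \<zero>\<^bsub>L\<^esub>" if "l \<in> {..<m}" "b \<in> Q" for l b
    unfolding smult_y[OF Qc[OF that(2)] that(1)]
    using kx that k by (intro L.M.add.finprod_one_eqI) auto
  \<comment> \<open>Both representations agree with the double sum over \<open>l\<close> and
    \<open>i\<close>, obtained by moving the coefficients \<open>k l i\<close> across the tensor
    sign.\<close>
  have "comb {..<m} y t - (\<Sum>l<m. comb {..<n} x (\<lambda>i. h (k l i) \<otimes>\<^bsub>S\<^esub> t l)) \<in> rels"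
    unfolding comb_def[of _ y] sum_subtractf[symmetric] y_def
    by (intro rels_sum comb_finsum_left finite_lessThan x k t)
  moreover have "comb {..<n} x s - (\<Sum>l<m. comb {..<n} x (\<lambda>i. h (k l i) \<otimes>\<^bsub>S\<^esub> t l)) \<in> rels"
  proof -
    have "comb {..<n} x (\<lambda>i. \<Oplus>\<^bsub>S\<^esub>l\<in>{..<r}. h (k l i) \<otimes>\<^bsub>S\<^esub> t l)
      - (\<Sum>l<r. comb {..<n} x (\<lambda>i. h (k l i) \<otimes>\<^bsub>S\<^esub> t l)) \<in> rels" if "r \<le> m" for r
      using that
    proof (induction r)
      case 0
      then show ?case using x by (auto simp: comb_def intro!: rels_sum tensor_zero_right)
    next
      case (Suc r)
      have cl: "(\<Oplus>\<^bsub>S\<^esub>l\<in>{..<r}. h (k l i) \<otimes>\<^bsub>S\<^esub> t l) \<in> carrier S" if "i \<in> {..<n}" for i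
        using k[OF _ that] t Suc.prems by (intro S.finsum_closed) auto
      have cr: "h (k r i) \<otimes>\<^bsub>S\<^esub> t r \<in> carrier S" if "i \<in> {..<n}" for i
        using k[OF _ that] t Suc.prems by auto
      have "comb {..<n} x (\<lambda>i. \<Oplus>\<^bsub>S\<^esub>l\<in>{..<Suc r}. h (k l i) \<otimes>\<^bsub>S\<^esub> t l)
        = comb {..<n} x (\<lambda>i. (\<Oplus>\<^bsub>S\<^esub>l\<in>{..<r}. h (k l i) \<otimes>\<^bsub>S\<^esub> t l) \<oplus>\<^bsub>S\<^esub> h (k r i) \<otimes>\<^bsub>S\<^esub> t r)"
        unfolding comb_def
      proof (rule sum.cong)
        fix i assume i: "i \<in> {..<n}"
        have "(\<Oplus>\<^bsub>S\<^esub>l\<in>insert r {..<r}. h (k l i) \<otimes>\<^bsub>S\<^esub> t l)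
          = h (k r i) \<otimes>\<^bsub>S\<^esub> t r \<oplus>\<^bsub>S\<^esub> (\<Oplus>\<^bsub>S\<^esub>l\<in>{..<r}. h (k l i) \<otimes>\<^bsub>S\<^esub> t l)"
          using k[OF _ i] t Suc.prems by (intro S.finsum_insert) auto
        then show "frag_of (x i, \<Oplus>\<^bsub>S\<^esub>l\<in>{..<Suc r}. h (k l i) \<otimes>\<^bsub>S\<^esub> t l)
          = frag_of (x i, (\<Oplus>\<^bsub>S\<^esub>l\<in>{..<r}. h (k l i) \<otimes>\<^bsub>S\<^esub> t l) \<oplus>\<^bsub>S\<^esub> h (k r i) \<otimes>\<^bsub>S\<^esub> t r)"
          using S.a_comm[OF cl[OF i] cr[OF i]] by (simp add: lessThan_Suc)
      qed simp
      moreover have "comb {..<n} x (\<lambda>i. (\<Oplus>\<^bsub>S\<^esub>l\<in>{..<r}. h (k l i) \<otimes>\<^bsub>S\<^esub> t l) \<oplus>\<^bsub>S\<^esub> h (k r i) \<otimes>\<^bsub>S\<^esub> t r)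
        - comb {..<n} x (\<lambda>i. \<Oplus>\<^bsub>S\<^esub>l\<in>{..<r}. h (k l i) \<otimes>\<^bsub>S\<^esub> t l)
        - comb {..<n} x (\<lambda>i. h (k r i) \<otimes>\<^bsub>S\<^esub> t r) \<in> rels"
        by (intro comb_add x cl cr)
      ultimately have 1: "comb {..<n} x (\<lambda>i. \<Oplus>\<^bsub>S\<^esub>l\<in>{..<Suc r}. h (k l i) \<otimes>\<^bsub>S\<^esub> t l)
        - comb {..<n} x (\<lambda>i. \<Oplus>\<^bsub>S\<^esub>l\<in>{..<r}. h (k l i) \<otimes>\<^bsub>S\<^esub> t l)
        - comb {..<n} x (\<lambda>i. h (k r i) \<otimes>\<^bsub>S\<^esub> t r) \<in> rels"
        by simp
      have 2: "comb {..<n} x (\<lambda>i. \<Oplus>\<^bsub>S\<^esub>l\<in>{..<r}. h (k l i) \<otimes>\<^bsub>S\<^esub> t l)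
        - (\<Sum>l<r. comb {..<n} x (\<lambda>i. h (k l i) \<otimes>\<^bsub>S\<^esub> t l)) \<in> rels"
        using Suc by simp
      from rels_add[OF 1 2] show ?case by (simp add: algebra_simps)
    qed
    from this[of m] have "comb {..<n} x (\<lambda>i. \<Oplus>\<^bsub>S\<^esub>l\<in>{..<m}. h (k l i) \<otimes>\<^bsub>S\<^esub> t l)
      - (\<Sum>l<m. comb {..<n} x (\<lambda>i. h (k l i) \<otimes>\<^bsub>S\<^esub> t l)) \<in> rels" by simp
    moreover have "comb {..<n} x (\<lambda>i. \<Oplus>\<^bsub>S\<^esub>l\<in>{..<m}. h (k l i) \<otimes>\<^bsub>S\<^esub> t l) = comb {..<n} x s"
      unfolding comb_def using st by (intro sum.cong) auto
    ultimately show ?thesis by simp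
  qed
  ultimately have "comb {..<n} x s - comb {..<m} y t \<in> rels" using rels_diff by fastforce
  then have "c - comb {..<m} y t \<in> rels" using rels_trans[OF c] by blast
  then show ?case using y t ay qy by (intro exI[of _ m] exI[of _ y] exI[of _ t]) auto
qed

end

section \<open>Strong Krull primes of a flat base change\<close>

context base_change_module
begin

text \<open>By \<open>kill\<close> and \<open>indep\<close>, the \<open>x i\<close> are a basis of a
  free module over \<open>R/q\<close>. By flatness its base change, a power of \<open>S/qS\<close>,
  embeds in that of \<open>L\<close>, and annihilators can be computed coordinatewise.\<close>

lemma ann_comb_eq:
  assumes flat and q: "q \<subseteq> carrier R" and A: "finite A" and x: "\<And>i. i \<in> A \<Longrightarrow> x i \<in> carrier L"
    and s: "\<And>i. i \<in> A \<Longrightarrow> s i \<in> carrier S"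
    and kill: "\<And>r i. r \<in> q \<Longrightarrow> i \<in> A \<Longrightarrow> r \<odot>\<^bsub>L\<^esub> x i = \<zero>\<^bsub>L\<^esub>"
    and indep: "\<And>c i. c \<in> L.module_relations A x \<Longrightarrow> i \<in> A \<Longrightarrow> c i \<in> q"
  shows "ann (comb A x s) = {a \<in> carrier S. \<forall>i\<in>A. a \<otimes>\<^bsub>S\<^esub> s i \<in> Idl\<^bsub>S\<^esub> (h ` q)}"
proof -
  have "hom_span A (L.module_relations A x) f \<longleftrightarrow> (\<forall>i\<in>A. f i \<in> Idl\<^bsub>S\<^esub> (h ` q))" for f
  proof
    show "\<forall>i\<in>A. f i \<in> Idl\<^bsub>S\<^esub> (h ` q)" if "hom_span A (L.module_relations A x) f"
      using hom_span_mem_ideal[OF q that] indep by blast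
    show "hom_span A (L.module_relations A x) f" if "\<forall>i\<in>A. f i \<in> Idl\<^bsub>S\<^esub> (h ` q)"
      by (rule hom_span_of_mem_ideal[OF q A x kill]) (use that in auto)
  qed
  moreover have "a \<in> ann (comb A x s) \<longleftrightarrow>
      a \<in> carrier S \<and> hom_span A (L.module_relations A x) (\<lambda>i. a \<otimes>\<^bsub>S\<^esub> s i)" for a
    by (rule mem_ann_comb[OF \<open>flat\<close> A x s])
  ultimately show ?thesis by (simp add: set_eq_iff)
qed

text \<open>If \<open>z\<close> has annihilator \<open>Q\<close>, the tensors of \<open>z\<close>
  with elements of \<open>S\<close> form a copy of \<open>S/QS\<close>, so witnesses for the
  quotient are witnesses in the base change.\<close>

lemma strong_krull_base_change_superset:
  assumes flat and Q: "Q \<in> associated_primes R L"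
    and P: "P \<in> strong_krull_primes S (quotient_module S (Idl\<^bsub>S\<^esub> (h ` Q)))"
  shows "P \<in> strong_krull_primes S BC"
proof -
  obtain z where z: "z \<in> carrier L" "Q = annihilator R L z" and Qp: "primeideal Q R"
    using Q by (auto simp: associated_primes_def)
  have Qc: "Q \<subseteq> carrier R" by (rule R.primeidealD(3)[OF Qp])
  define J where "J = Idl\<^bsub>S\<^esub> (h ` Q)"
  have J: "ideal J S" unfolding J_def using Qc by (intro S.genideal_ideal) auto
  have ann: "ann (comb {()} (\<lambda>_. z) (\<lambda>_. s)) = S.colon J s" if s: "s \<in> carrier S" for s
  proof -
    have "c () \<in> Q" if "c \<in> L.module_relations {()} (\<lambda>_. z)" for c
      using that z by (auto simp: L.module_relations_def annihilator_def Pi_def)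
    then have "ann (comb {()} (\<lambda>_. z) (\<lambda>_. s)) = {a \<in> carrier S. \<forall>i\<in>{()}. a \<otimes>\<^bsub>S\<^esub> s \<in> J}"
      unfolding J_def using z s
      by (intro ann_comb_eq[OF \<open>flat\<close> Qc]) (auto simp: annihilator_def)
    then show ?thesis by (simp add: S.colon_def)
  qed
  have carr: "comb {()} (\<lambda>_. z) (\<lambda>_. s) \<in> carrier frees" if "s \<in> carrier S" for s
    using coef_comb[of "{()}" "\<lambda>_. z" "\<lambda>_. s"] z that by simp
  show ?thesis
    unfolding strong_krull_base_change_iff
  proof (intro conjI allI impI)
    show "primeideal P S" using P by (simp add: strong_krull_primes_def)
    fix I assume "fg_ideal I S \<and> I \<subseteq> P"
    then have "\<exists>s\<in>carrier S. I \<subseteq> S.colon J s \<and> S.colon J s \<subseteq> P"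
      using P unfolding S.strong_krull_quotient_iff[OF J, folded J_def] J_def[symmetric] by blast
    then obtain s where s: "s \<in> carrier S" "I \<subseteq> S.colon J s" "S.colon J s \<subseteq> P" by blast
    show "\<exists>c\<in>carrier frees. I \<subseteq> ann c \<and> ann c \<subseteq> P"
      by (rule bexI[OF _ carr[OF s(1)]]) (simp add: ann[OF s(1)] s)
  qed
qed

text \<open>A representation of minimal length of a suitable multiple has linearly independent
  components modulo \<open>q = P \<inter> R\<close>: a relation with a coefficient \<open>\<kappa> j \<notin> q\<close> would shorten
  its \<open>\<kappa> j\<close>-fold.\<close>

lemma shorten_comb:
  assumes A: "finite A" and x: "\<And>i. i \<in> A \<Longrightarrow> x i \<in> carrier L"
    and s: "\<And>i. i \<in> A \<Longrightarrow> s i \<in> carrier S"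
    and \<kappa>: "\<kappa> \<in> L.module_relations A x" and j: "j \<in> A"
    and P: "primeideal P S" and hj: "h (\<kappa> j) \<notin> P" and sub: "ann (comb A x s) \<subseteq> P"
  shows "\<exists>s'. (\<forall>i\<in>A - {j}. s' i \<in> carrier S) \<and>
    ann (comb A x s) \<subseteq> ann (comb (A - {j}) x s') \<and> ann (comb (A - {j}) x s') \<subseteq> P"
proof -
  have \<kappa>c: "\<kappa> i \<in> carrier R" if "i \<in> A" for i
    using subsetD[OF L.module_relations_funcset \<kappa>] that by auto
  define b where "b = h (\<kappa> j)"
  have b: "b \<in> carrier S" using \<kappa>c[OF j] by (simp add: b_def)
  \<comment> \<open>Multiply by \<open>b\<close> and subtract \<open>s j\<close> times the relation
    \<open>\<kappa>\<close>; the entry at \<open>j\<close> becomes zero.\<close>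
  define s' where "s' i = (if i = j then \<zero>\<^bsub>S\<^esub> else b \<otimes>\<^bsub>S\<^esub> s i \<ominus>\<^bsub>S\<^esub> h (\<kappa> i) \<otimes>\<^bsub>S\<^esub> s j)" for i
  have s': "s' i \<in> carrier S" if "i \<in> A" for i using that b s \<kappa>c j by (simp add: s'_def)
  have bs: "b \<otimes>\<^bsub>S\<^esub> s i \<in> carrier S" if "i \<in> A" for i using that b s by simp
  have "hom_span A (L.module_relations A x) (\<lambda>i. h (\<kappa> i) \<otimes>\<^bsub>S\<^esub> s j)"
    by (rule hom_span_single[OF L.module_relations_funcset \<kappa> s[OF j]])
  then have "hom_span A (L.module_relations A x) (\<lambda>i. b \<otimes>\<^bsub>S\<^esub> s i \<ominus>\<^bsub>S\<^esub> s' i)"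
  proof (rule hom_span_cong)
    fix i assume i: "i \<in> A"
    have "u \<ominus>\<^bsub>S\<^esub> (u \<ominus>\<^bsub>S\<^esub> v) = v" if "u \<in> carrier S" "v \<in> carrier S" for u v
      using that by algebra
    then show "b \<otimes>\<^bsub>S\<^esub> s i \<ominus>\<^bsub>S\<^esub> s' i = h (\<kappa> i) \<otimes>\<^bsub>S\<^esub> s j"
      using bs[OF i] s[OF i] s[OF j] \<kappa>c[OF i] b by (simp add: s'_def b_def a_minus_def)
  qed
  then have "comb A x (\<lambda>i. b \<otimes>\<^bsub>S\<^esub> s i \<ominus>\<^bsub>S\<^esub> s' i) \<in> rels" by (intro comb_mem_rels_if A x)
  moreover have "comb A x (\<lambda>i. b \<otimes>\<^bsub>S\<^esub> s i) - comb A x s' - comb A x (\<lambda>i. b \<otimes>\<^bsub>S\<^esub> s i \<ominus>\<^bsub>S\<^esub> s' i) \<in> rels"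
    by (intro comb_minus x bs s')
  ultimately have 1: "comb A x (\<lambda>i. b \<otimes>\<^bsub>S\<^esub> s i) - comb A x s' \<in> rels" using rels_add by fastforce
  have "comb A x s' = frag_of (x j, \<zero>\<^bsub>S\<^esub>) + comb (A - {j}) x s'"
    unfolding comb_def using A j by (subst sum.remove[of A j]) (auto simp: s'_def)
  then have 2: "comb A x s' - comb (A - {j}) x s' \<in> rels" using tensor_zero_right[OF x[OF j]] by simp
  have "ann (comb A x (\<lambda>i. b \<otimes>\<^bsub>S\<^esub> s i)) = ann (comb (A - {j}) x s')"
    by (rule ann_cong[OF rels_trans[OF 1 2]])
  \<comment> \<open>The annihilator of the \<open>b\<close>-fold is the colon by \<open>b\<close> of
    the old annihilator. It stays inside the prime \<open>P\<close> because \<open>b\<close> is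
    outside \<open>P\<close>.\<close>
  moreover have mem: "a \<in> ann (comb A x (\<lambda>i. b \<otimes>\<^bsub>S\<^esub> s i)) \<longleftrightarrow> b \<otimes>\<^bsub>S\<^esub> a \<in> ann (comb A x s)"
    if a: "a \<in> carrier S" for a
  proof -
    have "comb A x (\<lambda>i. a \<otimes>\<^bsub>S\<^esub> (b \<otimes>\<^bsub>S\<^esub> s i)) = comb A x (\<lambda>i. b \<otimes>\<^bsub>S\<^esub> a \<otimes>\<^bsub>S\<^esub> s i)"
      unfolding comb_def using a b s by (intro sum.cong) (auto simp: S.m_assoc S.m_lcomm)
    then show ?thesis using a b by (simp add: ann_def scale_comb[OF A])
  qed
  moreover have "b \<otimes>\<^bsub>S\<^esub> a \<in> ann (comb A x s)" if a: "a \<in> ann (comb A x s)" for a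
  proof -
    have ac: "a \<in> carrier S" and "comb A x (\<lambda>i. a \<otimes>\<^bsub>S\<^esub> s i) \<in> rels"
      using a by (auto simp: ann_def scale_comb[OF A])
    from scale_rels[OF b this(2)] have "comb A x (\<lambda>i. b \<otimes>\<^bsub>S\<^esub> (a \<otimes>\<^bsub>S\<^esub> s i)) \<in> rels"
      by (simp add: scale_comb[OF A])
    moreover have "comb A x (\<lambda>i. b \<otimes>\<^bsub>S\<^esub> (a \<otimes>\<^bsub>S\<^esub> s i)) = comb A x (\<lambda>i. b \<otimes>\<^bsub>S\<^esub> a \<otimes>\<^bsub>S\<^esub> s i)"
      unfolding comb_def using ac b s by (intro sum.cong) (auto simp: S.m_assoc)
    ultimately show ?thesis using ac b by (simp add: ann_def scale_comb[OF A])
  qed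
  moreover have "a \<in> P" if "a \<in> carrier S" "b \<otimes>\<^bsub>S\<^esub> a \<in> ann (comb A x s)" for a
    using S.primeidealD(4)[OF P b that(1)] that(2) sub hj by (auto simp: b_def)
  moreover have "ann c \<subseteq> carrier S" for c by (auto simp: ann_def)
  ultimately have "ann (comb A x s) \<subseteq> ann (comb (A - {j}) x s') \<and> ann (comb (A - {j}) x s') \<subseteq> P"
    by blast
  then show ?thesis using s' by (intro exI[of _ s']) auto
qed

lemma strong_krull_base_change_independent:
  assumes noeth: "noetherian_ring R" and flat and P: "P \<in> strong_krull_primes S BC"
    and I: "fg_ideal I S" "I \<subseteq> P" and q_def: "q = {r \<in> carrier R. h r \<in> P}" and q: "ideal q R"
  obtains A :: "nat set" and x s where "finite A"
    "\<forall>i\<in>A. x i \<in> carrier L \<and> s i \<in> carrier S \<and> (\<forall>r\<in>q. r \<odot>\<^bsub>L\<^esub> x i = \<zero>\<^bsub>L\<^esub>)"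
    "\<forall>c\<in>L.module_relations A x. \<forall>i\<in>A. c i \<in> q"
    "I \<subseteq> ann (comb A x s)" "ann (comb A x s) \<subseteq> P"
proof -
  have Pp: "primeideal P S" using P by (simp add: strong_krull_primes_def)
  obtain G where G: "G \<subseteq> carrier S" "finite G" "I = Idl\<^bsub>S\<^esub> G" using I(1) by (auto simp: fg_ideal_def)
  obtain Q where Q: "Q \<subseteq> carrier R" "finite Q" "q = Idl Q"
    using noetherian_ring.finetely_gen[OF noeth q] by blast
  have Qq: "Q \<subseteq> q" using R.genideal_self[OF Q(1)] Q(3) by simp
  \<comment> \<open>Adding generators of \<open>q\<close> to the test ideal forces the witness to be
    killed by \<open>q\<close>. The enlarged ideal stays in \<open>P\<close> because
    \<open>h\<close> maps \<open>q\<close> into \<open>P\<close>.\<close>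
  define I' where "I' = Idl\<^bsub>S\<^esub> (G \<union> h ` Q)"
  have gen: "G \<union> h ` Q \<subseteq> carrier S" using G Q by auto
  have "fg_ideal I' S" unfolding fg_ideal_def I'_def using gen G(2) Q(2) by blast
  moreover have "G \<subseteq> P" using S.genideal_self[OF G(1)] G(3) I(2) by simp
  then have "I' \<subseteq> P" unfolding I'_def
    using Qq by (intro S.genideal_minimal S.primeidealD(1)[OF Pp]) (auto simp: q_def)
  ultimately obtain c where c: "c \<in> carrier frees" "I' \<subseteq> ann c" "ann c \<subseteq> P"
    using P unfolding strong_krull_base_change_iff by blast
  have II': "I \<subseteq> I'" unfolding G(3) I'_def using gen by (intro S.Idl_mono) auto
  have "h ` Q \<subseteq> ann c" using S.genideal_self[OF gen] c(2) by (auto simp: I'_def)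
  from comb_killed[OF \<open>flat\<close> Q(2,1) c(1) this] obtain n :: nat and x s where
    xs: "\<forall>i<n. x i \<in> carrier L \<and> s i \<in> carrier S \<and> (\<forall>a\<in>Q. a \<odot>\<^bsub>L\<^esub> x i = \<zero>\<^bsub>L\<^esub>)"
    and cx: "c - comb {..<n} x s \<in> rels" by (elim exE conjE)
  have kill: "r \<odot>\<^bsub>L\<^esub> x i = \<zero>\<^bsub>L\<^esub>" if r: "r \<in> q" and i: "i < n" for r i
  proof -
    have xi: "x i \<in> carrier L" using xs i by simp
    have "ideal {r \<in> carrier R. r \<odot>\<^bsub>L\<^esub> x i = \<zero>\<^bsub>L\<^esub>} R"
      by (rule R.cring_idealI) (auto simp: xi L.smult_l_distr L.smult_assoc1)
    moreover have "Q \<subseteq> {r \<in> carrier R. r \<odot>\<^bsub>L\<^esub> x i = \<zero>\<^bsub>L\<^esub>}" using Q(1) xs i by auto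
    ultimately have "q \<subseteq> {r \<in> carrier R. r \<odot>\<^bsub>L\<^esub> x i = \<zero>\<^bsub>L\<^esub>}" unfolding Q(3) by (rule R.genideal_minimal)
    then show ?thesis using r by blast
  qed
  define good where "good m \<longleftrightarrow> (\<exists>(A :: nat set) x s. finite A \<and> card A = m \<and>
    (\<forall>i\<in>A. x i \<in> carrier L \<and> s i \<in> carrier S \<and> (\<forall>r\<in>q. r \<odot>\<^bsub>L\<^esub> x i = \<zero>\<^bsub>L\<^esub>)) \<and>
    I \<subseteq> ann (comb A x s) \<and> ann (comb A x s) \<subseteq> P)" for m
  have "good n"
    unfolding good_def using xs kill c II' ann_cong[OF cx]
    by (intro exI[of _ "{..<n}"] exI[of _ x] exI[of _ s]) auto
  then have "good (LEAST m. good m)" by (rule LeastI)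
  then obtain A :: "nat set" and x s where A: "finite A" "card A = (LEAST m. good m)"
    and xs: "\<forall>i\<in>A. x i \<in> carrier L \<and> s i \<in> carrier S \<and> (\<forall>r\<in>q. r \<odot>\<^bsub>L\<^esub> x i = \<zero>\<^bsub>L\<^esub>)"
    and ann: "I \<subseteq> ann (comb A x s)" "ann (comb A x s) \<subseteq> P"
    unfolding good_def[of "LEAST m. good m"] by (elim exE conjE)
  have x: "x i \<in> carrier L" and s: "s i \<in> carrier S" if "i \<in> A" for i using xs that by auto
  have "\<kappa> j \<in> q" if \<kappa>: "\<kappa> \<in> L.module_relations A x" and j: "j \<in> A" for \<kappa> j
  proof (rule ccontr)
    assume nq: "\<kappa> j \<notin> q"
    have "\<kappa> j \<in> carrier R" using subsetD[OF L.module_relations_funcset \<kappa>] j by auto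
    then have "h (\<kappa> j) \<notin> P" using nq by (simp add: q_def)
    from shorten_comb[OF A(1) x s \<kappa> j Pp this ann(2)] obtain s' where
      s': "\<forall>i\<in>A - {j}. s' i \<in> carrier S" "ann (comb A x s) \<subseteq> ann (comb (A - {j}) x s')"
        "ann (comb (A - {j}) x s') \<subseteq> P" by blast
    have "good (card (A - {j}))"
      unfolding good_def using s' ann xs A(1)
      by (intro exI[of _ "A - {j}"] exI[of _ x] exI[of _ s']) auto
    then have "card A \<le> card (A - {j})" unfolding A(2) by (rule Least_le)
    then show False using card_Diff1_less[OF A(1) j] by simp
  qed
  then show thesis using that[OF A(1) xs _ ann] by blast
qed

lemma strong_krull_base_change_subset:
  assumes noeth: "noetherian_ring R" and flat and P: "P \<in> strong_krull_primes S BC"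
  shows "\<exists>q\<in>associated_primes R L. P \<in> strong_krull_primes S (quotient_module S (Idl\<^bsub>S\<^esub> (h ` q)))"
proof -
  have Pp: "primeideal P S" using P by (simp add: strong_krull_primes_def)
  note PI = S.idealD[OF S.primeidealD(1)[OF Pp]]
  define q where "q = {r \<in> carrier R. h r \<in> P}"
  have q: "ideal q R"
    by (rule R.cring_idealI) (auto simp: q_def PI)
  have qp: "primeideal q R"
  proof (rule primeidealI[OF q R.cring_axioms])
    have "\<one> \<notin> q" using S.primeidealD(2)[OF Pp] by (simp add: q_def)
    then show "carrier R \<noteq> q" using R.one_closed by metis
    show "a \<in> q \<or> b \<in> q" if "a \<in> carrier R" "b \<in> carrier R" "a \<otimes> b \<in> q" for a b
      using that S.primeidealD(4)[OF Pp, of "h a" "h b"] by (simp add: q_def)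
  qed
  have qc: "q \<subseteq> carrier R" by (auto simp: q_def)
  define J where "J = Idl\<^bsub>S\<^esub> (h ` q)"
  have J: "ideal J S" unfolding J_def using qc by (intro S.genideal_ideal) auto
  \<comment> \<open>\<open>q\<close> is fixed before \<open>I\<close>, so the same prime serves
    every test ideal; only the witnesses \<open>y\<close> and \<open>s\<close> depend on
    \<open>I\<close>.\<close>
  have key: "\<exists>y\<in>carrier L. annihilator R L y = q \<and> (\<exists>s\<in>carrier S. I \<subseteq> S.colon J s \<and> S.colon J s \<subseteq> P)"
    if I: "fg_ideal I S" "I \<subseteq> P" for I
  proof -
    obtain A :: "nat set" and x s where A: "finite A"
      and xs: "\<forall>i\<in>A. x i \<in> carrier L \<and> s i \<in> carrier S \<and> (\<forall>r\<in>q. r \<odot>\<^bsub>L\<^esub> x i = \<zero>\<^bsub>L\<^esub>)"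
      and rel: "\<forall>c\<in>L.module_relations A x. \<forall>i\<in>A. c i \<in> q"
      and ann: "I \<subseteq> ann (comb A x s)" "ann (comb A x s) \<subseteq> P"
      using strong_krull_base_change_independent[OF noeth \<open>flat\<close> P I q_def q] .
    have x: "x i \<in> carrier L" and s: "s i \<in> carrier S"
      and kill: "r \<in> q \<Longrightarrow> r \<odot>\<^bsub>L\<^esub> x i = \<zero>\<^bsub>L\<^esub>" if "i \<in> A" for i r
      using xs that by simp_all
    have indep: "c i \<in> q" if "c \<in> L.module_relations A x" "i \<in> A" for c i using rel that by blast
    have ann_eq: "ann (comb A x s) = {a \<in> carrier S. \<forall>i\<in>A. a \<otimes>\<^bsub>S\<^esub> s i \<in> J}"
      unfolding J_def by (rule ann_comb_eq[OF \<open>flat\<close> qc A]) (simp_all add: x s kill indep)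
    \<comment> \<open>A prime that contains a finite intersection of ideals contains one of them.
      Otherwise each colon ideal has an element outside \<open>P\<close>, and the product of these
      elements annihilates the sum.\<close>
    have "\<exists>i\<in>A. S.colon J (s i) \<subseteq> P"
    proof (rule ccontr)
      assume contra: "\<not> ?thesis"
      have "\<exists>b\<in>carrier S - P. \<forall>i\<in>B. b \<otimes>\<^bsub>S\<^esub> s i \<in> J" if "finite B" "B \<subseteq> A" for B
        using that
      proof (induction B)
        case empty
        then show ?case using S.primeidealD(2)[OF Pp] by (intro bexI[of _ "\<one>\<^bsub>S\<^esub>"]) auto
      next
        case (insert i B)
        then obtain b where b: "b \<in> carrier S - P" "\<forall>i\<in>B. b \<otimes>\<^bsub>S\<^esub> s i \<in> J" by auto
        obtain a where a: "a \<in> carrier S - P" "a \<otimes>\<^bsub>S\<^esub> s i \<in> J"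
          using contra insert.prems by (auto simp: S.colon_def)
        have si: "s k \<in> carrier S" if "k \<in> insert i B" for k using that insert.prems s by auto
        have "a \<otimes>\<^bsub>S\<^esub> b \<otimes>\<^bsub>S\<^esub> s k \<in> J" if k: "k \<in> insert i B" for k
        proof (cases "k = i")
          case True
          have "a \<otimes>\<^bsub>S\<^esub> b \<otimes>\<^bsub>S\<^esub> s k = b \<otimes>\<^bsub>S\<^esub> (a \<otimes>\<^bsub>S\<^esub> s i)"
            using a(1) b(1) si[OF k] True by (simp add: S.m_ac)
          then show ?thesis using S.idealD(6)[OF J, of b] a b by simp
        next
          case False
          have "a \<otimes>\<^bsub>S\<^esub> b \<otimes>\<^bsub>S\<^esub> s k = a \<otimes>\<^bsub>S\<^esub> (b \<otimes>\<^bsub>S\<^esub> s k)"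
            using a(1) b(1) si[OF k] by (simp add: S.m_assoc)
          then show ?thesis using S.idealD(6)[OF J, of a] a b k False by simp
        qed
        then show ?case using S.primeidealD(5)[OF Pp a(1) b(1)] by blast
      qed
      from this[OF A order_refl] show False using ann(2) unfolding ann_eq by blast
    qed
    then obtain i where i: "i \<in> A" "S.colon J (s i) \<subseteq> P" by blast
    have "I \<subseteq> S.colon J (s i)" using ann(1) i(1) unfolding ann_eq by (auto simp: S.colon_def)
    moreover have "annihilator R L (x i) = q"
    proof
      show "q \<subseteq> annihilator R L (x i)" using kill i(1) qc by (auto simp: annihilator_def)
      show "annihilator R L (x i) \<subseteq> q"
      proof
        fix r assume "r \<in> annihilator R L (x i)"
        then have r: "r \<in> carrier R" "r \<odot>\<^bsub>L\<^esub> x i = \<zero>\<^bsub>L\<^esub>" by (auto simp: annihilator_def)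
        \<comment> \<open>An element that kills \<open>x i\<close> gives a relation supported at
          \<open>i\<close>, and independence puts it into \<open>q\<close>.\<close>
        have "(\<lambda>k. if k = i then r else \<zero>) \<in> L.module_relations A x"
          using L.finsum_smult_delta[OF A i(1) x r(1)] r by (auto simp: L.module_relations_def)
        from indep[OF this i(1)] show "r \<in> q" by simp
      qed
    qed
    ultimately show ?thesis using i s x by blast
  qed
  \<comment> \<open>The zero ideal is always available as a test ideal and yields an element of
    \<open>L\<close> with annihilator \<open>q\<close>.\<close>
  have "fg_ideal {\<zero>\<^bsub>S\<^esub>} S" unfolding fg_ideal_def
    by (intro exI[of _ "{}"]) (simp add: S.Idl_empty)
  moreover have "{\<zero>\<^bsub>S\<^esub>} \<subseteq> P" using PI(2) by simp
  ultimately have "q \<in> associated_primes R L" using key qp unfolding associated_primes_def by blast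
  moreover have "P \<in> strong_krull_primes S (quotient_module S J)"
    unfolding S.strong_krull_quotient_iff[OF J] using key Pp by blast
  ultimately show ?thesis unfolding J_def by blast
qed

theorem strong_krull_flat_base_change:
  assumes "noetherian_ring R" flat
  shows "strong_krull_primes S BC =
    (\<Union>Q \<in> associated_primes R L. strong_krull_primes S (quotient_module S (Idl\<^bsub>S\<^esub> (h ` Q))))"
  using strong_krull_base_change_subset[OF assms] strong_krull_base_change_superset[OF assms(2)] by blast

end

theorem corollary4p9:
  fixes R :: "('a, 'r) ring_scheme" and L :: "('a, 'b, 'm) module_scheme" and p :: nat
  assumes "regular_noetherian_ring R"
    and "Factorial_Ring.prime p" and "has_characteristic R p"
    and "module R L"
  shows "strong_krull_primes (perfect_closure R p)
           (base_change R (perfect_closure R p) (perfect_embed R p) L) =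
         (\<Union>Q \<in> associated_primes R L.
            strong_krull_primes (perfect_closure R p)
              (quotient_module (perfect_closure R p)
                (Idl\<^bsub>perfect_closure R p\<^esub> (perfect_embed R p ` Q))))"
proof -
  note R = assms(1)[unfolded regular_noetherian_ring_def]
  note cring = conjunct1[OF R] and noeth = conjunct1[OF conjunct2[OF R]]
    and reg = conjunct2[OF conjunct2[OF R], rule_format]
  have "[p] \<cdot>\<^bsub>R\<^esub> \<one>\<^bsub>R\<^esub> = \<zero>\<^bsub>R\<^esub>"
    using assms(3)[unfolded has_characteristic_def, rule_format, of p] by simp
  then interpret regular_char_p R p
    by (intro regular_char_p.intro[OF noetherian_cring.intro[OF cring noeth]
          char_p_cring.intro[OF cring char_p_cring_axioms.intro[OF assms(2)]]
          regular_char_p_axioms.intro[OF reg]])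
  interpret base_change_module R "perfect_closure R p" "perfect_embed R p" L
    by (intro base_change_module.intro perfect_embed_hom assms(4))
  show ?thesis
    by (rule strong_krull_flat_base_change[OF noeth perfect_closure_flat[OF frobenius_flat]])
qed

end
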